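(* Let $P$ be a pinwheel tiling, regarded as an infinite planar graph. Then its chromatic index is $\chi'(P)=8$.
   Context: Pinwheel substitution. The prototile $K$ is the right triangle with side lengths $1,2,\sqrt5$. The substitution $\omega$ expands a tile by $\sqrt5$ and dissects it into five tiles: the expanded tile, placed as the triangle with vertices $(0,0)$ (right angle), $(2,-1)$, $(2,4)$, is dissected into the triangles with vertices $\{(2,-1),(2,0),(0,0)\}$, $\{(0,0),(1,0),(1,2)\}$, $\{(1,0),(2,0),(1,2)\}$, $\{(2,0),(2,2),(1,2)\}$, $\{(1,2),(2,2),(2,4)\}$. The rule is extended to all congruent copies of $K$ (including reflections) and to collections of tiles covariantly. A pinwheel tiling is a tiling $P$ of $\mathbb{R}^2$ by congruent copies of $K$ such that every finite set of tiles of $P$ is contained in a congruent copy of $\omega^n(K)$ for some $n\ge0$. Graph: the vertices are all points that are a corner of at least one tile; the edges are the segments, contained in tile boundaries, joining consecutive vertices (so a tile side containing vertices in its interior is subdivided by them). The chromatic index is the least number of colours in a proper edge colouring (edges sharing an endpoint get different colours). *)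

theory Defs
  imports "HOL-Analysis.Analysis" "HOL-Library.Extended_Nat"
begin

text \<open>The plane is \<^typ>\<open>real \<times> real\<close>, whose library metric is the Euclidean one.\<close>

type_synonym point = "real \<times> real"

definition isometry :: "(point \<Rightarrow> point) \<Rightarrow> bool" where
  "isometry f \<longleftrightarrow> (\<forall>x y. dist (f x) (f y) = dist x y)"

text \<open>The triangle with side lengths \<open>1, 2, \<surd>5\<close>, positioned so that its expansion by
  \<open>\<surd>5\<close> has vertices \<open>(0,0), (2,-1), (2,4)\<close>.\<close>

definition prototile :: "point set" where
  "prototile = convex hull ((\<lambda>x. x /\<^sub>R sqrt 5) ` {(0,0), (2,-1), (2,4)})"

definition is_tile :: "point set \<Rightarrow> bool" where
  "is_tile T \<longleftrightarrow> (\<exists>f. isometry f \<and> T = f ` prototile)"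

definition dissection :: "point set set" where
  "dissection =
    {convex hull {(2,-1), (2,0), (0,0)},
     convex hull {(0,0), (1,0), (1,2)},
     convex hull {(1,0), (2,0), (1,2)},
     convex hull {(2,0), (2,2), (1,2)},
     convex hull {(1,2), (2,2), (2,4)}}"

text \<open>If \<open>T = f ` prototile\<close>, then \<open>x \<mapsto> \<surd>5 f (x / \<surd>5)\<close> is the isometry carrying the standard
  expanded triangle to the expansion \<open>\<surd>5 T\<close>; it transports the dissection. The prototile is
  scalene, so the isometry \<open>f\<close> is uniquely determined by \<open>T\<close>.\<close>

definition subst_tile :: "point set \<Rightarrow> point set set" where
  "subst_tile T =
    {(\<lambda>x. sqrt 5 *\<^sub>R f (x /\<^sub>R sqrt 5)) ` S | f S.
       isometry f \<and> f ` prototile = T \<and> S \<in> dissection}"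

definition subst :: "point set set \<Rightarrow> point set set" where
  "subst C = (\<Union>T\<in>C. subst_tile T)"

definition supertile :: "nat \<Rightarrow> point set set" where
  "supertile n = (subst ^^ n) {prototile}"

definition tiling :: "point set set \<Rightarrow> bool" where
  "tiling P \<longleftrightarrow> (\<forall>T\<in>P. is_tile T) \<and> \<Union>P = UNIV \<and>
     (\<forall>S\<in>P. \<forall>T\<in>P. S \<noteq> T \<longrightarrow> interior S \<inter> interior T = {})"

definition pinwheel_tiling :: "point set set \<Rightarrow> bool" where
  "pinwheel_tiling P \<longleftrightarrow> tiling P \<and>
     (\<forall>F. finite F \<and> F \<subseteq> P \<longrightarrow>
        (\<exists>n f. isometry f \<and> F \<subseteq> (\<lambda>T. f ` T) ` supertile n))"

definition tiling_vertices :: "point set set \<Rightarrow> point set" where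
  "tiling_vertices P = {v. \<exists>T\<in>P. v extreme_point_of T}"

text \<open>An edge is represented by the pair of its end points.\<close>

definition tiling_edges :: "point set set \<Rightarrow> point set set" where
  "tiling_edges P =
    {{u, v} | u v. u \<in> tiling_vertices P \<and> v \<in> tiling_vertices P \<and> u \<noteq> v \<and>
       (\<exists>T\<in>P. closed_segment u v \<subseteq> frontier T) \<and>
       open_segment u v \<inter> tiling_vertices P = {}}"

definition proper_edge_colouring :: "'a set set \<Rightarrow> ('a set \<Rightarrow> 'c) \<Rightarrow> bool" where
  "proper_edge_colouring E c \<longleftrightarrow>
     (\<forall>e\<in>E. \<forall>e'\<in>E. e \<noteq> e' \<and> e \<inter> e' \<noteq> {} \<longrightarrow> c e \<noteq> c e')"

text \<open>The value is \<open>\<infinity>\<close> if no finite number of colours suffices.\<close>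

definition chromatic_index :: "'a set set \<Rightarrow> enat" where
  "chromatic_index E =
     Inf {enat k | k. \<exists>c :: 'a set \<Rightarrow> nat. c ` E \<subseteq> {..<k} \<and> proper_edge_colouring E c}"

end

theory Submission
  imports Defs
begin

text \<open>
  A right angle is dissected into the two acute angles of the tile, and the acute angles are kept.
  Hence counting both acute angles as \<open>45\<close> degrees is as consistent as counting them correctly, and
  a vertex meets at most eight tiles. The mirror image of a tile across its long leg, as in the
  dissection, produces a vertex of degree eight, so eight colours are necessary.

  For the converse it suffices, by compactness, to colour finite supertiles. The edges of a
  supertile are described by the roles which they play in its decomposition into supertiles of
  level one. Ordered by these roles, every new edge but those of one kind meets at most seven
  earlier edges and can be coloured greedily. The exception is the common long leg of two
  mirrored tiles: one of its ends then carries a single coloured edge, and a Kempe chain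
  argument applies.
\<close>

section \<open>Edge colourings of finite and infinite graphs\<close>

text \<open>Tiles occur in infinitely many directions, so the weight turns incidence into integer
  arithmetic in affine coordinates: it is 8 inside a tile, 4 inside a side and less than 4 at a
  corner. A bound on the sum of weights at a point then serves at once as disjointness of interiors,
  as the fact that two straight angles leave no room for a vertex, and as the degree bound.

  An edge can be coloured greedily with eight colours if the degrees of its ends, in the graph
  reached so far, add up to at most 9. Full degrees reach 8, so many edges must be inserted while
  one end is nearly bare. The obstacle is the point \<open>v0\<close> inside a supertile of level
  one: two of its three edges lead to points for which only the bound 8 is available, the
  right-angled corner and the centre of the long leg, and each of them would have to come first at
  \<open>v0\<close>. The second one faces the sum 8 + 2. The chain argument gains the missing colour
  by recolouring, if necessary, the edge from the centre of the long leg to the foot of the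
  altitude, whose final degree is at most 6.\<close>

definition edge_colourable :: "'a set set \<Rightarrow> nat \<Rightarrow> bool" where
  "edge_colourable E k \<longleftrightarrow>
     (\<exists>c :: 'a set \<Rightarrow> nat. c ` E \<subseteq> {..<k} \<and> proper_edge_colouring E c)"

definition deg :: "'a set set \<Rightarrow> 'a \<Rightarrow> nat" where
  "deg E v = card {e \<in> E. v \<in> e}"

lemma deg_mono: "finite F \<Longrightarrow> E \<subseteq> F \<Longrightarrow> deg E v \<le> deg F v"
  unfolding deg_def by (intro card_mono) auto

lemma edge_colourable_subset: "edge_colourable F k \<Longrightarrow> E \<subseteq> F \<Longrightarrow> edge_colourable E k"
  unfolding edge_colourable_def proper_edge_colouring_def by (meson image_mono subset_iff)

lemma edge_colourable_insert:
  assumes "finite E" "edge_colourable E k" "card {e' \<in> E. e' \<inter> e \<noteq> {}} < k" 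
  shows "edge_colourable (insert e E) k"
proof (cases "e \<in> E")
  case True
  then show ?thesis using assms by (simp add: insert_absorb)
next
  case False
  obtain c :: "'a set \<Rightarrow> nat" where c: "c ` E \<subseteq> {..<k}" "proper_edge_colouring E c"
    using assms(2) unfolding edge_colourable_def by blast
  let ?N = "{e' \<in> E. e' \<inter> e \<noteq> {}}"
  have "card (c ` ?N) < k"
    using assms(1,3) card_image_le[of ?N c] by simp
  then have "\<not> {..<k} \<subseteq> c ` ?N"
    using assms(1) card_mono[of "c ` ?N" "{..<k}"] by auto
  then obtain \<delta> where d: "\<delta> < k" "\<delta> \<notin> c ` ?N" by blast
  have "(c(e := \<delta>)) ` insert e E \<subseteq> {..<k}"
    using c(1) d(1) False by auto
  moreover have "proper_edge_colouring (insert e E) (c(e := \<delta>))"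
    using c(2) d(2) False unfolding proper_edge_colouring_def
    by (auto simp: Int_commute)
  ultimately show ?thesis unfolding edge_colourable_def by blast
qed

text \<open>The edge \<open>e\<close> itself is counted in both degrees, hence the 2.\<close>

lemma card_adjacent_edges:
  assumes "finite K" "e \<in> K" "e = {x,y}" "x \<noteq> y"
  shows "card {e' \<in> K - {e}. e' \<inter> e \<noteq> {}} + 2 \<le> deg K x + deg K y"
proof -
  let ?X = "{e' \<in> K. x \<in> e'}" and ?Y = "{e' \<in> K. y \<in> e'}"
  have "{e' \<in> K - {e}. e' \<inter> e \<noteq> {}} \<subseteq> (?X - {e}) \<union> (?Y - {e})"
    using assms(3) by auto
  then have "card {e' \<in> K - {e}. e' \<inter> e \<noteq> {}} \<le> card ((?X - {e}) \<union> (?Y - {e}))"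
    using assms(1) by (intro card_mono) auto
  also have "\<dots> \<le> card (?X - {e}) + card (?Y - {e})" by (rule card_Un_le)
  finally have 1: "card {e' \<in> K - {e}. e' \<inter> e \<noteq> {}} \<le> card (?X - {e}) + card (?Y - {e})" .
  have "e \<in> ?X" "e \<in> ?Y" using assms by auto
  then have "card (?X - {e}) + 1 = card ?X" "card (?Y - {e}) + 1 = card ?Y"
    using assms(1) card_Suc_Diff1[of ?X e] card_Suc_Diff1[of ?Y e] by auto
  then show ?thesis using 1 unfolding deg_def by linarith
qed

text \<open>Degrees are taken in the final graph, so the order in which \<open>B\<close> is coloured
  is irrelevant. A degree sum of \<open>k\<close> + 1 leaves at most \<open>k\<close> - 1 adjacent
  edges, hence a free colour.\<close>

lemma edge_colourable_greedy:
  assumes "finite A" "finite B" "edge_colourable A k"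
    and deg: "\<And>e. e \<in> B \<Longrightarrow> \<exists>x y. e = {x,y} \<and> x \<noteq> y \<and> deg (A \<union> B) x + deg (A \<union> B) y \<le> Suc k"
  shows "edge_colourable (A \<union> B) k"
proof -
  have "edge_colourable (A \<union> B') k" if "finite B'" "B' \<subseteq> B" for B'
    using that
  proof (induction B')
    case empty
    then show ?case using assms by simp
  next
    case (insert e B')
    show ?case
    proof (cases "e \<in> A \<union> B'")
      case True
      then show ?thesis using insert by (simp add: insert_absorb)
    next
      case False
      obtain x y where xy: "e = {x,y}" "x \<noteq> y" "deg (A \<union> B) x + deg (A \<union> B) y \<le> Suc k"
        using deg[of e] insert.prems by auto
      have fin: "finite (A \<union> B)" using assms by auto
      have sub: "insert e (A \<union> B') \<subseteq> A \<union> B" using insert.prems by auto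
      then have "deg (insert e (A \<union> B')) x + deg (insert e (A \<union> B')) y \<le> Suc k"
        using deg_mono[OF fin sub, of x] deg_mono[OF fin sub, of y] xy by linarith
      moreover have "finite (insert e (A \<union> B'))" using sub fin by (rule finite_subset)
      moreover have "insert e (A \<union> B') - {e} = A \<union> B'" using False by auto
      ultimately have "card {e' \<in> A \<union> B'. e' \<inter> e \<noteq> {}} < k"
        using card_adjacent_edges[of "insert e (A \<union> B')" e x y] xy(1,2) by simp
      then have "edge_colourable (insert e (A \<union> B')) k"
        using insert sub fin by (intro edge_colourable_insert) (auto intro: finite_subset)
      then show ?thesis by simp
    qed
  qed
  then show ?thesis using assms by blast
qed

section \<open>Kempe chains as orbits of two involutions\<close>

text \<open>The composition of the two involutions rotates the orbit of \<open>x\<close>, and a rotation of odd order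
  conjugates at most one point to a fixed point of \<open>\<beta>\<close>. This replaces the argument that a Kempe
  chain has at most two ends.\<close>

lemma dihedral_orbit:
  fixes \<alpha> \<beta> :: "'a \<Rightarrow> 'a"
  assumes inv: "\<And>v. \<alpha> (\<alpha> v) = v" "\<And>v. \<beta> (\<beta> v) = v"
    and fin: "finite S" "x \<in> S" "\<alpha> ` S \<subseteq> S" "\<beta> ` S \<subseteq> S"
    and fixed: "\<alpha> x = x" "\<beta> y = y" "\<beta> w = w" "y \<noteq> w"
  shows "\<exists>K. x \<in> K \<and> \<alpha> ` K \<subseteq> K \<and> \<beta> ` K \<subseteq> K \<and> (y \<notin> K \<or> w \<notin> K)"
proof -
  define \<rho> where "\<rho> = \<alpha> \<circ> \<beta>"
  define \<sigma> where "\<sigma> = \<beta> \<circ> \<alpha>"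
  have injr: "inj \<rho>" unfolding \<rho>_def
    by (metis comp_apply injI inv)
  have injn: "inj (\<rho> ^^ n)" for n using injr by (rule inj_fn)
  have "(\<rho> ^^ k) x \<in> S" for k
    by (induction k) (use fin in \<open>auto simp: \<rho>_def\<close>)
  then have "range (\<lambda>k. (\<rho> ^^ k) x) \<subseteq> S" by auto
  then have "\<not> inj (\<lambda>k. (\<rho> ^^ k) x)"
    using fin(1) finite_subset infinite_UNIV_nat finite_imageD by blast
  then obtain i j where ij: "i < j" "(\<rho> ^^ i) x = (\<rho> ^^ j) x"
    unfolding inj_def by (metis linorder_neqE_nat)
  then have "(\<rho> ^^ i) x = (\<rho> ^^ i) ((\<rho> ^^ (j - i)) x)"
    by (metis add_diff_inverse_nat comp_apply funpow_add less_imp_not_less)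
  then have "(\<rho> ^^ (j - i)) x = x" using injn injD by metis
  with ij obtain N where N: "N > 0" "(\<rho> ^^ N) x = x" by (metis zero_less_diff)
  have Nk: "(\<rho> ^^ (N * k)) x = x" for k
    by (induction k) (simp_all add: funpow_add N)
  have sr: "(\<sigma> ^^ k) ((\<rho> ^^ k) v) = v" for k v
  proof (induction k arbitrary: v)
    case (Suc k)
    have "(\<sigma> ^^ Suc k) ((\<rho> ^^ Suc k) v) = \<sigma> ((\<sigma> ^^ k) ((\<rho> ^^ k) (\<rho> v)))"
      by (simp add: funpow_swap1)
    also have "\<dots> = \<sigma> (\<rho> v)" by (simp only: Suc)
    also have "\<dots> = v" by (simp add: \<rho>_def \<sigma>_def inv)
    finally show ?case .
  qed simp
  have sg: "\<sigma> v = \<beta> (\<alpha> v)" for v by (simp add: \<sigma>_def)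
  have ar: "\<alpha> ((\<rho> ^^ k) v) = (\<sigma> ^^ k) (\<alpha> v)" for k v
  proof (induction k)
    case (Suc k)
    have "\<alpha> ((\<rho> ^^ Suc k) v) = \<beta> (\<alpha> (\<alpha> ((\<rho> ^^ k) v)))" by (simp add: \<rho>_def inv)
    also have "\<dots> = \<sigma> ((\<sigma> ^^ k) (\<alpha> v))" by (simp only: Suc) (rule sg[symmetric])
    finally show ?case by simp
  qed simp
  define K where "K = range (\<lambda>k. (\<rho> ^^ k) x)"
  \<comment> \<open>\<open>\<sigma>\<close> is the inverse of \<open>\<rho>\<close>, and the orbit
    of \<open>x\<close> has finite period \<open>N\<close>; so negative powers of
    \<open>\<rho>\<close> stay in \<open>K\<close>.\<close>
  have sK: "(\<sigma> ^^ k) x \<in> K" for k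
  proof -
    have "k \<le> N * k" using N by simp
    then have "(\<rho> ^^ (N * k)) x = (\<rho> ^^ k) ((\<rho> ^^ (N * k - k)) x)"
      by (metis comp_apply funpow_add le_add_diff_inverse)
    then have "(\<sigma> ^^ k) x = (\<rho> ^^ (N * k - k)) x" using Nk[of k] sr by metis
    then show ?thesis unfolding K_def by auto
  qed
  have aK: "\<alpha> v \<in> K" if "v \<in> K" for v
    using that sK ar fixed(1) unfolding K_def by auto
  have rK: "\<rho> v \<in> K" if "v \<in> K" for v
    using that unfolding K_def by (auto simp: image_iff) (metis comp_apply funpow.simps(2))
  have bK: "\<beta> v \<in> K" if "v \<in> K" for v
  proof -
    have "\<beta> v = \<alpha> (\<rho> v)" by (simp add: \<rho>_def inv)
    then show ?thesis using aK rK that by simp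
  qed
  \<comment> \<open>\<open>\<alpha>\<close> conjugates \<open>\<rho>\<close> to its inverse and
    fixes \<open>x\<close>, so the power of exponent \<open>k\<close> + 1 and the one of exponent
    -\<open>k\<close> agree at \<open>x\<close>.\<close>
  have odd_period: "(\<rho> ^^ (2*k+1)) x = x" if "\<beta> ((\<rho> ^^ k) x) = (\<rho> ^^ k) x" for k
  proof -
    have "\<rho> ((\<rho> ^^ k) x) = (\<sigma> ^^ k) x"
      using that ar[of k x] fixed(1) by (simp add: \<rho>_def)
    moreover have "(\<rho> ^^ k) ((\<sigma> ^^ k) x) = x"
    proof -
      obtain l where l: "(\<sigma> ^^ k) x = (\<rho> ^^ l) x" using sK[of k] unfolding K_def by auto
      have "(\<sigma> ^^ k) ((\<rho> ^^ k) ((\<rho> ^^ l) x)) = (\<rho> ^^ l) x" by (rule sr)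
      then have "(\<sigma> ^^ k) ((\<rho> ^^ k) ((\<sigma> ^^ k) x)) = (\<sigma> ^^ k) x" using l by simp
      moreover have "inj \<sigma>" unfolding \<sigma>_def by (metis comp_apply injI inv)
      ultimately show ?thesis by (meson inj_fn injD)
    qed
    ultimately have "(\<rho> ^^ k) (\<rho> ((\<rho> ^^ k) x)) = x" by simp
    then show ?thesis
      by (metis add.commute comp_apply funpow_add funpow_swap1 mult_2 plus_1_eq_Suc funpow.simps(2))
  qed
  have "y = w" if "y \<in> K" "w \<in> K"
  proof -
    obtain k j where kj: "y = (\<rho> ^^ k) x" "w = (\<rho> ^^ j) x" using \<open>y \<in> K\<close> \<open>w \<in> K\<close> unfolding K_def by auto
    have per: "(\<rho> ^^ (2*k+1)) x = x" "(\<rho> ^^ (2*j+1)) x = x"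
      using odd_period fixed kj by auto
    define L where "L = (LEAST n. n > 0 \<and> (\<rho> ^^ n) x = x)"
    have L: "L > 0" "(\<rho> ^^ L) x = x" using LeastI[of "\<lambda>n. n > 0 \<and> (\<rho> ^^ n) x = x" N] N
      unfolding L_def by auto
    have Lmin: "L dvd n" if "(\<rho> ^^ n) x = x" for n
    proof (rule ccontr)
      assume "\<not> L dvd n"
      then have "n mod L > 0" by (simp add: mod_greater_zero_iff_not_dvd)
      moreover have "(\<rho> ^^ (n mod L)) x = x" using funpow_mod_eq[OF L(2), of n] that by simp
      ultimately have "L \<le> n mod L" unfolding L_def by (intro Least_le) auto
      then show False using L(1) mod_less_divisor[of L n] by linarith
    qed
    \<comment> \<open>The least period divides an odd number, so it is odd, and the factor 2 cancels
      from 2 * (\<open>k\<close> - \<open>j\<close>).\<close>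
    have d1: "int L dvd 2 * int k + 1" "int L dvd 2 * int j + 1"
      using Lmin[OF per(1)] Lmin[OF per(2)] by (auto simp: add.commute simp flip: int_dvd_int_iff)
    then have "int L dvd (2 * int k + 1) - (2 * int j + 1)" by (rule dvd_diff)
    then have "int L dvd 2 * (int k - int j)" by (simp add: algebra_simps)
    moreover have "coprime (int L) 2"
      using d1(1) by (metis coprime_right_2_iff_odd dvd_trans even_plus_one_iff dvd_triv_left odd_one add.commute)
    ultimately have "int L dvd int k - int j" using coprime_dvd_mult_right_iff by blast
    then have "k mod L = j mod L"
      by (metis mod_eq_dvd_iff of_nat_eq_iff zmod_int)
    then show ?thesis using funpow_mod_eq[OF L(2)] kj by metis
  qed
  moreover have "x \<in> K" unfolding K_def by (metis funpow_0 rangeI)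
  ultimately show ?thesis using aK bK fixed by blast
qed

lemma proper_edge_colouring_unique:
  "proper_edge_colouring E c \<Longrightarrow> e \<in> E \<Longrightarrow> e' \<in> E \<Longrightarrow> v \<in> e \<Longrightarrow> v \<in> e' \<Longrightarrow> c e = c e' \<Longrightarrow> e = e'"
  unfolding proper_edge_colouring_def by blast

definition misses :: "'a set set \<Rightarrow> ('a set \<Rightarrow> 'c) \<Rightarrow> 'c \<Rightarrow> 'a \<Rightarrow> bool" where
  "misses E c \<delta> v \<longleftrightarrow> (\<forall>e\<in>E. v \<in> e \<longrightarrow> c e \<noteq> \<delta>)"

lemma misses_ex:
  assumes "finite E" "deg E v < k"
  shows "\<exists>\<delta><k. misses E c \<delta> v"
proof -
  have "card (c ` {e \<in> E. v \<in> e}) < k"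
    using assms card_image_le[of "{e \<in> E. v \<in> e}" c] unfolding deg_def by simp
  then have "\<not> {..<k} \<subseteq> c ` {e \<in> E. v \<in> e}"
    using assms(1) card_mono[of "c ` {e \<in> E. v \<in> e}" "{..<k}"] by auto
  then show ?thesis unfolding misses_def by blast
qed

lemma edge_colourable_extend:
  assumes "proper_edge_colouring E c" "c ` E \<subseteq> {..<k}" "{x,y} \<notin> E"
    and "\<delta> < k" "misses E c \<delta> x" "misses E c \<delta> y"
  shows "edge_colourable (insert {x,y} E) k"
proof -
  have "(c({x,y} := \<delta>)) ` insert {x,y} E \<subseteq> {..<k}" using assms by auto
  moreover have "proper_edge_colouring (insert {x,y} E) (c({x,y} := \<delta>))"
    using assms unfolding proper_edge_colouring_def misses_def by auto
  ultimately show ?thesis unfolding edge_colourable_def by blast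
qed

text \<open>Giving \<open>{x,w}\<close> the colour \<open>\<delta>\<close> frees its old colour at
  \<open>x\<close>; that colour is also free at \<open>y\<close> and goes to the new edge.\<close>

lemma edge_colourable_shift:
  assumes "proper_edge_colouring E c" "c ` E \<subseteq> {..<k}" "{x,y} \<notin> E"
    and "{x,w} \<in> E" "w \<noteq> y" "x \<noteq> y"
    and "\<delta> < k" "misses E c \<delta> x" "misses E c \<delta> w" "misses E c (c {x,w}) y"
  shows "edge_colourable (insert {x,y} E) k"
proof (rule edge_colourable_extend)
  let ?c = "c({x,w} := \<delta>)"
  show "proper_edge_colouring E ?c"
    using assms(1,8,9) unfolding proper_edge_colouring_def misses_def by auto
  show "?c ` E \<subseteq> {..<k}" using assms(2,7) by auto
  show "c {x,w} < k" using assms(2,4) by auto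
  show "misses E ?c (c {x,w}) x"
    unfolding misses_def
  proof (intro ballI impI)
    fix e assume e: "e \<in> E" "x \<in> e"
    show "?c e \<noteq> c {x,w}"
    proof (cases "e = {x,w}")
      case True
      then show ?thesis using assms(4,8) unfolding misses_def by fastforce
    next
      case False
      then show ?thesis using proper_edge_colouring_unique[OF assms(1) e(1) assms(4) e(2)] by auto
    qed
  qed
  show "misses E ?c (c {x,w}) y"
    using assms(5,6,10) unfolding misses_def by auto
qed (use assms in auto)

text \<open>Having at most one coloured edge, \<open>y\<close> misses all colours or all but
  \<open>\<delta>\<close>, where \<open>\<delta>\<close> is free at \<open>x\<close>. In the second
  case, with \<open>\<gamma>\<close> free at \<open>w\<close>, exchanging \<open>\<delta>\<close>
  and \<open>\<gamma>\<close> on the chain of \<open>x\<close> makes \<open>\<gamma>\<close> free at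
  \<open>x\<close>. The chain cannot contain both \<open>y\<close> and \<open>w\<close>, so
  \<open>\<gamma>\<close> stays free at one of them: at \<open>y\<close> it colours the new edge, at
  \<open>w\<close> it permits a shift.\<close>

lemma edge_colourable_kempe:
  fixes E :: "'a set set"
  assumes fin: "finite E" and col: "edge_colourable E k" and card2: "\<And>e. e \<in> E \<Longrightarrow> card e = 2"
    and xy: "x \<noteq> y" "{x,y} \<notin> E" "deg E x < k" "deg E y \<le> 1"
    and w: "w \<noteq> y" "{x,w} \<in> E" "deg E w < k"
  shows "edge_colourable (insert {x,y} E) k"
proof -
  obtain c :: "'a set \<Rightarrow> nat" where c: "c ` E \<subseteq> {..<k}" "proper_edge_colouring E c"
    using col unfolding edge_colourable_def by blast
  obtain \<delta> where \<delta>: "\<delta> < k" "misses E c \<delta> x" using misses_ex[OF fin xy(3)] by blast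
  obtain \<gamma> where \<gamma>: "\<gamma> < k" "misses E c \<gamma> w" using misses_ex[OF fin w(3)] by blast
  define \<epsilon> where "\<epsilon> = c {x,w}"
  have eps: "\<epsilon> \<noteq> \<delta>" "\<epsilon> \<noteq> \<gamma>"
    using \<delta>(2) \<gamma>(2) w(2) unfolding misses_def \<epsilon>_def by simp_all
  show ?thesis
  proof (cases "misses E c \<delta> y")
    case True
    then show ?thesis using edge_colourable_extend[OF c(2,1) xy(2) \<delta>] by simp
  next
    case False
    then obtain e0 where e0: "e0 \<in> E" "y \<in> e0" "c e0 = \<delta>" unfolding misses_def by auto
    have "e = e0" if "e \<in> E" "y \<in> e" for e
    proof -
      have "card {e \<in> E. y \<in> e} \<le> Suc 0" using xy(4) unfolding deg_def by simp
      then have "\<forall>a\<in>{e \<in> E. y \<in> e}. \<forall>b\<in>{e \<in> E. y \<in> e}. a = b"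
        using fin card_le_Suc0_iff_eq[of "{e \<in> E. y \<in> e}"] by simp
      then show ?thesis using that e0 by blast
    qed
    then have ymiss: "misses E c \<zeta> y" if "\<zeta> \<noteq> \<delta>" for \<zeta>
      using that e0 unfolding misses_def by blast
    show ?thesis
    proof (cases "\<gamma> = \<delta>")
      case True
      then show ?thesis
        using edge_colourable_shift[OF c(2,1) xy(2) w(2,1) xy(1) \<delta>] \<gamma>(2) ymiss[OF eps(1)]
        unfolding \<epsilon>_def by simp
    next
      case gd: False
      \<comment> \<open>The partner across the edge of colour \<open>a\<close>. A vertex without
        such an edge is its own partner, so that \<open>pr a\<close> is a total involution fixing
        exactly the vertices that miss \<open>a\<close>.\<close>
      define pr where "pr a v = (if \<exists>u. {v,u} \<in> E \<and> c {v,u} = a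
        then SOME u. {v,u} \<in> E \<and> c {v,u} = a else v)" for a v
      have ne: "u \<noteq> v" if "{v,u} \<in> E" for u v
        using card2[OF that] by (auto simp: card_insert_if split: if_splits)
      have uniq: "u = u'" if "{v,u} \<in> E" "{v,u'} \<in> E" "c {v,u} = c {v,u'}" for v u u'
      proof -
        have "{v,u} = {v,u'}"
          by (rule proper_edge_colouring_unique[OF c(2) that(1,2) _ _ that(3), of v]) simp_all
        then show ?thesis by (auto simp: doubleton_eq_iff)
      qed
      have pr1: "pr a v = u" if "{v,u} \<in> E" "c {v,u} = a" for a u v
      proof -
        have "{v, pr a v} \<in> E \<and> c {v, pr a v} = a"
          unfolding pr_def using that by (auto intro: someI2)
        then show ?thesis using uniq that by metis
      qed
      have pr0: "pr a v = v" if "\<not> (\<exists>u. {v,u} \<in> E \<and> c {v,u} = a)" for a v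
        using that unfolding pr_def by auto
      have inv: "pr a (pr a v) = v" for a v
      proof (cases "\<exists>u. {v,u} \<in> E \<and> c {v,u} = a")
        case True
        then obtain u where "{v,u} \<in> E" "c {v,u} = a" by blast
        then show ?thesis using pr1[of v u a] pr1[of u v a] by (simp add: insert_commute)
      qed (simp add: pr0)
      have misspr: "pr a v = v" if "misses E c a v" for a v
        using that pr0 unfolding misses_def by blast
      define S where "S = insert x (\<Union>E)"
      have "finite e" if "e \<in> E" for e using card2[OF that] by (auto intro: card_ge_0_finite)
      then have "finite S" unfolding S_def using fin by simp
      moreover have "pr a ` S \<subseteq> S" for a
      proof
        fix z assume "z \<in> pr a ` S"
        then obtain v where v: "v \<in> S" "z = pr a v" by auto
        show "z \<in> S"
        proof (cases "\<exists>u. {v,u} \<in> E \<and> c {v,u} = a")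
          case True
          then obtain u where "{v,u} \<in> E" "c {v,u} = a" by blast
          then show ?thesis using pr1[of v u a] v(2) unfolding S_def by auto
        next
          case False
          then show ?thesis using pr0[of v a] v by simp
        qed
      qed
      moreover have "x \<in> S" unfolding S_def by simp
      ultimately obtain K where K: "x \<in> K" "pr \<delta> ` K \<subseteq> K" "pr \<gamma> ` K \<subseteq> K" "y \<notin> K \<or> w \<notin> K"
        using dihedral_orbit[OF inv inv _ _ _ _ misspr[OF \<delta>(2)] misspr[OF ymiss[OF gd]]
            misspr[OF \<gamma>(2)] w(1)[symmetric], of S] by metis
      have Kcl: "v \<in> K" if ecv: "e \<in> E" "c e = \<delta> \<or> c e = \<gamma>" "e \<inter> K \<noteq> {}" "v \<in> e" for e v
      proof -
        obtain u where u: "u \<in> e" "u \<in> K" using ecv(3) by blast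
        show ?thesis
        proof (cases "u = v")
          case False
          then have "e = {u,v}" using card2[OF ecv(1)] u ecv(4) by (auto simp: card_2_iff)
          then have "v = pr \<delta> u \<or> v = pr \<gamma> u" using ecv(1,2) pr1[of u v] by metis
          then show ?thesis using K(2,3) u(2) by blast
        qed (use u in auto)
      qed
      define f where "f = (\<lambda>a. if a = \<delta> then \<gamma> else if a = \<gamma> then \<delta> else a)"
      have finj: "f a = f b \<longleftrightarrow> a = b" for a b unfolding f_def by auto
      define c' where "c' e = (if e \<inter> K \<noteq> {} then f (c e) else c e)" for e
      have c'eq: "c' e = c e" if "e \<in> E" "v \<in> e" "v \<notin> K" for e v
      proof -
        have "e \<inter> K = {} \<or> c e \<noteq> \<delta> \<and> c e \<noteq> \<gamma>" using Kcl[OF that(1) _ _ that(2)] that(3) by blast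
        then show ?thesis unfolding c'_def f_def by auto
      qed
      have pc': "proper_edge_colouring E c'"
        unfolding proper_edge_colouring_def
      proof (intro ballI impI)
        fix e e' assume e: "e \<in> E" "e' \<in> E" "e \<noteq> e' \<and> e \<inter> e' \<noteq> {}"
        then obtain v where v: "v \<in> e" "v \<in> e'" by blast
        have ce: "c e \<noteq> c e'" using proper_edge_colouring_unique[OF c(2) e(1,2) v] e(3) by blast
        show "c' e \<noteq> c' e'"
        proof (cases "v \<in> K")
          case True
          then have "c' e = f (c e)" "c' e' = f (c e')" using v unfolding c'_def by auto
          then show ?thesis using ce finj by simp
        next
          case False
          then show ?thesis using c'eq[OF e(1) v(1)] c'eq[OF e(2) v(2)] ce by simp
        qed
      qed
      have rc': "c' ` E \<subseteq> {..<k}" using c(1) \<delta> \<gamma> unfolding c'_def f_def by auto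
      have xm: "misses E c' \<gamma> x"
        using \<delta>(2) K(1) unfolding misses_def c'_def f_def by auto
      have ym: "misses E c' (c' {x,w}) y"
      proof -
        have "c' {x,w} = \<epsilon>" using eps unfolding c'_def f_def \<epsilon>_def by auto
        moreover have "misses E c' \<epsilon> y"
          using ymiss[OF eps(1)] eps unfolding misses_def c'_def f_def by auto
        ultimately show ?thesis by simp
      qed
      have keep: "misses E c' \<gamma> v" if "misses E c \<gamma> v" "v \<notin> K" for v
        using that c'eq unfolding misses_def by metis
      have "misses E c' \<gamma> y \<or> misses E c' \<gamma> w"
        using K(4) keep[OF \<gamma>(2)] keep[OF ymiss[OF gd]] by blast
      then show ?thesis
        using edge_colourable_extend[OF pc' rc' xy(2) \<gamma>(1) xm]
          edge_colourable_shift[OF pc' rc' xy(2) w(2,1) xy(1) \<gamma>(1) xm _ ym] by (elim disjE) simp_all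
    qed
  qed
qed

text \<open>The degree bounds include the edge to be inserted; before its insertion they drop to
  less than \<open>k\<close> at \<open>x\<close> and at most 1 at \<open>y\<close>.\<close>

lemma edge_colourable_kempe_set:
  assumes "finite A" "finite B" "edge_colourable A k" and card2: "\<And>e. e \<in> A \<union> B \<Longrightarrow> card e = 2"
    and deg: "\<And>e. e \<in> B \<Longrightarrow> \<exists>x y w. e = {x,y} \<and> x \<noteq> y \<and> deg (A \<union> B) x \<le> k \<and> deg (A \<union> B) y \<le> 2
      \<and> w \<noteq> y \<and> {x,w} \<in> A \<and> deg (A \<union> B) w < k"
  shows "edge_colourable (A \<union> B) k"
proof -
  have "edge_colourable (A \<union> B') k" if "finite B'" "B' \<subseteq> B" for B'
    using that
  proof (induction B')
    case empty
    then show ?case using assms by simp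
  next
    case (insert e B')
    show ?case
    proof (cases "e \<in> A \<union> B'")
      case True
      then show ?thesis using insert by (simp add: insert_absorb)
    next
      case False
      obtain x y w where xy: "e = {x,y}" "x \<noteq> y" "deg (A \<union> B) x \<le> k" "deg (A \<union> B) y \<le> 2"
        and w: "w \<noteq> y" "{x,w} \<in> A" "deg (A \<union> B) w < k"
        using deg[of e] insert.prems by auto
      have fin: "finite (A \<union> B)" using assms by auto
      have sub: "A \<union> B' \<subseteq> A \<union> B - {e}" "A \<union> B - {e} \<subseteq> A \<union> B" "e \<in> A \<union> B"
        using insert.prems False by auto
      have less: "deg (A \<union> B') v < deg (A \<union> B) v" if "v \<in> e" for v
        unfolding deg_def using sub that fin by (intro psubset_card_mono) auto
      have "edge_colourable (insert {x,y} (A \<union> B')) k"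
      proof (rule edge_colourable_kempe)
        show "finite (A \<union> B')" using insert assms by auto
        show "edge_colourable (A \<union> B') k" using insert by auto
        show "card e = 2" if "e \<in> A \<union> B'" for e using that card2 insert.prems by auto
        show "{x,w} \<in> A \<union> B'" using w by simp
        have "A \<union> B' \<subseteq> A \<union> B" using sub by blast
        then show "deg (A \<union> B') w < k" using w(3) deg_mono[OF fin, of "A \<union> B'" w] by linarith
      qed (use xy w False less[of x] less[of y] in auto)
      then show ?thesis using xy by simp
    qed
  qed
  then show ?thesis using assms by blast
qed

section \<open>Compactness\<close>

text \<open>By Tychonoff the assignments of \<open>k\<close> colours form a compact product of
  finite discrete spaces, and every pair of adjacent edges imposes a closed condition.\<close>

lemma edge_colourable_compactness:
  assumes "\<And>F. finite F \<Longrightarrow> F \<subseteq> E \<Longrightarrow> edge_colourable F k"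
  shows "edge_colourable E k"
proof -
  define X where "X = product_topology (\<lambda>e :: 'a set. discrete_topology {..<k}) E"
  have tX: "topspace X = PiE E (\<lambda>e. {..<k})" unfolding X_def by simp
  define Z where "Z e e' = {c \<in> topspace X. c e \<noteq> c e'}" for e e'
  define I where "I = {(e,e'). e \<in> E \<and> e' \<in> E \<and> e \<noteq> e' \<and> e \<inter> e' \<noteq> {}}"
  have cX: "compact_space X" unfolding X_def
    by (simp add: compact_space_product_topology compact_space_discrete_topology)
  have closed: "closedin X (Z e e')" if "(e,e') \<in> I" for e e'
  proof -
    have cont: "continuous_map X (discrete_topology {..<k}) (\<lambda>c. c d)" if "d \<in> E" for d
      unfolding X_def using that by (rule continuous_map_product_projection)
    have e: "e \<in> E" "e' \<in> E" using that unfolding I_def by auto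
    have "Z e e' = (\<Union>i\<in>{..<k}. {c \<in> topspace X. c e \<in> {i}} \<inter> {c \<in> topspace X. c e' \<in> {..<k} - {i}})"
      unfolding Z_def using e tX by (auto simp: PiE_iff)
    also have "closedin X \<dots>"
    proof (intro closedin_Union closedin_Int)
      show "closedin X S" if S: "S \<in> (\<lambda>i. {c \<in> topspace X. c e \<in> {i}} \<inter> {c \<in> topspace X. c e' \<in> {..<k} - {i}}) ` {..<k}" for S
      proof -
        obtain i where i: "i \<in> {..<k}"
          "S = {c \<in> topspace X. c e \<in> {i}} \<inter> {c \<in> topspace X. c e' \<in> {..<k} - {i}}"
          using S by (elim imageE)
        have "closedin X {c \<in> topspace X. c e \<in> {i}}"
          using closedin_continuous_map_preimage[OF cont[OF e(1)], of "{i}"] i(1) by simp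
        moreover have "closedin X {c \<in> topspace X. c e' \<in> {..<k} - {i}}"
          using closedin_continuous_map_preimage[OF cont[OF e(2)], of "{..<k} - {i}"] by simp
        ultimately show ?thesis unfolding i(2) by (rule closedin_Int)
      qed
    qed auto
    finally show ?thesis .
  qed
  \<comment> \<open>Adjoining the whole space ensures that a point of the intersection is an
    assignment of colours even if no two edges are adjacent.\<close>
  have "\<Inter>(case_prod Z ` I \<union> {topspace X}) \<noteq> {}"
  proof -
    have fip: "\<Inter>\<F> \<noteq> {}" if F: "finite \<F>" "\<F> \<subseteq> case_prod Z ` I \<union> {topspace X}" for \<F>
    proof -
      obtain J where J: "finite J" "J \<subseteq> I" "\<F> - {topspace X} = case_prod Z ` J"
      proof -
        have "finite (\<F> - {topspace X})" "\<F> - {topspace X} \<subseteq> case_prod Z ` I" using F by auto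
        from finite_subset_image[OF this] show ?thesis by (elim exE conjE) (rule that)
      qed
      define F0 where "F0 = fst ` J \<union> snd ` J"
      have "finite F0" "F0 \<subseteq> E" using J unfolding F0_def I_def by auto
      then obtain c :: "'a set \<Rightarrow> nat" where c: "c ` F0 \<subseteq> {..<k}" "proper_edge_colouring F0 c"
        using assms unfolding edge_colourable_def by blast
      show ?thesis
      \<comment> \<open>Without edges \<open>k\<close> may be 0, and the default colour 0 used below
        would not exist.\<close>
      proof (cases "E = {}")
        case True
        then have "J = {}" using J unfolding I_def by auto
        then have "\<F> \<subseteq> {topspace X}" using J by auto
        moreover have "topspace X \<noteq> {}" using True tX by simp
        ultimately show ?thesis by (metis Inf_empty UNIV_not_empty cInf_singleton subset_singletonD)
      next
        case False
        then obtain e0 where "e0 \<in> E" by blast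
        then have "edge_colourable {e0} k" using assms by simp
        then have "k > 0" unfolding edge_colourable_def by auto
        define d where "d = (\<lambda>e\<in>E. if e \<in> F0 then c e else 0)"
        have d: "d \<in> topspace X"
          using tX c(1) \<open>k > 0\<close> unfolding d_def by (auto simp: image_subset_iff)
        have "d \<in> Z e e'" if "(e,e') \<in> J" for e e'
        proof -
          have e: "e \<in> F0" "e' \<in> F0" using imageI[OF that, of fst] imageI[OF that, of snd]
            unfolding F0_def by simp_all
          have e': "e \<in> E" "e' \<in> E" "e \<noteq> e' \<and> e \<inter> e' \<noteq> {}"
            using that J(2) unfolding I_def by blast+
          have "c e \<noteq> c e'" using c(2) e e'(3) unfolding proper_edge_colouring_def by blast
          then show ?thesis using d e e' unfolding Z_def d_def by simp
        qed
        then have "d \<in> C" if "C \<in> \<F> - {topspace X}" for C using that J(3) by auto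
        then have "d \<in> \<Inter>\<F>" using d by blast
        then show ?thesis by blast
      qed
    qed
    have "\<forall>C\<in>case_prod Z ` I \<union> {topspace X}. closedin X C" using closed by auto
    with cX fip show ?thesis unfolding compact_space_fip by metis
  qed
  then obtain c where c: "c \<in> topspace X" "\<And>e e'. (e,e') \<in> I \<Longrightarrow> c \<in> Z e e'" by auto
  have "c ` E \<subseteq> {..<k}" using c(1) tX by auto
  moreover have "proper_edge_colouring E c"
    using c(2) unfolding proper_edge_colouring_def I_def Z_def by auto
  ultimately show ?thesis unfolding edge_colourable_def by blast
qed

section \<open>Frames and weights\<close>

text \<open>A frame lists the right-angled corner, the end of the short leg and the end of the long leg
  of a tile. Everything is expressed in the affine coordinates of a frame, which makes the
  dissection rational.\<close>

type_synonym frame = "point \<times> point \<times> point"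

definition pt :: "frame \<Rightarrow> real \<Rightarrow> real \<Rightarrow> point" where
  "pt t x y = fst t + x *\<^sub>R (fst (snd t) - fst t) + y *\<^sub>R (snd (snd t) - fst t)"

abbreviation vp :: "frame \<Rightarrow> point" where "vp t \<equiv> pt t 0 0"
abbreviation vq :: "frame \<Rightarrow> point" where "vq t \<equiv> pt t 1 0"
abbreviation vr :: "frame \<Rightarrow> point" where "vr t \<equiv> pt t 0 1"
abbreviation vm :: "frame \<Rightarrow> point" where "vm t \<equiv> pt t 0 (1/2)"

text \<open>The points dividing the hypotenuse into five equal parts, and the centre of the long leg of
  the child \<open>fA\<close> below.\<close>

abbreviation hyp :: "frame \<Rightarrow> real \<Rightarrow> point" where "hyp t k \<equiv> pt t (1 - k/5) (k/5)"
abbreviation v0 :: "frame \<Rightarrow> point" where "v0 t \<equiv> pt t (2/5) (1/10)"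

text \<open>\<open>hyp t 1\<close> is the foot of the altitude from \<open>vp t\<close>, which cuts
  off \<open>fA\<close>. The rest is a triangle of twice the linear size of a child, with
  \<open>vm t\<close> as the centre of its hypotenuse. In it \<open>fB\<close> and \<open>fC\<close>
  are mirror images in their common long leg, \<open>fD\<close> and \<open>fE\<close> in their
  common short leg, and \<open>fC\<close> and \<open>fD\<close> are related by a half turn about the
  centre of their common hypotenuse.\<close>

definition fA :: "frame \<Rightarrow> frame" where "fA t = (hyp t 1, vq t, vp t)"
definition fB :: "frame \<Rightarrow> frame" where "fB t = (v0 t, vp t, vm t)"
definition fC :: "frame \<Rightarrow> frame" where "fC t = (v0 t, hyp t 1, vm t)"
definition fD :: "frame \<Rightarrow> frame" where "fD t = (hyp t 3, vm t, hyp t 1)"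
definition fE :: "frame \<Rightarrow> frame" where "fE t = (hyp t 3, vm t, vr t)"

lemmas child_defs = fA_def fB_def fC_def fD_def fE_def

definition children :: "frame \<Rightarrow> frame set" where
  "children t = {fA t, fB t, fC t, fD t, fE t}"

lemma pt_child:
  "pt (fA t) x y = pt t (4/5 + x/5 - 4*y/5) (1/5 - x/5 - y/5)"
  "pt (fB t) x y = pt t (2/5 - 2*x/5 - 2*y/5) (1/10 - x/10 + 2*y/5)"
  "pt (fC t) x y = pt t (2/5 + 2*x/5 - 2*y/5) (1/10 + x/10 + 2*y/5)"
  "pt (fD t) x y = pt t (2/5 - 2*x/5 + 2*y/5) (3/5 - x/10 - 2*y/5)"
  "pt (fE t) x y = pt t (2/5 - 2*x/5 - 2*y/5) (3/5 - x/10 + 2*y/5)"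
  by (simp_all add: pt_def child_defs prod_eq_iff algebra_simps)

definition nondeg :: "frame \<Rightarrow> bool" where
  "nondeg t \<longleftrightarrow> (fst (vq t) - fst (vp t)) * (snd (vr t) - snd (vp t))
     - (snd (vq t) - snd (vp t)) * (fst (vr t) - fst (vp t)) \<noteq> 0"

lemma nondeg_child: "nondeg t \<Longrightarrow> s \<in> children t \<Longrightarrow> nondeg s"
  unfolding nondeg_def children_def
  by (auto simp: pt_child) (auto simp: pt_def field_simps)

lemma pt_inj:
  assumes "nondeg t"
  shows "pt t x y = pt t x' y' \<longleftrightarrow> x = x' \<and> y = y'"
proof
  define a b c d where "a = fst (vq t) - fst (vp t)" "b = snd (vq t) - snd (vp t)"
    "c = fst (vr t) - fst (vp t)" "d = snd (vr t) - snd (vp t)"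
  note D = this
  assume "pt t x y = pt t x' y'"
  then have 1: "(x - x') * a + (y - y') * c = 0" "(x - x') * b + (y - y') * d = 0"
    unfolding D by (auto simp: pt_def algebra_simps prod_eq_iff)
  have n: "a * d - b * c \<noteq> 0" using assms unfolding nondeg_def D by simp
  have "(x - x') * (a * d - b * c) = ((x - x') * a + (y - y') * c) * d - ((x - x') * b + (y - y') * d) * c"
    "(y - y') * (a * d - b * c) = ((x - x') * b + (y - y') * d) * a - ((x - x') * a + (y - y') * c) * b"
    by (simp_all add: algebra_simps)
  then have "(x - x') * (a * d - b * c) = 0" "(y - y') * (a * d - b * c) = 0"
    unfolding 1 by simp_all
  then show "x = x' \<and> y = y'" using n by simp
qed simp

lemma pt_surj:
  assumes "nondeg t"
  obtains x y where "z = pt t x y"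
proof -
  define a b c d where "a = fst (vq t) - fst (vp t)" "b = snd (vq t) - snd (vp t)"
    "c = fst (vr t) - fst (vp t)" "d = snd (vr t) - snd (vp t)"
  note D = this
  define e f where "e = fst z - fst (vp t)" "f = snd z - snd (vp t)"
  note E = this
  have n: "a * d - b * c \<noteq> 0" using assms unfolding nondeg_def D by simp
  define x y where "x = (e * d - f * c) / (a * d - b * c)" "y = (a * f - b * e) / (a * d - b * c)"
  have "e = x * a + y * c" "f = x * b + y * d"
    unfolding \<open>x = _\<close> \<open>y = _\<close> using n by (simp_all add: divide_simps) (simp_all add: algebra_simps)
  moreover have "fst (pt t x y) = fst (vp t) + (x * a + y * c)" "snd (pt t x y) = snd (vp t) + (x * b + y * d)"
    unfolding D by (simp_all add: pt_def algebra_simps)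
  ultimately have "z = pt t x y" unfolding E prod_eq_iff by (metis diff_add_cancel add.commute)
  then show ?thesis by (rule that)
qed

section \<open>Weights and their behaviour under dissection\<close>

text \<open>The weight of a point in a tile is its angle in units of \<open>45\<close> degrees, with both acute angles
  counted as \<open>45\<close> degrees. As the dissection splits a right angle into one acute angle of either
  kind and keeps the acute angles, the weight is still additive.\<close>

definition corner_weight :: "real \<Rightarrow> real \<Rightarrow> nat" where
  "corner_weight x y = (if x < 0 \<or> y < 0 \<or> x + y > 1 then 0
     else if x = 0 \<and> y = 0 then 2
     else if x = 1 \<or> y = 1 then 1
     else if x = 0 \<or> y = 0 \<or> x + y = 1 then 4 else 8)"

lemma corner_weight_eq_0: "x < 0 \<or> y < 0 \<or> x + y > 1 \<Longrightarrow> corner_weight x y = 0"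
  by (auto simp: corner_weight_def)

lemma corner_weight_le: "corner_weight x y \<le> 8"
  by (auto simp: corner_weight_def)

text \<open>The arguments are the coordinates of the point in the five children, the inverse of
  \<open>pt_child\<close>. The case distinctions follow the cuts: \<open>x = 4*y\<close> is the
  altitude, \<open>x + y = 1/2\<close> carries the common long leg of \<open>fB\<close> and
  \<open>fC\<close>, and \<open>1 + x/2 = 2*y\<close> the common short leg of \<open>fD\<close> and
  \<open>fE\<close>. Off a cut the children beyond it have weight 0.\<close>

lemma corner_weight_additive:
  "corner_weight (x-4*y) (1-x-y) + corner_weight (1-2*x-2*y) (2*y-x/2)
   + corner_weight (2*x+2*y-1) (2*y-x/2) + corner_weight (2-2*x-2*y) (1+x/2-2*y)
   + corner_weight (2-2*x-2*y) (2*y-x/2-1) \<le> corner_weight x y"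
    (is "?A + ?B + ?C + ?D + ?E \<le> ?T")
proof -
  note z = corner_weight_eq_0 and d = corner_weight_def
  consider "x - 4*y > 0" | "x = 4*y" | "x - 4*y < 0" by linarith
  then show ?thesis
  proof cases
    case 1
    then have "?B = 0" "?C = 0" "?D = 0" "?E = 0" by (intro z; linarith)+
    moreover have "?A \<le> ?T" using 1 by (auto simp: d)
    ultimately show ?thesis by simp
  next
    case 2
    then show ?thesis by (simp only: d) (simp split: if_splits)
  next
    case 3
    then have zA: "?A = 0" by (intro z) linarith
    consider "x + y < 1/2" | "x + y = 1/2" | "x + y > 1/2" by linarith
    then show ?thesis
    proof cases
      case 1
      then have "?C = 0" "?D = 0" "?E = 0" by (intro z; linarith)+
      moreover have "?B \<le> ?T" using 1 3 by (auto simp: d)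
      ultimately show ?thesis using zA by simp
    next
      case 2
      then have y: "y = 1/2 - x" by simp
      show ?thesis using zA 3 unfolding y by (auto simp: d)
    next
      case xy: 3
      then have zB: "?B = 0" by (intro z) linarith
      consider "1+x/2-2*y < 0" | "1+x/2-2*y = 0" | "1+x/2-2*y > 0" by linarith
      then show ?thesis
      proof cases
        case 1
        then have "?C = 0" "?D = 0" using xy by (intro z; linarith)+
        moreover have "?E \<le> ?T" using 1 3 xy by (auto simp: d)
        ultimately show ?thesis using zA zB by simp
      next
        case 2
        then have x: "x = 4*y - 2" by simp
        show ?thesis using zA zB 3 xy unfolding x by (auto simp: d field_simps)
      next
        case c3: 3
        then have "?E = 0" by (intro z) linarith
        moreover have "?C + ?D \<le> ?T" using zA zB 3 c3 xy by (auto simp: d)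
        ultimately show ?thesis using zA zB by simp
      qed
    qed
  qed
qed

definition wt :: "frame \<Rightarrow> point \<Rightarrow> nat" where
  "wt t z = (THE n. \<exists>x y. z = pt t x y \<and> n = corner_weight x y)"

lemma wt_pt: "nondeg t \<Longrightarrow> wt t (pt t x y) = corner_weight x y"
  unfolding wt_def by (rule the_equality) (auto simp: pt_inj)

lemma wt_le: "nondeg t \<Longrightarrow> wt t z \<le> 8"
  using pt_surj[of t z] wt_pt corner_weight_le by metis

lemma wt_child:
  assumes "nondeg t"
  shows "wt (fA t) (pt t x y) = corner_weight (x-4*y) (1-x-y)"
    "wt (fB t) (pt t x y) = corner_weight (1-2*x-2*y) (2*y-x/2)"
    "wt (fC t) (pt t x y) = corner_weight (2*x+2*y-1) (2*y-x/2)"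
    "wt (fD t) (pt t x y) = corner_weight (2-2*x-2*y) (1+x/2-2*y)"
    "wt (fE t) (pt t x y) = corner_weight (2-2*x-2*y) (2*y-x/2-1)"
proof -
  have n: "nondeg s" if "s \<in> children t" for s using assms that by (rule nondeg_child)
  have "pt t x y = pt (fA t) (x-4*y) (1-x-y)" "pt t x y = pt (fB t) (1-2*x-2*y) (2*y-x/2)"
    "pt t x y = pt (fC t) (2*x+2*y-1) (2*y-x/2)" "pt t x y = pt (fD t) (2-2*x-2*y) (1+x/2-2*y)"
    "pt t x y = pt (fE t) (2-2*x-2*y) (2*y-x/2-1)"
    unfolding pt_child by (rule arg_cong2[of _ _ _ _ "pt t"]; simp add: field_simps)+
  moreover have "wt s (pt t x y) = corner_weight a b" if "s \<in> children t" "pt t x y = pt s a b" for s a b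
    using wt_pt[OF n[OF that(1)]] that(2) by simp
  moreover have "fA t \<in> children t" "fB t \<in> children t" "fC t \<in> children t" "fD t \<in> children t"
    "fE t \<in> children t" by (simp_all add: children_def)
  ultimately show "wt (fA t) (pt t x y) = corner_weight (x-4*y) (1-x-y)"
    "wt (fB t) (pt t x y) = corner_weight (1-2*x-2*y) (2*y-x/2)"
    "wt (fC t) (pt t x y) = corner_weight (2*x+2*y-1) (2*y-x/2)"
    "wt (fD t) (pt t x y) = corner_weight (2-2*x-2*y) (1+x/2-2*y)"
    "wt (fE t) (pt t x y) = corner_weight (2-2*x-2*y) (2*y-x/2-1)"
    by metis+
qed

lemma wt_children:
  assumes "nondeg t"
  shows "(\<Sum>s\<in>children t. wt s z) \<le> wt t z"
proof -
  obtain x y where z: "z = pt t x y" using pt_surj[OF assms] .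
  \<comment> \<open>As only an upper bound is wanted, coincidences among the five children would do
    no harm.\<close>
  have ins: "sum f (insert a S) \<le> f a + sum f S" if "finite S" for f :: "frame \<Rightarrow> nat" and a S
    using that by (simp add: sum.insert_if)
  have "(\<Sum>s\<in>children t. wt s z) \<le> wt (fA t) z + (wt (fB t) z + (wt (fC t) z + (wt (fD t) z + wt (fE t) z)))"
    unfolding children_def by (intro order_trans[OF ins] add_left_mono) simp_all
  also have "\<dots> \<le> wt t z"
    unfolding z wt_child[OF assms] wt_pt[OF assms] using corner_weight_additive[of x y] by simp
  finally show ?thesis .
qed

lemma wt_child_le: "nondeg t \<Longrightarrow> s \<in> children t \<Longrightarrow> wt s z \<le> wt t z"
  by (rule order_trans[OF member_le_sum wt_children]) (auto simp: children_def)

lemma children_distinct: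
  assumes "nondeg t"
  shows "fA t \<noteq> fB t" "fA t \<noteq> fC t" "fA t \<noteq> fD t" "fA t \<noteq> fE t" "fB t \<noteq> fC t" "fB t \<noteq> fD t"
    "fB t \<noteq> fE t" "fC t \<noteq> fD t" "fC t \<noteq> fE t" "fD t \<noteq> fE t"
  using assms by (auto simp: child_defs pt_inj)

section \<open>Iterated dissection and matching of sides\<close>

text \<open>The patch is dissected in place instead of being expanded, so all levels lie in one
  plane and can be compared point by point. The expansion returns in
  \<open>supertile_eq\<close>.\<close>

primrec level :: "frame \<Rightarrow> nat \<Rightarrow> frame set" where
  "level \<Omega> 0 = {\<Omega>}"
| "level \<Omega> (Suc n) = (\<Union>t\<in>level \<Omega> n. children t)"

lemma finite_level: "finite (level \<Omega> n)"
  by (induction n) (auto simp: children_def)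

lemma nondeg_level: "nondeg \<Omega> \<Longrightarrow> t \<in> level \<Omega> n \<Longrightarrow> nondeg t"
proof (induction n arbitrary: t)
  case (Suc n)
  then obtain t' where "t' \<in> level \<Omega> n" "t \<in> children t'" by auto
  then show ?case using Suc nondeg_child by blast
qed simp

lemma sum_UN_le:
  fixes f :: "'b \<Rightarrow> nat"
  assumes "finite I" "\<And>i. i \<in> I \<Longrightarrow> finite (A i)"
  shows "sum f (\<Union>i\<in>I. A i) \<le> (\<Sum>i\<in>I. sum f (A i))"
  using assms
proof (induction I)
  case (insert i I)
  have "sum f (A i \<union> (\<Union>i\<in>I. A i)) \<le> sum f (A i) + sum f (\<Union>i\<in>I. A i)"
    using insert by (subst sum.union_inter[symmetric]) auto
  then show ?case using insert by simp
qed simp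

lemma wt_level:
  assumes "nondeg \<Omega>"
  shows "(\<Sum>t\<in>level \<Omega> n. wt t z) \<le> wt \<Omega> z"
proof (induction n)
  case (Suc n)
  have "(\<Sum>t\<in>level \<Omega> (Suc n). wt t z) \<le> (\<Sum>t\<in>level \<Omega> n. \<Sum>s\<in>children t. wt s z)"
    by (simp, rule sum_UN_le) (auto simp: finite_level children_def)
  also have "\<dots> \<le> (\<Sum>t\<in>level \<Omega> n. wt t z)"
    by (rule sum_mono) (rule wt_children[OF nondeg_level[OF assms]])
  finally show ?case using Suc by simp
qed simp

lemma wt_level_subset:
  assumes "nondeg \<Omega>" "S \<subseteq> level \<Omega> n"
  shows "(\<Sum>t\<in>S. wt t z) \<le> wt \<Omega> z"
  using wt_level[OF assms(1), of z n] sum_mono2[OF finite_level assms(2), of "\<lambda>t. wt t z"] by linarith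

text \<open>Stands in for disjointness of interiors: two different tiles of one level cannot be too
  heavy together.\<close>

lemma level_eqI:
  assumes "nondeg \<Omega>" "s \<in> level \<Omega> n" "t \<in> level \<Omega> n" "wt s z + wt t z > wt \<Omega> z"
  shows "s = t"
proof (rule ccontr)
  assume "s \<noteq> t"
  then show False using wt_level_subset[OF assms(1), of "{s,t}" n z] assms by simp
qed

lemma children_disjoint:
  assumes "nondeg \<Omega>" "s \<in> level \<Omega> n" "t \<in> level \<Omega> n" "u \<in> children s" "u \<in> children t"
  shows "s = t"
proof (rule level_eqI[OF assms(1-3)])
  \<comment> \<open>The centroid of \<open>u\<close> has weight 8 in \<open>u\<close>, hence in both
    parents, which is twice what the patch allows.\<close>
  let ?z = "pt u (1/3) (1/3)"
  have "nondeg u" using assms nondeg_child nondeg_level by metis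
  then have "wt u ?z = 8" by (simp add: wt_pt corner_weight_def)
  then have "wt s ?z \<ge> 8" "wt t ?z \<ge> 8"
    using wt_child_le[OF nondeg_level[OF assms(1,2)] assms(4)]
      wt_child_le[OF nondeg_level[OF assms(1,3)] assms(5)] by metis+
  then show "wt \<Omega> ?z < wt s ?z + wt t ?z" using wt_le[OF assms(1), of ?z] by linarith
qed

lemma open_segment_pt:
  assumes "z \<in> open_segment (pt t a b) (pt t c d)"
  obtains u where "0 < u" "u < 1" "z = pt t ((1-u)*a + u*c) ((1-u)*b + u*d)"
proof -
  obtain u where u: "0 < u" "u < 1" "z = (1 - u) *\<^sub>R pt t a b + u *\<^sub>R pt t c d"
    using assms by (auto simp: in_segment)
  have "z = pt t ((1-u)*a + u*c) ((1-u)*b + u*d)"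
    unfolding u pt_def by (simp add: prod_eq_iff algebra_simps)
  then show ?thesis using that u by blast
qed

lemma pt_in_open_segment:
  assumes "nondeg t" "a \<noteq> c \<or> b \<noteq> d" "0 < u" "u < 1" "x = (1-u)*a + u*c" "y = (1-u)*b + u*d"
  shows "pt t x y \<in> open_segment (pt t a b) (pt t c d)"
proof -
  have "pt t x y = (1 - u) *\<^sub>R pt t a b + u *\<^sub>R pt t c d"
    unfolding assms(5,6) pt_def by (simp add: prod_eq_iff algebra_simps)
  then show ?thesis using assms by (auto simp: in_segment pt_inj)
qed

text \<open>With the long leg halved, all leg pieces are as long as the short leg, which is also a
  fifth of the parent's hypotenuse. Neighbouring tiles need not share whole sides, but they match in
  these pieces and in undivided hypotenuses.\<close>

definition leg_pieces :: "frame \<Rightarrow> point set set" where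
  "leg_pieces t = {{vp t, vq t}, {vp t, vm t}, {vm t, vr t}}"

definition hyp_piece :: "frame \<Rightarrow> point set set" where
  "hyp_piece t = {{vq t, vr t}}"

definition hyp_units :: "frame \<Rightarrow> point set set" where
  "hyp_units t = {{hyp t 0, hyp t 1}, {hyp t 1, hyp t 2}, {hyp t 2, hyp t 3}, {hyp t 3, hyp t 4}, {hyp t 4, hyp t 5}}"

text \<open>Pieces in the boundary of \<open>\<Omega>\<close> are exempt.\<close>

definition matched :: "frame \<Rightarrow> frame set \<Rightarrow> (frame \<Rightarrow> point set set) \<Rightarrow> bool" where
  "matched \<Omega> X F \<longleftrightarrow> (\<forall>t\<in>X. \<forall>a b z. {a,b} \<in> F t \<and> z \<in> open_segment a b \<and> wt \<Omega> z > 4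
     \<longrightarrow> (\<exists>s\<in>X. s \<noteq> t \<and> {a,b} \<in> F s))"

lemma pt_affine_eq:
  assumes "pt s 1 0 = pt t 1 0" "pt s 0 1 = pt t 0 1"
  shows "hyp s k = hyp t k"
  using assms by (simp add: pt_def prod_eq_iff algebra_simps)

lemma pt_affine_eq_swap:
  assumes "pt s 1 0 = pt t 0 1" "pt s 0 1 = pt t 1 0"
  shows "hyp s k = hyp t (5 - k)"
proof -
  have *: "hyp u j = (1 - j/5) *\<^sub>R vq u + (j/5) *\<^sub>R vr u" for u j
    by (simp add: pt_def prod_eq_iff algebra_simps)
  show ?thesis unfolding *[of s k] *[of t "5 - k"] assms
    by (simp add: diff_divide_distrib add.commute)
qed

text \<open>The division into fifths is invariant under reversal, so the orientation of the common
  hypotenuse does not matter.\<close>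

lemma hyp_units_cong:
  assumes "hyp_piece s = hyp_piece t"
  shows "hyp_units s = hyp_units t"
proof -
  have "{vq s, vr s} = {vq t, vr t}" using assms unfolding hyp_piece_def by simp
  then consider "vq s = vq t" "vr s = vr t" | "vq s = vr t" "vr s = vq t"
    by (auto simp: doubleton_eq_iff)
  then show ?thesis
  proof cases
    case 1
    then have "hyp s = hyp t" using pt_affine_eq by blast
    then show ?thesis unfolding hyp_units_def fun_eq_iff by presburger
  next
    case 2
    then have "hyp s = (\<lambda>k. hyp t (5 - k))" using pt_affine_eq_swap by blast
    then have "hyp s 0 = hyp t 5" "hyp s 1 = hyp t 4" "hyp s 2 = hyp t 3" "hyp s 3 = hyp t 2"
      "hyp s 4 = hyp t 1" "hyp s 5 = hyp t 0" unfolding fun_eq_iff by (simp_all only: ) simp_all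
    then show ?thesis unfolding hyp_units_def by (simp only: ) blast
  qed
qed

lemma leg_pieces_child:
  assumes "nondeg t" "s \<in> children t" "e \<in> leg_pieces s"
  shows "e \<in> hyp_units t \<or> (\<exists>s'\<in>children t. s' \<noteq> s \<and> e \<in> leg_pieces s')"
  using assms(2,3) children_distinct[OF assms(1)]
  unfolding children_def leg_pieces_def hyp_units_def
  by (elim insertE emptyE) (simp_all add: pt_child insert_commute)

lemma hyp_piece_child:
  assumes "nondeg t" "s \<in> children t" "e \<in> hyp_piece s"
  shows "e \<in> leg_pieces t \<or> (\<exists>s'\<in>children t. s' \<noteq> s \<and> e \<in> hyp_piece s')"
  using assms(2,3) children_distinct[OF assms(1)]
  unfolding children_def leg_pieces_def hyp_piece_def
  by (elim insertE emptyE) (simp_all add: pt_child insert_commute)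

lemma hyp_unitsD: "e \<in> hyp_units t \<Longrightarrow> \<exists>s\<in>children t. e \<in> leg_pieces s"
  unfolding children_def leg_pieces_def hyp_units_def
  by (elim insertE emptyE) (simp_all add: pt_child insert_commute)

lemma leg_piecesD: "e \<in> leg_pieces t \<Longrightarrow> \<exists>s\<in>children t. e \<in> hyp_piece s"
  unfolding children_def leg_pieces_def hyp_piece_def
  by (elim insertE emptyE) (simp_all add: pt_child insert_commute)

lemma hyp_units_segment:
  assumes "nondeg t" "{a,b} \<in> hyp_units t" "z \<in> open_segment a b"
  shows "z \<in> open_segment (vq t) (vr t)"
proof -
  have "hyp_units t = (\<lambda>k. {hyp t k, hyp t (k+1)}) ` {0,1,2,3,4}"
    by (simp add: hyp_units_def)
  then obtain k where "k \<in> {0,1,2,3,4}" and k: "{a,b} = {hyp t k, hyp t (k+1)}"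
    using assms(2) by blast
  then have k04: "0 \<le> k" "k \<le> 4" by auto
  have "open_segment a b = open_segment (hyp t k) (hyp t (k+1))"
    using k by (auto simp: doubleton_eq_iff open_segment_commute)
  then obtain u where u: "0 < u" "u < 1"
    "z = pt t ((1-u)*(1 - k/5) + u*(1 - (k+1)/5)) ((1-u)*(k/5) + u*((k+1)/5))"
    using assms(3) open_segment_pt[of z t] by metis
  show ?thesis unfolding u(3)
    by (rule pt_in_open_segment[OF assms(1), where u = "(k+u)/5"]) (use u k04 in \<open>auto simp: field_simps\<close>)
qed

lemma wt_open_piece:
  assumes "nondeg t" "{a,b} \<in> leg_pieces t \<union> hyp_piece t" "z \<in> open_segment a b"
  shows "wt t z = 4"
proof -
  have *: "wt t z = 4" if seg: "z \<in> open_segment (pt t a b) (pt t c d)"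
    and abcd: "(a,b,c,d) \<in> {(0,0,1,0), (0,0,0,1/2), (0,1/2,0,1), (1,0,0,1)}" for z a b c d
  proof -
    obtain u where u: "0 < u" "u < 1" "z = pt t ((1-u)*a + u*c) ((1-u)*b + u*d)"
      using open_segment_pt[OF seg] .
    show ?thesis using abcd unfolding u(3) wt_pt[OF assms(1)]
      by (elim insertE emptyE Pair_inject; hypsubst)
        (use u(1,2) in \<open>simp_all add: corner_weight_def field_simps\<close>)
  qed
  have "\<exists>x y x' y'. open_segment a b = open_segment (pt t x y) (pt t x' y') \<and>
    (x,y,x',y') \<in> {(0,0,1,0), (0,0,0,1/2), (0,1/2,0,1), (1,0,0,1)}"
  proof -
    have "{a,b} = {pt t x y, pt t x' y'} \<Longrightarrow> open_segment a b = open_segment (pt t x y) (pt t x' y')" for x y x' y'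
      by (auto simp: doubleton_eq_iff open_segment_commute)
    moreover have "{a,b} = {pt t 0 0, pt t 1 0} \<or> {a,b} = {pt t 0 0, pt t 0 (1/2)}
      \<or> {a,b} = {pt t 0 (1/2), pt t 0 1} \<or> {a,b} = {pt t 1 0, pt t 0 1}"
      using assms(2) unfolding leg_pieces_def hyp_piece_def by blast
    ultimately show ?thesis by blast
  qed
  then show ?thesis using * assms(3) by blast
qed

text \<open>Both claims are proved together because dissection exchanges the two kinds of sides: on
  the boundary of the parent, a leg piece of a child is a fifth of a hypotenuse and a hypotenuse of
  a child is a leg piece. All pieces inside the parent are shared by two siblings.\<close>

lemma matched_level:
  assumes "nondeg \<Omega>"
  shows "matched \<Omega> (level \<Omega> n) leg_pieces \<and> matched \<Omega> (level \<Omega> n) hyp_piece"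
proof (induction n)
  case 0
  \<comment> \<open>The sides of \<open>\<Omega>\<close> itself have weight 4 at their inner points
    and are exempt.\<close>
  then show ?case using wt_open_piece[OF assms] unfolding matched_def by fastforce
next
  case (Suc n)
  note IH = Suc[unfolded matched_def]
  have nd: "nondeg t" if "t \<in> level \<Omega> n" for t using nondeg_level[OF assms that] .
  have legs: "\<exists>s'\<in>level \<Omega> (Suc n). s' \<noteq> s \<and> {a,b} \<in> leg_pieces s'"
    if s: "s \<in> level \<Omega> (Suc n)" "{a,b} \<in> leg_pieces s" "z \<in> open_segment a b" "wt \<Omega> z > 4" for s a b z
  proof -
    obtain t where t: "t \<in> level \<Omega> n" "s \<in> children t" using s(1) by auto
    show ?thesis
    proof (cases "{a,b} \<in> hyp_units t")
      case True
      have "z \<in> open_segment (vq t) (vr t)" using hyp_units_segment[OF nd[OF t(1)] True s(3)] .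
      then obtain t' where t': "t' \<in> level \<Omega> n" "t' \<noteq> t" "{vq t, vr t} \<in> hyp_piece t'"
        using IH t(1) s(4) unfolding hyp_piece_def by blast
      then have "hyp_piece t' = hyp_piece t" unfolding hyp_piece_def by simp
      then have "{a,b} \<in> hyp_units t'" using True hyp_units_cong by blast
      then obtain s' where "s' \<in> children t'" "{a,b} \<in> leg_pieces s'" using hyp_unitsD by blast
      moreover have "s' \<noteq> s" using children_disjoint[OF assms t'(1) t(1)] calculation t t' by blast
      ultimately show ?thesis using t' by auto
    next
      case False
      then show ?thesis using leg_pieces_child[OF nd[OF t(1)] t(2) s(2)] t(1) by auto
    qed
  qed
  have hyps: "\<exists>s'\<in>level \<Omega> (Suc n). s' \<noteq> s \<and> {a,b} \<in> hyp_piece s'"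
    if s: "s \<in> level \<Omega> (Suc n)" "{a,b} \<in> hyp_piece s" "z \<in> open_segment a b" "wt \<Omega> z > 4" for s a b z
  proof -
    obtain t where t: "t \<in> level \<Omega> n" "s \<in> children t" using s(1) by auto
    show ?thesis
    proof (cases "{a,b} \<in> leg_pieces t")
      case True
      then obtain t' where t': "t' \<in> level \<Omega> n" "t' \<noteq> t" "{a,b} \<in> leg_pieces t'"
        using IH t(1) s(3,4) by blast
      then obtain s' where "s' \<in> children t'" "{a,b} \<in> hyp_piece s'" using leg_piecesD by blast
      moreover have "s' \<noteq> s" using children_disjoint[OF assms t'(1) t(1)] calculation t t' by blast
      ultimately show ?thesis using t' by auto
    next
      case False
      then show ?thesis using hyp_piece_child[OF nd[OF t(1)] t(2) s(2)] t(1) by auto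
    qed
  qed
  show ?case unfolding matched_def using legs hyps by blast
qed

text \<open>Hence the centre of a long leg never faces four acute angles, which would make its degree
  too large for the greedy step.\<close>

lemma mid_faces_mid_or_right_angle:
  assumes "nondeg \<Omega>" "s \<in> level \<Omega> (Suc n)" "wt \<Omega> (vm s) > 4"
  shows "\<exists>s'\<in>level \<Omega> (Suc n). s' \<noteq> s \<and> (vm s' = vm s \<or> vp s' = vm s)"
proof -
  obtain t where t: "t \<in> level \<Omega> n" "s \<in> children t" using assms(2) by auto
  have nd: "nondeg t" using nondeg_level[OF assms(1) t(1)] .
  note dist = children_distinct[OF nd]
  have sib: ?thesis if "s' \<in> children t" "s' \<noteq> s" "vm s' = vm s \<or> vp s' = vm s" for s'
    using that t by auto
  \<comment> \<open>The centre lies at position \<open>k\<close> of the parent's hypotenuse; the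
    tile across it sees that point at position \<open>k\<close> or 5 - \<open>k\<close>, depending
    on its orientation.\<close>
  have opp: ?thesis if k: "0 < k" "k < 5" "vm s = hyp t k"
    and facing: "\<And>t'. vm s = hyp t' k \<or> vm s = hyp t' (5 - k) \<Longrightarrow>
      \<exists>s'\<in>children t'. vm s' = vm s \<or> vp s' = vm s" for k
  proof -
    have "hyp t k \<in> open_segment (vq t) (vr t)"
      by (rule pt_in_open_segment[OF nd, where u = "k/5"]) (use k in auto)
    then obtain t' where t': "t' \<in> level \<Omega> n" "t' \<noteq> t" "{vq t, vr t} \<in> hyp_piece t'"
      using matched_level[OF assms(1), of n] t(1) assms(3) k(3)
      unfolding matched_def hyp_piece_def by (metis singletonI)
    have "vm s = hyp t' k \<or> vm s = hyp t' (5 - k)"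
      using t'(3) pt_affine_eq[of t t' k] pt_affine_eq_swap[of t t' k] k(3)
      unfolding hyp_piece_def by (auto simp: doubleton_eq_iff)
    then obtain s' where "s' \<in> children t'" "vm s' = vm s \<or> vp s' = vm s" using facing by blast
    moreover have "s' \<noteq> s" using children_disjoint[OF assms(1) t'(1) t(1)] calculation t t' by blast
    ultimately show ?thesis using t' by auto
  qed
  consider "s = fA t" | "s = fB t" | "s = fC t" | "s = fD t" | "s = fE t"
    using t(2) unfolding children_def by blast
  then show ?thesis
  proof cases
    case 1
    then show ?thesis using dist by (intro sib[of "fB t"]) (auto simp: children_def pt_child)
  next
    case 2
    then show ?thesis using dist by (intro sib[of "fC t"]) (auto simp: children_def pt_child)
  next
    case 3
    then show ?thesis using dist by (intro sib[of "fB t"]) (auto simp: children_def pt_child)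
  next
    case 4
    then have "vm s = hyp t 2" by (simp add: pt_child)
    \<comment> \<open>Across the hypotenuse, position 2 appears as 2 or 3, the centre of the long
      leg or the right angle of \<open>fD t'\<close>. Likewise 4 appears below as 4 or 1, the centre
      of the long leg of \<open>fE t'\<close> or the right angle of \<open>fA t'\<close>.\<close>
    moreover have "vm (fD t') = hyp t' 2" "vp (fD t') = hyp t' 3" for t' by (simp_all add: pt_child)
    ultimately show ?thesis by (intro opp[of 2]) (auto simp: children_def)
  next
    case 5
    then have "vm s = hyp t 4" by (simp add: pt_child)
    moreover have "vm (fE t') = hyp t' 4" "vp (fA t') = hyp t' 1" for t' by (simp_all add: pt_child)
    ultimately show ?thesis by (intro opp[of 4]) (auto simp: children_def)
  qed
qed

section \<open>Vertex degrees in a patch\<close>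

text \<open>Every edge inside the patch belongs to two tiles of \<open>X\<close>, listed by \<open>hs\<close> in both of them,
  or lies in the interior of a single tile, listed by \<open>fs\<close>.\<close>

definition patch_edges ::
  "frame set \<Rightarrow> (frame \<Rightarrow> point set list) \<Rightarrow> (frame \<Rightarrow> point set list) \<Rightarrow> point set set" where
  "patch_edges X hs fs = (\<Union>t\<in>X. set (fs t)) \<union>
     {e. \<exists>s\<in>X. \<exists>t\<in>X. s \<noteq> t \<and> e \<in> set (hs s) \<and> e \<in> set (hs t)}"

text \<open>A shared edge counts 1 in each of its two tiles, an edge inside one tile counts 2 there.
  Summed over all tiles this bounds twice the degree.\<close>

definition incidence ::
  "(frame \<Rightarrow> point set list) \<Rightarrow> (frame \<Rightarrow> point set list) \<Rightarrow> frame \<Rightarrow> point \<Rightarrow> nat" where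
  "incidence hs fs t v =
     length (filter (\<lambda>e. v \<in> e) (hs t)) + 2 * length (filter (\<lambda>e. v \<in> e) (fs t))"

lemma finite_patch_edges: "finite X \<Longrightarrow> finite (patch_edges X hs fs)"
  unfolding patch_edges_def
  by (auto intro: finite_subset[of _ "\<Union>t\<in>X. set (hs t)"])

lemma double_deg_le:
  assumes "finite X"
  shows "2 * deg (patch_edges X hs fs) v \<le> (\<Sum>t\<in>X. incidence hs fs t v)"
proof -
  define D where "D = {e \<in> patch_edges X hs fs. v \<in> e}"
  define w :: "frame \<Rightarrow> point set \<Rightarrow> nat"
    where "w t e = of_bool (e \<in> set (hs t)) + 2 * of_bool (e \<in> set (fs t))" for t e
  have fD: "finite D" unfolding D_def using finite_patch_edges[OF assms] by simp
  have "2 \<le> (\<Sum>t\<in>X. w t e)" if e: "e \<in> D" for e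
  proof -
    consider t where "t \<in> X" "e \<in> set (fs t)"
      | s t where "s \<in> X" "t \<in> X" "s \<noteq> t" "e \<in> set (hs s)" "e \<in> set (hs t)"
      using e unfolding D_def patch_edges_def by blast
    then show ?thesis
    proof cases
      case (1 t)
      have "2 \<le> w t e" unfolding w_def using 1 by simp
      also have "\<dots> \<le> (\<Sum>t\<in>X. w t e)" using assms 1 by (intro member_le_sum) auto
      finally show ?thesis .
    next
      case (2 s t)
      have "2 \<le> w s e + w t e" unfolding w_def using 2 by simp
      also have "\<dots> = (\<Sum>t\<in>{s,t}. w t e)" using 2 by simp
      also have "\<dots> \<le> (\<Sum>t\<in>X. w t e)" using assms 2 by (intro sum_mono2) auto
      finally show ?thesis .
    qed
  qed
  then have "(\<Sum>e\<in>D. 2) \<le> (\<Sum>e\<in>D. \<Sum>t\<in>X. w t e)" by (rule sum_mono)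
  also have "\<dots> = (\<Sum>t\<in>X. \<Sum>e\<in>D. w t e)" by (rule sum.swap)
  also have "\<dots> \<le> (\<Sum>t\<in>X. incidence hs fs t v)"
  proof (rule sum_mono)
    fix t
    have *: "(\<Sum>e\<in>D. of_bool (e \<in> set es)) \<le> length (filter (\<lambda>e. v \<in> e) es)" for es
    proof -
      have "(\<Sum>e\<in>D. of_bool (e \<in> set es)) = card {e \<in> D. e \<in> set es}"
        using fD by (simp add: Int_def of_bool_def flip: sum.inter_filter)
      also have "\<dots> \<le> card (set (filter (\<lambda>e. v \<in> e) es))"
        by (intro card_mono) (auto simp: D_def)
      also have "\<dots> \<le> length (filter (\<lambda>e. v \<in> e) es)" by (rule card_length)
      finally show ?thesis .
    qed
    have "(\<Sum>e\<in>D. w t e) = (\<Sum>e\<in>D. of_bool (e \<in> set (hs t))) + 2 * (\<Sum>e\<in>D. of_bool (e \<in> set (fs t)))"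
      unfolding w_def by (simp add: sum.distrib sum_distrib_left)
    then show "(\<Sum>e\<in>D. w t e) \<le> incidence hs fs t v"
      unfolding incidence_def using *[of "hs t"] *[of "fs t"] by simp
  qed
  finally show ?thesis unfolding deg_def D_def by simp
qed

section \<open>The roles of edges and the order of colouring\<close>

text \<open>The two ways of sharing a hypotenuse: by reflection in it, or, for
  \<open>rotated\<close>, by a half turn about its centre.\<close>

definition mirrored :: "frame set \<Rightarrow> frame \<Rightarrow> bool" where
  "mirrored X t \<longleftrightarrow> (\<exists>s\<in>X. s \<noteq> t \<and> vq s = vq t \<and> vr s = vr t)"

definition rotated :: "frame set \<Rightarrow> frame \<Rightarrow> bool" where
  "rotated X t \<longleftrightarrow> (\<exists>s\<in>X. s \<noteq> t \<and> vq s = vr t \<and> vr s = vq t)"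

definition leg_list :: "frame \<Rightarrow> point set list" where
  "leg_list t = [{vp t, vq t}, {vp t, vm t}, {vm t, vr t}]"

text \<open>On the hypotenuse the children have corners at positions 0, 1, 3 and 5. A mirrored
  neighbour has them at the same points, a rotated one at 5, 4, 2 and 0, so that all six points
  become vertices. The edges at the two ends of the hypotenuse are separated from the others, in
  \<open>inner_list\<close>, because they are coloured much earlier.\<close>

definition outer_list :: "frame set \<Rightarrow> frame \<Rightarrow> point set list" where
  "outer_list X t =
    (if mirrored X t then [{hyp t 0, hyp t 1}, {hyp t 3, hyp t 5}]
     else if rotated X t then [{hyp t 0, hyp t 1}, {hyp t 4, hyp t 5}] else [])"

definition inner_list :: "frame set \<Rightarrow> frame \<Rightarrow> point set list" where
  "inner_list X t =
    (if mirrored X t then [{hyp t 1, hyp t 3}]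
     else if rotated X t then [{hyp t 1, hyp t 2}, {hyp t 2, hyp t 3}, {hyp t 3, hyp t 4}] else [])"

text \<open>\<open>edge_a\<close> and \<open>edge_b\<close> are the halves of the altitude,
  \<open>edge_c\<close> is the common long leg of \<open>fB\<close> and \<open>fC\<close>,
  \<open>edge_h\<close> the common hypotenuse of \<open>fC\<close> and \<open>fD\<close>, and
  \<open>edge_t\<close> the common short leg of \<open>fD\<close> and \<open>fE\<close>.\<close>

abbreviation edge_a :: "frame \<Rightarrow> point set" where "edge_a t \<equiv> {vp t, v0 t}"
abbreviation edge_b :: "frame \<Rightarrow> point set" where "edge_b t \<equiv> {hyp t 1, v0 t}"
abbreviation edge_c :: "frame \<Rightarrow> point set" where "edge_c t \<equiv> {vm t, v0 t}"
abbreviation edge_h :: "frame \<Rightarrow> point set" where "edge_h t \<equiv> {vm t, hyp t 1}"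
abbreviation edge_t :: "frame \<Rightarrow> point set" where "edge_t t \<equiv> {vm t, hyp t 3}"

text \<open>The order is forced by degrees. \<open>edge_h\<close> and \<open>edge_t\<close> come
  while few edges meet at the centre of the long leg. \<open>edge_h\<close> precedes
  \<open>edge_c\<close>, for which it serves as the edge to be recoloured, and \<open>edge_b\<close>
  follows it, so that \<open>v0\<close> then carries only \<open>edge_a\<close>.\<close>

definition stage1 where "stage1 X = patch_edges X leg_list (\<lambda>t. [])"
definition stage2 where "stage2 X = patch_edges X (\<lambda>t. leg_list t @ outer_list X t) (\<lambda>t. [])"
definition stage3 where "stage3 X = patch_edges X (\<lambda>t. leg_list t @ outer_list X t)
  (\<lambda>t. [edge_h t, edge_t t])"
definition stage4 where "stage4 X = patch_edges X (\<lambda>t. leg_list t @ outer_list X t)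
  (\<lambda>t. [edge_h t, edge_t t, edge_a t])"
definition stage5 where "stage5 X = patch_edges X (\<lambda>t. leg_list t @ outer_list X t)
  (\<lambda>t. [edge_h t, edge_t t, edge_a t, edge_c t])"
definition stage6 where "stage6 X = patch_edges X (\<lambda>t. leg_list t @ outer_list X t @ inner_list X t)
  (\<lambda>t. [edge_h t, edge_t t, edge_a t, edge_c t])"
definition stage7 where "stage7 X = patch_edges X (\<lambda>t. leg_list t @ outer_list X t @ inner_list X t)
  (\<lambda>t. [edge_h t, edge_t t, edge_a t, edge_c t, edge_b t])"

lemmas stage_defs = stage1_def stage2_def stage3_def stage4_def stage5_def stage6_def stage7_def

lemma stage_mono:
  "stage1 X \<subseteq> stage2 X" "stage2 X \<subseteq> stage3 X" "stage3 X \<subseteq> stage4 X" "stage4 X \<subseteq> stage5 X"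
  "stage5 X \<subseteq> stage6 X" "stage6 X \<subseteq> stage7 X"
  unfolding stage_defs patch_edges_def by (simp_all, blast+)

lemmas incidence_simps = incidence_def leg_list_def outer_list_def inner_list_def

text \<open>Each unit of weight pays for one edge at \<open>v\<close>, so the total weight 8 caps
  the degree. There is equality at \<open>vm t\<close>, where two half edges and three inner edges
  give 8 for the weight 4.\<close>

lemma incidence_all:
  assumes "nondeg t"
  shows "incidence (\<lambda>t. leg_list t @ outer_list X t @ inner_list X t)
    (\<lambda>t. [edge_h t, edge_t t, edge_a t, edge_c t, edge_b t]) t v \<le> 2 * wt t v"
proof -
  obtain x y where v: "v = pt t x y" using pt_surj[OF assms] .
  show ?thesis unfolding v wt_pt[OF assms]
    by (auto simp: incidence_simps pt_inj[OF assms] corner_weight_def)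
qed

lemma incidence_legs:
  assumes "nondeg t"
  shows "incidence leg_list (\<lambda>t. []) t v \<le> wt t v"
proof -
  obtain x y where v: "v = pt t x y" using pt_surj[OF assms] .
  show ?thesis unfolding v wt_pt[OF assms]
    by (auto simp: incidence_simps pt_inj[OF assms] corner_weight_def)
qed

text \<open>The bounds serve stages 2, 3, 6 and 7. The extreme position is \<open>hyp t 1\<close>,
  which successively receives an outer edge, \<open>edge_h\<close>, an edge of
  \<open>inner_list\<close> and \<open>edge_b\<close>.\<close>

lemma incidence_hyp:
  assumes "nondeg t" "0 < k" "k < 5"
  shows "incidence (\<lambda>t. leg_list t @ outer_list X t) (\<lambda>t. []) t (hyp t k) \<le> 1"
    "incidence (\<lambda>t. leg_list t @ outer_list X t) (\<lambda>t. [edge_h t, edge_t t]) t (hyp t k) \<le> 3"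
    "incidence (\<lambda>t. leg_list t @ outer_list X t @ inner_list X t)
       (\<lambda>t. [edge_h t, edge_t t, edge_a t, edge_c t]) t (hyp t k) \<le> 4"
    "incidence (\<lambda>t. leg_list t @ outer_list X t @ inner_list X t)
       (\<lambda>t. [edge_h t, edge_t t, edge_a t, edge_c t, edge_b t]) t (hyp t k) \<le> 6"
  using assms by (auto simp: incidence_simps pt_inj[OF assms(1)])

lemma incidence_v0:
  assumes "nondeg t"
  shows "incidence (\<lambda>t. leg_list t @ outer_list X t)
       (\<lambda>t. [edge_h t, edge_t t, edge_a t]) t (v0 t) \<le> 2"
    "incidence (\<lambda>t. leg_list t @ outer_list X t)
       (\<lambda>t. [edge_h t, edge_t t, edge_a t, edge_c t]) t (v0 t) \<le> 4"
    "incidence (\<lambda>t. leg_list t @ outer_list X t @ inner_list X t)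
       (\<lambda>t. [edge_h t, edge_t t, edge_a t, edge_c t, edge_b t]) t (v0 t) \<le> 6"
  using assms by (auto simp: incidence_simps pt_inj[OF assms(1)])

lemma incidence_right_or_mid:
  assumes "nondeg t"
  shows "incidence (\<lambda>t. leg_list t @ outer_list X t) (\<lambda>t. [edge_h t, edge_t t]) t (vp t) \<le> 2"
    "incidence (\<lambda>t. leg_list t @ outer_list X t) (\<lambda>t. [edge_h t, edge_t t]) t (vm t) \<le> 6"
  using assms by (auto simp: incidence_simps pt_inj[OF assms(1)])

lemma incidence_stage3:
  assumes "nondeg t"
  shows "incidence (\<lambda>t. leg_list t @ outer_list X t) (\<lambda>t. [edge_h t, edge_t t]) t v \<le> 2 * wt t v"
  by (rule order_trans[OF _ incidence_all[OF assms, of X]]) (simp add: incidence_def)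

section \<open>Degree bounds inside a patch\<close>

locale patch =
  fixes \<Omega> :: frame and n :: nat
  assumes nondeg_root: "nondeg \<Omega>"
begin

text \<open>The members of \<open>X\<close> play the supertiles of level one; the tiles proper are
  their children. The successor supplies the parents used in
  \<open>mid_faces_mid_or_right_angle\<close>.\<close>

definition X :: "frame set" where "X = level \<Omega> (Suc n)"

lemma finite_X: "finite X"
  unfolding X_def by (rule finite_level)

lemma nondeg_X: "t \<in> X \<Longrightarrow> nondeg t"
  unfolding X_def using nondeg_level[OF nondeg_root] .

lemma wt_subset: "S \<subseteq> X \<Longrightarrow> (\<Sum>t\<in>S. wt t v) \<le> wt \<Omega> v"
  unfolding X_def by (rule wt_level_subset[OF nondeg_root])

lemma wt_root_le: "wt \<Omega> v \<le> 8"
  by (rule wt_le[OF nondeg_root])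

lemma wt_others:
  assumes "S \<subseteq> X"
  shows "(\<Sum>t\<in>S. wt t v) + (\<Sum>t\<in>X - S. wt t v) \<le> wt \<Omega> v"
  using wt_subset[of X v] sum.subset_diff[OF assms finite_X, of "\<lambda>t. wt t v"] by simp

text \<open>Tiles in \<open>S\<close> are counted by their actual incidence, all others at twice the
  weight that \<open>S\<close> leaves over. Precise knowledge of one or two tiles at
  \<open>v\<close> thus improves on the bound 8.\<close>

lemma sum_incidence_le:
  assumes "S \<subseteq> X" "\<And>t. t \<in> X \<Longrightarrow> incidence hs fs t v \<le> 2 * wt t v"
  shows "(\<Sum>t\<in>X. incidence hs fs t v) \<le> (\<Sum>t\<in>S. incidence hs fs t v) + 2 * (wt \<Omega> v - (\<Sum>t\<in>S. wt t v))"
proof -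
  have "(\<Sum>t\<in>X. incidence hs fs t v) = (\<Sum>t\<in>X - S. incidence hs fs t v) + (\<Sum>t\<in>S. incidence hs fs t v)"
    by (rule sum.subset_diff[OF assms(1) finite_X])
  also have "(\<Sum>t\<in>X - S. incidence hs fs t v) \<le> (\<Sum>t\<in>X - S. 2 * wt t v)"
    using assms(2) by (intro sum_mono) auto
  also have "\<dots> = 2 * (\<Sum>t\<in>X - S. wt t v)" by (simp add: sum_distrib_left)
  finally show ?thesis using wt_others[OF assms(1), of v] by linarith
qed

lemma deg_all: "deg (stage7 X) v \<le> 8"
proof -
  have "2 * deg (stage7 X) v \<le> 2 * wt \<Omega> v"
    unfolding stage7_def
    using order_trans[OF double_deg_le[OF finite_X]
        sum_incidence_le[OF empty_subsetI incidence_all[OF nondeg_X]], unfolded sum.empty] by simp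
  then show ?thesis using wt_root_le[of v] by linarith
qed

lemma deg_legs: "deg (stage1 X) v \<le> 4"
proof -
  have "2 * deg (stage1 X) v \<le> (\<Sum>t\<in>X. wt t v)"
    unfolding stage1_def
    by (rule order_trans[OF double_deg_le[OF finite_X]]) (intro sum_mono incidence_legs nondeg_X)
  then show ?thesis using wt_subset[of X v] wt_root_le[of v] by auto
qed

lemma matched_X: "matched \<Omega> X leg_pieces" "matched \<Omega> X hyp_piece"
  unfolding X_def using matched_level[OF nondeg_root, of "Suc n"] by blast+

lemma hyp_partner:
  assumes "t \<in> X" "0 < k" "k < 5" "wt \<Omega> (hyp t k) > 4"
  shows "\<exists>s\<in>X. s \<noteq> t \<and> {vq t, vr t} = {vq s, vr s}"
proof -
  have "hyp t k \<in> open_segment (vq t) (vr t)"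
    by (rule pt_in_open_segment[OF nondeg_X[OF assms(1)], where u = "k/5"]) (use assms in auto)
  then show ?thesis
    using matched_X(2) assms(1,4) unfolding matched_def hyp_piece_def by blast
qed

lemma wt_hyp: "t \<in> X \<Longrightarrow> 0 < k \<Longrightarrow> k < 5 \<Longrightarrow> wt t (hyp t k) = 4"
  using wt_pt[OF nondeg_X] by (simp add: corner_weight_def)

lemma hyp_partner_point:
  assumes "{vq t, vr t} = {vq s, vr s}"
  shows "hyp t k = hyp s k \<or> hyp t k = hyp s (5 - k)"
  using assms pt_affine_eq[of t s k] pt_affine_eq_swap[of t s k] by (auto simp: doubleton_eq_iff)

text \<open>At such a point \<open>t\<close> and its partner have weight 4 each, so no third tile
  contributes; on the boundary of \<open>\<Omega>\<close> already \<open>t\<close> exhausts the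
  weight.\<close>

lemma deg_hyp:
  assumes "t \<in> X" "0 < k" "k < 5"
    and all: "\<And>t v. t \<in> X \<Longrightarrow> incidence hs fs t v \<le> 2 * wt t v"
    and own: "\<And>t k. t \<in> X \<Longrightarrow> 0 < k \<Longrightarrow> k < 5 \<Longrightarrow> incidence hs fs t (hyp t k) \<le> m"
  shows "deg (patch_edges X hs fs) (hyp t k) \<le> m"
proof -
  let ?v = "hyp t k"
  have "(\<Sum>t\<in>X. incidence hs fs t ?v) \<le> 2 * m"
  proof (cases "wt \<Omega> ?v > 4")
    case True
    then obtain s where s: "s \<in> X" "s \<noteq> t" "{vq t, vr t} = {vq s, vr s}"
      using hyp_partner[OF assms(1-3)] by blast
    obtain j where j: "0 < j" "j < 5" "?v = hyp s j"
      using hyp_partner_point[OF s(3), of k] assms(2,3) by (metis diff_gt_0_iff_gt diff_less_eq less_add_same_cancel1)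
    have "incidence hs fs t ?v \<le> m" "incidence hs fs s ?v \<le> m"
      using own[OF assms(1-3)] own[OF s(1) j(1,2)] j(3) by simp_all
    moreover have "wt t ?v = 4" "wt s ?v = 4" using wt_hyp assms(1-3) s(1) j by metis+
    ultimately show ?thesis
      using sum_incidence_le[of "{s,t}" hs fs ?v, OF _ all] s(1,2) assms(1) wt_root_le[of ?v] by simp
  next
    case False
    then show ?thesis
      using sum_incidence_le[of "{t}" hs fs ?v, OF _ all] assms(1) own[OF assms(1-3)] wt_hyp[OF assms(1-3)] by simp
  qed
  then show ?thesis using double_deg_le[OF finite_X, of hs fs ?v] by linarith
qed

lemma deg_v0:
  assumes "t \<in> X"
    and all: "\<And>t v. t \<in> X \<Longrightarrow> incidence hs fs t v \<le> 2 * wt t v"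
    and own: "incidence hs fs t (v0 t) \<le> 2 * m"
  shows "deg (patch_edges X hs fs) (v0 t) \<le> m"
proof -
  have "wt t (v0 t) = 8" using wt_pt[OF nondeg_X[OF assms(1)]] by (simp add: corner_weight_def)
  then show ?thesis
    using double_deg_le[OF finite_X, of hs fs "v0 t"] sum_incidence_le[of "{t}" hs fs "v0 t", OF _ all] own
      wt_root_le[of "v0 t"] assms(1) by simp
qed

lemma deg_hyp_stages:
  assumes "t \<in> X" "0 < k" "k < 5"
  shows "deg (stage2 X) (hyp t k) \<le> 1" "deg (stage3 X) (hyp t k) \<le> 3"
    "deg (stage6 X) (hyp t k) \<le> 4" "deg (stage7 X) (hyp t k) \<le> 6"
proof -
  have le: "incidence hs fs s v \<le> 2 * wt s v"
    if "s \<in> X" "incidence hs fs s v \<le> incidence (\<lambda>t. leg_list t @ outer_list X t @ inner_list X t)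
      (\<lambda>t. [edge_h t, edge_t t, edge_a t, edge_c t, edge_b t]) s v" for hs fs s v
    using incidence_all[OF nondeg_X[OF that(1)], of X v] that(2) by linarith
  show "deg (stage2 X) (hyp t k) \<le> 1" unfolding stage2_def
    by (rule deg_hyp[OF assms le incidence_hyp(1)]) (simp_all add: incidence_def nondeg_X)
  show "deg (stage3 X) (hyp t k) \<le> 3" unfolding stage3_def
    by (rule deg_hyp[OF assms le incidence_hyp(2)]) (simp_all add: incidence_def nondeg_X)
  show "deg (stage6 X) (hyp t k) \<le> 4" unfolding stage6_def
    by (rule deg_hyp[OF assms le incidence_hyp(3)]) (simp_all add: incidence_def nondeg_X)
  show "deg (stage7 X) (hyp t k) \<le> 6" unfolding stage7_def
    by (rule deg_hyp[OF assms le incidence_hyp(4)]) (simp_all add: incidence_def nondeg_X)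
qed

lemma deg_v0_stages:
  assumes "t \<in> X"
  shows "deg (stage4 X) (v0 t) \<le> 1" "deg (stage5 X) (v0 t) \<le> 2" "deg (stage7 X) (v0 t) \<le> 3"
proof -
  have le: "incidence hs fs s v \<le> 2 * wt s v"
    if "s \<in> X" "incidence hs fs s v \<le> incidence (\<lambda>t. leg_list t @ outer_list X t @ inner_list X t)
      (\<lambda>t. [edge_h t, edge_t t, edge_a t, edge_c t, edge_b t]) s v" for hs fs s v
    using incidence_all[OF nondeg_X[OF that(1)], of X v] that(2) by linarith
  note own = incidence_v0[OF nondeg_X[OF assms], of X]
  show "deg (stage4 X) (v0 t) \<le> 1" unfolding stage4_def
    by (rule deg_v0[OF assms le]) (use own(1) in \<open>simp_all add: incidence_def\<close>)
  show "deg (stage5 X) (v0 t) \<le> 2" unfolding stage5_def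
    by (rule deg_v0[OF assms le]) (use own(2) in \<open>simp_all add: incidence_def\<close>)
  show "deg (stage7 X) (v0 t) \<le> 3" unfolding stage7_def
    by (rule deg_v0[OF assms le]) (use own(3) in \<open>simp_all add: incidence_def\<close>)
qed

text \<open>A facing centre gives 6 + 6 half edges; a facing right angle gives 6 + 2 and at most 4
  more from the remaining weight 2. Either way twice the degree is at most 12.\<close>

lemma deg_mid:
  assumes "t \<in> X"
  shows "deg (stage3 X) (vm t) \<le> 6"
proof -
  let ?hs = "\<lambda>t. leg_list t @ outer_list X t" and ?fs = "\<lambda>t. [edge_h t, edge_t t]"
  let ?v = "vm t"
  have all: "incidence ?hs ?fs s ?v \<le> 2 * wt s ?v" if "s \<in> X" for s
    by (rule incidence_stage3[OF nondeg_X[OF that]])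
  have own: "incidence ?hs ?fs s (vp s) \<le> 2" "incidence ?hs ?fs s (vm s) \<le> 6" if "s \<in> X" for s
    by (rule incidence_right_or_mid[OF nondeg_X[OF that]])+
  have w: "wt s (vp s) = 2" "wt s (vm s) = 4" if "s \<in> X" for s
    using wt_pt[OF nondeg_X[OF that]] by (simp_all add: corner_weight_def)
  have "(\<Sum>s\<in>X. incidence ?hs ?fs s ?v) \<le> 12"
  proof (cases "wt \<Omega> ?v > 4")
    case True
    then obtain s where s: "s \<in> X" "s \<noteq> t" "vm s = ?v \<or> vp s = ?v"
      using mid_faces_mid_or_right_angle[OF nondeg_root] assms unfolding X_def by blast
    have 1: "(\<Sum>s\<in>X. incidence ?hs ?fs s ?v) \<le>
      (incidence ?hs ?fs s ?v + incidence ?hs ?fs t ?v) + 2 * (wt \<Omega> ?v - (wt s ?v + wt t ?v))"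
      using sum_incidence_le[of "{s,t}" ?hs ?fs ?v, OF _ all] s(1,2) assms by simp
    have 2: "incidence ?hs ?fs t ?v \<le> 6" "wt t ?v = 4" using own w assms by auto
    have "incidence ?hs ?fs s ?v \<le> 6 \<and> wt s ?v = 4 \<or> incidence ?hs ?fs s ?v \<le> 2 \<and> wt s ?v = 2"
      using s(3)
    proof
      assume "vm s = ?v"
      then show ?thesis using own(2)[OF s(1)] w(2)[OF s(1)] by simp
    next
      assume "vp s = ?v"
      then show ?thesis using own(1)[OF s(1)] w(1)[OF s(1)] by simp
    qed
    then show ?thesis using 1 2 wt_root_le[of ?v] by linarith
  next
    case False
    then show ?thesis
      using sum_incidence_le[of "{t}" ?hs ?fs ?v, OF _ all] assms own(2)[OF assms] w(2)[OF assms] by simp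
  qed
  then show ?thesis unfolding stage3_def using double_deg_le[OF finite_X, of ?hs ?fs ?v] by linarith
qed

end

section \<open>Colouring a patch\<close>

lemma patch_edges_diff:
  assumes "e \<in> patch_edges X (\<lambda>t. hs t @ hs' t) (\<lambda>t. fs t @ fs' t)" "e \<notin> patch_edges X hs fs"
  shows "\<exists>t\<in>X. e \<in> set (hs' t) \<union> set (fs' t)"
  using assms unfolding patch_edges_def set_append by blast

lemma patch_edgesD:
  "e \<in> patch_edges X hs fs \<Longrightarrow> \<exists>t\<in>X. e \<in> set (hs t) \<union> set (fs t)"
  unfolding patch_edges_def by blast

context patch
begin

lemma finite_stages:
  "finite (stage1 X)" "finite (stage2 X)" "finite (stage3 X)" "finite (stage4 X)"
  "finite (stage5 X)" "finite (stage6 X)" "finite (stage7 X)"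
  unfolding stage_defs by (rule finite_patch_edges[OF finite_X])+

lemma stage7_in_list:
  assumes "e \<in> stage7 X"
  obtains t where "t \<in> X" "e \<in> set (leg_list t @ outer_list X t @ inner_list X t
    @ [edge_h t, edge_t t, edge_a t, edge_c t, edge_b t])"
  using patch_edgesD[OF assms[unfolded stage7_def]] unfolding set_append by blast

lemma card_stage7:
  assumes "e \<in> stage7 X"
  shows "card e = 2"
proof -
  obtain t where t: "t \<in> X" and e: "e \<in> set (leg_list t @ outer_list X t @ inner_list X t
    @ [edge_h t, edge_t t, edge_a t, edge_c t, edge_b t])"
    using stage7_in_list[OF assms] .
  have "card {pt t a b, pt t c d} = 2" if "a \<noteq> c \<or> b \<noteq> d" for a b c d
    using that by (auto simp: pt_inj[OF nondeg_X[OF t]] card_insert_if)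
  then show ?thesis using e
    unfolding leg_list_def outer_list_def inner_list_def by (auto split: if_splits)
qed

lemma deg_upto:
  "deg (stage2 X) v \<le> 8" "deg (stage3 X) v \<le> 8" "deg (stage4 X) v \<le> 8" "deg (stage5 X) v \<le> 8"
proof -
  have *: "stage2 X \<subseteq> stage7 X" "stage3 X \<subseteq> stage7 X" "stage4 X \<subseteq> stage7 X" "stage5 X \<subseteq> stage7 X"
    using stage_mono[of X] by blast+
  show "deg (stage2 X) v \<le> 8" "deg (stage3 X) v \<le> 8" "deg (stage4 X) v \<le> 8" "deg (stage5 X) v \<le> 8"
    using *[THEN deg_mono[OF finite_stages(7)], of v] deg_all[of v] by linarith+
qed

lemma stage_step:
  assumes "S \<subseteq> S'" "finite S'" "edge_colourable S 8"
    and "\<And>e. e \<in> S' \<Longrightarrow> e \<notin> S \<Longrightarrow> \<exists>x y. e = {x,y} \<and> x \<noteq> y \<and> deg S' x + deg S' y \<le> 9"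
  shows "edge_colourable S' 8"
proof -
  have "S \<union> (S' - S) = S'" using assms(1) by auto
  moreover have "edge_colourable (S \<union> (S' - S)) 8"
    by (rule edge_colourable_greedy) (use assms finite_subset calculation in auto)
  ultimately show ?thesis by simp
qed

lemma deg_stage7_hyp1: "t \<in> X \<Longrightarrow> deg (stage7 X) (hyp t 1) \<le> 6"
  by (rule deg_hyp_stages(4)) simp_all

text \<open>The degree sums of the new edges are at most 4 + 4, 8 + 1, 6 + 3, 8 + 1, 8 + 2, 4 + 4
  and 6 + 3 in the seven stages. Only the fifth exceeds 9 and needs the Kempe argument.\<close>

lemma stage7_colourable: "edge_colourable (stage7 X) 8"
proof -
  have ne: "pt t a b \<noteq> pt t c d" if "t \<in> X" "a \<noteq> c \<or> b \<noteq> d" for t a b c d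
    using that by (simp add: pt_inj[OF nondeg_X])
  have "edge_colourable ({} :: point set set) 8"
    unfolding edge_colourable_def proper_edge_colouring_def by simp
  then have c1: "edge_colourable (stage1 X) 8"
  proof (rule stage_step[rotated 2])
    fix e assume "e \<in> stage1 X"
    then have "e \<in> stage7 X" using stage_mono[of X] by blast
    then obtain x y where "e = {x,y}" "x \<noteq> y" using card_stage7[of e] unfolding card_2_iff by blast
    then show "\<exists>x y. e = {x,y} \<and> x \<noteq> y \<and> deg (stage1 X) x + deg (stage1 X) y \<le> 9"
      using deg_legs[of x] deg_legs[of y] by (intro exI[of _ x] exI[of _ y] conjI) simp_all
  qed (auto simp: finite_stages)
  have c2: "edge_colourable (stage2 X) 8"
  proof (rule stage_step[OF stage_mono(1) finite_stages(2) c1])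
    fix e assume e: "e \<in> stage2 X" "e \<notin> stage1 X"
    have "\<exists>t\<in>X. e \<in> set (outer_list X t)"
      using patch_edges_diff[of e X leg_list "outer_list X" "\<lambda>t. []" "\<lambda>t. []"] e
      unfolding stage1_def stage2_def by simp
    then obtain t where t: "t \<in> X" "e \<in> set (outer_list X t)" by blast
    then have "e = {hyp t 0, hyp t 1} \<or> e = {hyp t 5, hyp t 3} \<or> e = {hyp t 5, hyp t 4}"
      unfolding outer_list_def by (auto split: if_splits)
    moreover have "deg (stage2 X) (hyp t a) + deg (stage2 X) (hyp t b) \<le> 9"
      if "b = 1 \<or> b = 3 \<or> b = 4" for a b
    proof -
      have "deg (stage2 X) (hyp t b) \<le> 1" by (rule deg_hyp_stages(1)[OF t(1)]) (use that in auto)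
      then show ?thesis using deg_upto(1)[of "hyp t a"] by linarith
    qed
    moreover have "hyp t 0 \<noteq> hyp t 1" "hyp t 5 \<noteq> hyp t 3" "hyp t 5 \<noteq> hyp t 4"
      using ne[OF t(1)] by simp_all
    ultimately show "\<exists>x y. e = {x,y} \<and> x \<noteq> y \<and> deg (stage2 X) x + deg (stage2 X) y \<le> 9"
      by metis
  qed
  have c3: "edge_colourable (stage3 X) 8"
  proof (rule stage_step[OF stage_mono(2) finite_stages(3) c2])
    fix e assume e: "e \<in> stage3 X" "e \<notin> stage2 X"
    have "\<exists>t\<in>X. e = edge_h t \<or> e = edge_t t"
      using patch_edges_diff[of e X "\<lambda>t. leg_list t @ outer_list X t" "\<lambda>t. []" "\<lambda>t. []" "\<lambda>t. [edge_h t, edge_t t]"] e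
      unfolding stage3_def stage2_def by simp
    then obtain t where t: "t \<in> X" "e = edge_h t \<or> e = edge_t t" by blast
    moreover have "deg (stage3 X) (vm t) + deg (stage3 X) (hyp t b) \<le> 9" if "b = 1 \<or> b = 3" for b
    proof -
      have "deg (stage3 X) (hyp t b) \<le> 3" by (rule deg_hyp_stages(2)[OF t(1)]) (use that in auto)
      then show ?thesis using deg_mid[OF t(1)] by linarith
    qed
    moreover have "vm t \<noteq> hyp t 1" "vm t \<noteq> hyp t 3" using ne[OF t(1)] by simp_all
    ultimately show "\<exists>x y. e = {x,y} \<and> x \<noteq> y \<and> deg (stage3 X) x + deg (stage3 X) y \<le> 9"
      by metis
  qed
  have c4: "edge_colourable (stage4 X) 8"
  proof (rule stage_step[OF stage_mono(3) finite_stages(4) c3])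
    fix e assume e: "e \<in> stage4 X" "e \<notin> stage3 X"
    have "\<exists>t\<in>X. e = edge_a t"
      using patch_edges_diff[of e X "\<lambda>t. leg_list t @ outer_list X t" "\<lambda>t. []"
          "\<lambda>t. [edge_h t, edge_t t]" "\<lambda>t. [edge_a t]"] e
      unfolding stage3_def stage4_def by simp
    then obtain t where t: "t \<in> X" "e = edge_a t" by blast
    moreover have "vp t \<noteq> v0 t" using ne[OF t(1)] by simp
    ultimately show "\<exists>x y. e = {x,y} \<and> x \<noteq> y \<and> deg (stage4 X) x + deg (stage4 X) y \<le> 9"
      using deg_v0_stages(1)[OF t(1)] deg_upto(3)[of "vp t"]
      by (intro exI[of _ "vp t"] exI[of _ "v0 t"] conjI) auto
  qed
  have c5: "edge_colourable (stage5 X) 8"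
  proof -
    have un: "stage4 X \<union> (stage5 X - stage4 X) = stage5 X" using stage_mono(4)[of X] by auto
    have "edge_colourable (stage4 X \<union> (stage5 X - stage4 X)) 8"
    proof (rule edge_colourable_kempe_set)
      show "card e = 2" if "e \<in> stage4 X \<union> (stage5 X - stage4 X)" for e
        using that un card_stage7 stage_mono(5,6)[of X] by blast
      fix e assume e: "e \<in> stage5 X - stage4 X"
      have "\<exists>t\<in>X. e = edge_c t"
        using patch_edges_diff[of e X "\<lambda>t. leg_list t @ outer_list X t" "\<lambda>t. []"
            "\<lambda>t. [edge_h t, edge_t t, edge_a t]" "\<lambda>t. [edge_c t]"] e
        unfolding stage5_def stage4_def by simp
    then obtain t where t: "t \<in> X" "e = edge_c t" by blast
      \<comment> \<open>The third vertex of the Kempe argument is \<open>hyp t 1\<close>, joined to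
        \<open>vm t\<close> by \<open>edge_h\<close>; it has a spare colour because even its final
        degree is at most 6.\<close>
      have "deg (stage5 X) (hyp t 1) \<le> deg (stage7 X) (hyp t 1)"
        using deg_mono[OF finite_stages(7)] stage_mono(5,6)[of X] by blast
      then have "deg (stage5 X) (hyp t 1) < 8" using deg_stage7_hyp1[OF t(1)] by linarith
      moreover have "edge_h t \<in> stage4 X" using t(1) unfolding stage4_def patch_edges_def by auto
      moreover have "vm t \<noteq> v0 t" "hyp t 1 \<noteq> v0 t" using ne[OF t(1)] by simp_all
      ultimately show "\<exists>x y w. e = {x, y} \<and> x \<noteq> y \<and> deg (stage4 X \<union> (stage5 X - stage4 X)) x \<le> 8 \<and>
          deg (stage4 X \<union> (stage5 X - stage4 X)) y \<le> 2 \<and> w \<noteq> y \<and> {x, w} \<in> stage4 X \<and>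
          deg (stage4 X \<union> (stage5 X - stage4 X)) w < 8"
        unfolding un using t(2) deg_upto(4)[of "vm t"] deg_v0_stages(2)[OF t(1)] by blast
    qed (use c4 finite_stages in auto)
    then show ?thesis unfolding un .
  qed
  have c6: "edge_colourable (stage6 X) 8"
  proof (rule stage_step[OF stage_mono(5) finite_stages(6) c5])
    fix e assume e: "e \<in> stage6 X" "e \<notin> stage5 X"
    have "\<exists>t\<in>X. e \<in> set (inner_list X t)"
      using patch_edges_diff[of e X "\<lambda>t. leg_list t @ outer_list X t" "inner_list X"
          "\<lambda>t. [edge_h t, edge_t t, edge_a t, edge_c t]" "\<lambda>t. []"] e
      unfolding stage5_def stage6_def by simp
    then obtain t where t: "t \<in> X" "e \<in> set (inner_list X t)" by blast
    then have "e = {hyp t 1, hyp t 3} \<or> e = {hyp t 1, hyp t 2} \<or> e = {hyp t 2, hyp t 3} \<or> e = {hyp t 3, hyp t 4}"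
      unfolding inner_list_def by (auto split: if_splits)
    then obtain j k where jk: "e = {hyp t j, hyp t k}" "0 < j" "j < k" "k < 5"
    proof (elim disjE)
      assume "e = {hyp t 1, hyp t 3}"
      then show thesis by (rule that) simp_all
    next
      assume "e = {hyp t 1, hyp t 2}"
      then show thesis by (rule that) simp_all
    next
      assume "e = {hyp t 2, hyp t 3}"
      then show thesis by (rule that) simp_all
    next
      assume "e = {hyp t 3, hyp t 4}"
      then show thesis by (rule that) simp_all
    qed
    have "hyp t j \<noteq> hyp t k" using ne[OF t(1)] jk by simp
    moreover have "deg (stage6 X) (hyp t j) \<le> 4" "deg (stage6 X) (hyp t k) \<le> 4"
      by (rule deg_hyp_stages(3)[OF t(1)]; use jk in simp)+
    ultimately show "\<exists>x y. e = {x,y} \<and> x \<noteq> y \<and> deg (stage6 X) x + deg (stage6 X) y \<le> 9"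
      using jk(1) by (intro exI[of _ "hyp t j"] exI[of _ "hyp t k"] conjI) auto
  qed
  show ?thesis
  proof (rule stage_step[OF stage_mono(6) finite_stages(7) c6])
    fix e assume e: "e \<in> stage7 X" "e \<notin> stage6 X"
    have "\<exists>t\<in>X. e = edge_b t"
      using patch_edges_diff[of e X "\<lambda>t. leg_list t @ outer_list X t @ inner_list X t" "\<lambda>t. []"
          "\<lambda>t. [edge_h t, edge_t t, edge_a t, edge_c t]" "\<lambda>t. [edge_b t]"] e
      unfolding stage7_def stage6_def by simp
    then obtain t where t: "t \<in> X" "e = edge_b t" by blast
    moreover have "hyp t 1 \<noteq> v0 t" using ne[OF t(1)] by simp
    ultimately show "\<exists>x y. e = {x,y} \<and> x \<noteq> y \<and> deg (stage7 X) x + deg (stage7 X) y \<le> 9"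
      using deg_v0_stages(3)[OF t(1)] deg_stage7_hyp1[OF t(1)]
      by (intro exI[of _ "hyp t 1"] exI[of _ "v0 t"] conjI) auto
  qed
qed

end

section \<open>From patches to tilings\<close>

definition tile :: "frame \<Rightarrow> point set" where
  "tile t = convex hull {vp t, vq t, vr t}"

lemma pt_affine_comb:
  assumes "u + v + w = 1"
  shows "u *\<^sub>R vp t + v *\<^sub>R vq t + w *\<^sub>R vr t = pt t v w"
proof -
  have u: "u = 1 - v - w" using assms by simp
  show ?thesis unfolding u pt_def by (simp add: prod_eq_iff algebra_simps)
qed

lemma not_collinear_frame:
  assumes "nondeg t"
  shows "\<not> collinear {vp t, vq t, vr t}"
proof
  assume "collinear {vp t, vq t, vr t}"
  then consider "vp t = vr t" | u where "vq t = u *\<^sub>R vp t + (1 - u) *\<^sub>R vr t"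
    unfolding collinear_3_expand by blast
  then show False
  proof cases
    case 1
    then show False by (simp add: pt_inj[OF assms])
  next
    case (2 u)
    then have "vq t = pt t 0 (1 - u)" using pt_affine_comb[of u 0 "1 - u" t] by simp
    then show False by (simp add: pt_inj[OF assms])
  qed
qed

lemma pt_in_tile:
  assumes "nondeg t"
  shows "pt t x y \<in> tile t \<longleftrightarrow> 0 \<le> x \<and> 0 \<le> y \<and> x + y \<le> 1"
proof
  assume "pt t x y \<in> tile t"
  then obtain u v w where "0 \<le> u" "0 \<le> v" "0 \<le> w" "u + v + w = 1"
    "pt t x y = u *\<^sub>R vp t + v *\<^sub>R vq t + w *\<^sub>R vr t"
    unfolding tile_def convex_hull_3 by blast
  then show "0 \<le> x \<and> 0 \<le> y \<and> x + y \<le> 1"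
    using pt_affine_comb[of u v w t] by (simp add: pt_inj[OF assms])
next
  assume "0 \<le> x \<and> 0 \<le> y \<and> x + y \<le> 1"
  then show "pt t x y \<in> tile t"
    unfolding tile_def convex_hull_3 using pt_affine_comb[of "1 - x - y" x y t]
    by (intro CollectI exI[of _ "1 - x - y"] exI[of _ x] exI[of _ y]) simp
qed

lemma pt_in_interior_tile:
  assumes "nondeg t"
  shows "pt t x y \<in> interior (tile t) \<longleftrightarrow> 0 < x \<and> 0 < y \<and> x + y < 1"
proof -
  have *: "interior (tile t) =
    {v. \<exists>x y z. 0 < x \<and> 0 < y \<and> 0 < z \<and> x + y + z = 1 \<and> x *\<^sub>R vp t + y *\<^sub>R vq t + z *\<^sub>R vr t = v}"
    unfolding tile_def using not_collinear_frame[OF assms]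
    by (rule interior_convex_hull_3_minimal) simp
  show ?thesis
  proof
    assume "pt t x y \<in> interior (tile t)"
    then obtain u v w where "0 < u" "0 < v" "0 < w" "u + v + w = 1"
      "u *\<^sub>R vp t + v *\<^sub>R vq t + w *\<^sub>R vr t = pt t x y"
      unfolding * by blast
    then show "0 < x \<and> 0 < y \<and> x + y < 1"
      using pt_affine_comb[of u v w t] by (simp add: pt_inj[OF assms])
  next
    assume "0 < x \<and> 0 < y \<and> x + y < 1"
    then show "pt t x y \<in> interior (tile t)"
      unfolding * using pt_affine_comb[of "1 - x - y" x y t]
      by (intro CollectI exI[of _ "1 - x - y"] exI[of _ x] exI[of _ y]) simp
  qed
qed

lemma wt_pos_iff:
  assumes "nondeg t"
  shows "0 < wt t z \<longleftrightarrow> z \<in> tile t"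
proof -
  obtain x y where z: "z = pt t x y" using pt_surj[OF assms] .
  show ?thesis unfolding z wt_pt[OF assms] pt_in_tile[OF assms] corner_weight_def by auto
qed

lemma wt_eq_8_iff:
  assumes "nondeg t"
  shows "wt t z = 8 \<longleftrightarrow> z \<in> interior (tile t)"
proof -
  obtain x y where z: "z = pt t x y" using pt_surj[OF assms] .
  show ?thesis unfolding z wt_pt[OF assms] pt_in_interior_tile[OF assms] corner_weight_def by auto
qed

lemma extreme_point_of_tile:
  assumes "nondeg t"
  shows "v extreme_point_of tile t \<longleftrightarrow> v \<in> {vp t, vq t, vr t}"
proof -
  have "\<not> affine_dependent {vp t, vq t, vr t}"
    using not_collinear_frame[OF assms] unfolding collinear_3_eq_affine_dependent by blast
  then show ?thesis unfolding tile_def by (rule extreme_point_of_convex_hull_affine_independent)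
qed

lemma closed_tile: "closed (tile t)"
  unfolding tile_def by (intro compact_imp_closed finite_imp_compact_convex_hull) simp

lemma frontier_tile: "frontier (tile t) = tile t - interior (tile t)"
  unfolding frontier_def using closed_tile closure_closed by metis

lemma wt_corner:
  assumes "nondeg t" "z \<in> {vp t, vq t, vr t}"
  shows "0 < wt t z" "wt t z < 4"
  using assms by (auto simp: wt_pt corner_weight_def)

section \<open>A patch that shows the tiling near the origin\<close>

text \<open>Towards its boundary the patch may bear no relation to \<open>P\<close>, so all
  statements about \<open>P\<close> are confined to the ball.\<close>

locale tiling_patch = patch +
  fixes P :: "point set set" and R :: real
  assumes cover: "\<Union>P = UNIV"
    and shown: "\<And>S. S \<in> P \<Longrightarrow> S \<inter> ball 0 R \<noteq> {} \<Longrightarrow> S \<in> tile ` level \<Omega> (Suc (Suc n))"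
begin

definition Y :: "frame set" where "Y = level \<Omega> (Suc (Suc n))"

lemma finite_Y: "finite Y"
  unfolding Y_def by (rule finite_level)

lemma nondeg_Y: "s \<in> Y \<Longrightarrow> nondeg s"
  unfolding Y_def using nondeg_level[OF nondeg_root] .

lemma Y_iff: "s \<in> Y \<longleftrightarrow> (\<exists>t\<in>X. s \<in> children t)"
  unfolding Y_def X_def by simp

lemma wt_sum_Y: "S \<subseteq> Y \<Longrightarrow> (\<Sum>s\<in>S. wt s z) \<le> wt \<Omega> z"
  unfolding Y_def by (rule wt_level_subset[OF nondeg_root])

lemma ball_tile:
  assumes "z \<in> ball 0 R"
  obtains s where "s \<in> Y" "tile s \<in> P" "z \<in> tile s"
proof -
  obtain S where S: "S \<in> P" "z \<in> S" using cover by blast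
  then obtain s where "s \<in> Y" "S = tile s" using shown[of S] assms unfolding Y_def by blast
  then show ?thesis using S that by blast
qed

text \<open>The converse of \<open>shown\<close>. Some inner point of the tile lies in the ball and
  is covered by a tile of \<open>P\<close>, which belongs to the patch as well; two patch tiles
  overlapping there must coincide.\<close>

lemma tile_in_P:
  assumes "s \<in> Y" "z \<in> tile s" "z \<in> ball 0 R"
  shows "tile s \<in> P"
proof -
  have nd: "nondeg s" using nondeg_Y[OF assms(1)] .
  have "z \<in> closure (interior (tile s))"
  proof -
    have "pt s (1/3) (1/3) \<in> interior (tile s)" using pt_in_interior_tile[OF nd] by simp
    moreover have "convex (tile s)" unfolding tile_def by (rule convex_convex_hull)
    ultimately show ?thesis
      using convex_closure_interior[of "tile s"] assms(2) closure_subset by blast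
  qed
  then have "interior (tile s) \<inter> ball 0 R \<noteq> {}"
    using assms(3) open_Int_closure_eq_empty[OF open_ball, of 0 R "interior (tile s)"] by blast
  then obtain w where w: "w \<in> interior (tile s)" "w \<in> ball 0 R" by blast
  obtain s' where s': "s' \<in> Y" "tile s' \<in> P" "w \<in> tile s'" using ball_tile[OF w(2)] .
  have "wt s w = 8" "0 < wt s' w"
    using w(1) s' wt_eq_8_iff[OF nd] wt_pos_iff[OF nondeg_Y[OF s'(1)]] by auto
  then have "s = s'"
    using level_eqI[OF nondeg_root, of s "Suc (Suc n)" s' w] assms(1) s'(1) wt_root_le[of w]
    unfolding Y_def by simp
  then show ?thesis using s' by simp
qed

lemma vertex_iff:
  assumes "z \<in> ball 0 R"
  shows "z \<in> tiling_vertices P \<longleftrightarrow> (\<exists>s\<in>Y. z \<in> {vp s, vq s, vr s})"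
proof
  assume "z \<in> tiling_vertices P"
  then obtain S where S: "S \<in> P" "z extreme_point_of S" unfolding tiling_vertices_def by blast
  then have "z \<in> S" unfolding extreme_point_of_def by blast
  then obtain s where "s \<in> Y" "S = tile s" using shown[of S] S assms unfolding Y_def by blast
  then show "\<exists>s\<in>Y. z \<in> {vp s, vq s, vr s}" using S(2) extreme_point_of_tile[OF nondeg_Y] by blast
next
  assume "\<exists>s\<in>Y. z \<in> {vp s, vq s, vr s}"
  then obtain s where s: "s \<in> Y" "z \<in> {vp s, vq s, vr s}" by blast
  have "z extreme_point_of tile s" using extreme_point_of_tile[OF nondeg_Y[OF s(1)]] s(2) by blast
  moreover have "tile s \<in> P"
    using tile_in_P[OF s(1) _ assms] calculation unfolding extreme_point_of_def by blast
  ultimately show "z \<in> tiling_vertices P" unfolding tiling_vertices_def by blast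
qed

text \<open>The other tiles shown by the patch form a closed set which covers the ball together
  with \<open>s\<close>, hence contains the frontier points of \<open>s\<close> in the ball.\<close>

lemma wt_root_side:
  assumes "s \<in> Y" "z \<in> ball 0 R" "wt s z = 4"
  shows "wt \<Omega> z > 4"
proof -
  define K where "K = (\<Union>u\<in>Y - {s}. tile u)"
  have "closed K" unfolding K_def using finite_Y closed_tile by auto
  have "z \<in> K"
  proof (rule ccontr)
    assume "z \<notin> K"
    have "open (ball 0 R - K)" using \<open>closed K\<close> by (intro open_Diff) auto
    moreover have "ball 0 R - K \<subseteq> tile s"
    proof
      fix w assume w: "w \<in> ball 0 R - K"
      then obtain u where "u \<in> Y" "w \<in> tile u" using ball_tile[of w] by blast
      then show "w \<in> tile s" using w unfolding K_def by blast
    qed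
    ultimately have "z \<in> interior (tile s)"
      using \<open>z \<notin> K\<close> assms(2) unfolding interior_def by blast
    then show False using wt_eq_8_iff[OF nondeg_Y[OF assms(1)], of z] assms(3) by simp
  qed
  then obtain u where u: "u \<in> Y" "u \<noteq> s" "z \<in> tile u" unfolding K_def by blast
  then have "0 < wt u z" using wt_pos_iff[OF nondeg_Y] by blast
  then show ?thesis using wt_sum_Y[of "{s,u}" z] u assms by simp
qed

text \<open>Two straight angles use up the weight 8, while a corner of a third tile would add to
  it.\<close>

lemma two_sides_no_vertex:
  assumes "z \<in> ball 0 R" "s \<in> Y" "s' \<in> Y" "s \<noteq> s'" "wt s z = 4" "wt s' z = 4"
  shows "z \<notin> tiling_vertices P"
proof
  assume "z \<in> tiling_vertices P"
  then obtain u where u: "u \<in> Y" "z \<in> {vp u, vq u, vr u}" using vertex_iff[OF assms(1)] by blast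
  then have "0 < wt u z" "wt u z < 4" using wt_corner[OF nondeg_Y[OF u(1)] u(2)] by auto
  moreover have "wt s z + wt s' z + wt u z \<le> 8" if "u \<noteq> s" "u \<noteq> s'"
    using wt_sum_Y[of "{s,s',u}" z] assms(2-4) u(1) that wt_root_le[of z] by simp
  ultimately show False using assms(5,6) by fastforce
qed

text \<open>Leaves the centre of a long leg as the only inner point of a side, within the ball, that
  can be a vertex.\<close>

lemma piece_no_vertex:
  assumes "s \<in> Y" "{a,b} \<in> leg_pieces s \<union> hyp_piece s" "z \<in> open_segment a b" "z \<in> ball 0 R"
  shows "z \<notin> tiling_vertices P"
proof -
  have w: "wt s z = 4" using wt_open_piece[OF nondeg_Y[OF assms(1)] assms(2,3)] .
  then have big: "wt \<Omega> z > 4" using wt_root_side assms by blast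
  have "matched \<Omega> Y leg_pieces" "matched \<Omega> Y hyp_piece"
    unfolding Y_def using matched_level[OF nondeg_root, of "Suc (Suc n)"] by blast+
  then obtain s' where s': "s' \<in> Y" "s' \<noteq> s" "{a,b} \<in> leg_pieces s' \<union> hyp_piece s'"
    using assms big unfolding matched_def by (metis UnE UnI1 UnI2)
  then have "wt s' z = 4" using wt_open_piece[OF nondeg_Y] assms(3) by blast
  then show ?thesis using two_sides_no_vertex[of z s s'] assms w s' by blast
qed

lemma rotated_not_mirrored:
  assumes "t \<in> X" "rotated X t"
  shows "\<not> mirrored X t"
proof
  assume "mirrored X t"
  then obtain s where s: "s \<in> X" "s \<noteq> t" "vq s = vq t" "vr s = vr t" unfolding mirrored_def by blast
  obtain u where u: "u \<in> X" "u \<noteq> t" "vq u = vr t" "vr u = vq t" using assms(2) unfolding rotated_def by blast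
  have "s \<noteq> u" using s u pt_inj[OF nondeg_X[OF assms(1)], of 1 0 0 1] by auto
  \<comment> \<open>The centre of the hypotenuse is at position 5/2 in either orientation, so three
    tiles of weight 4 would meet there.\<close>
  let ?z = "hyp t (5/2)"
  have "?z = hyp s (5/2)" by (rule pt_affine_eq[OF s(3,4)[symmetric]])
  moreover have "?z = hyp u (5/2)" using pt_affine_eq_swap[OF u(4,3)[symmetric], of "5/2"] by simp
  ultimately have "wt s ?z = 4" "wt u ?z = 4" "wt t ?z = 4"
    using wt_hyp[of s "5/2"] wt_hyp[of u "5/2"] wt_hyp[of t "5/2"] s u assms(1) by simp_all
  then show False using wt_subset[of "{s,u,t}" ?z] s u assms(1) \<open>s \<noteq> u\<close> wt_root_le[of ?z] by simp
qed

text \<open>A tile and its partner list the same edges, up to reversal of positions in the rotated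
  case, so every listed edge is shared.\<close>

lemma hyp_edge_in_stage7:
  assumes "t \<in> X" "e \<in> set (outer_list X t) \<union> set (inner_list X t)"
  shows "e \<in> stage7 X"
proof -
  have "\<exists>s\<in>X. s \<noteq> t \<and> e \<in> set (outer_list X s) \<union> set (inner_list X s)"
  proof (cases "mirrored X t")
    case True
    then obtain s where s: "s \<in> X" "s \<noteq> t" "vq s = vq t" "vr s = vr t" unfolding mirrored_def by blast
    then have "mirrored X s" unfolding mirrored_def using assms(1) by metis
    moreover have h: "hyp s k = hyp t k" for k by (rule pt_affine_eq[OF s(3,4)])
    ultimately have "outer_list X s = outer_list X t" "inner_list X s = inner_list X t"
      unfolding outer_list_def inner_list_def h using True by simp_all
    then show ?thesis using s assms(2) by auto
  next
    case False
    then have rot: "rotated X t" using assms(2) unfolding outer_list_def inner_list_def by (auto split: if_splits)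
    then obtain s where s: "s \<in> X" "s \<noteq> t" "vq s = vr t" "vr s = vq t" unfolding rotated_def by blast
    then have rs: "rotated X s" unfolding rotated_def using assms(1) by metis
    have h: "hyp s k = hyp t (5 - k)" for k using pt_affine_eq_swap[of s t k] s by blast
    have "set (outer_list X s) = {{hyp s 0, hyp s 1}, {hyp s 4, hyp s 5}}"
      "set (inner_list X s) = {{hyp s 1, hyp s 2}, {hyp s 2, hyp s 3}, {hyp s 3, hyp s 4}}"
      unfolding outer_list_def inner_list_def using rotated_not_mirrored[OF s(1) rs] rs by auto
    then have "set (outer_list X s) = {{hyp t 5, hyp t 4}, {hyp t 1, hyp t 0}}"
      "set (inner_list X s) = {{hyp t 4, hyp t 3}, {hyp t 3, hyp t 2}, {hyp t 2, hyp t 1}}"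
      unfolding h by simp_all
    moreover have "set (outer_list X t) = {{hyp t 0, hyp t 1}, {hyp t 4, hyp t 5}}"
      "set (inner_list X t) = {{hyp t 1, hyp t 2}, {hyp t 2, hyp t 3}, {hyp t 3, hyp t 4}}"
      unfolding outer_list_def inner_list_def using False rot by auto
    ultimately have "set (outer_list X s) = set (outer_list X t)" "set (inner_list X s) = set (inner_list X t)"
      by (simp_all add: insert_commute)
    then show ?thesis using s assms(2) by blast
  qed
  then show ?thesis using assms unfolding stage7_def patch_edges_def set_append by blast
qed

end

lemma open_segment_doubleton: "{a,b} = {c,d} \<Longrightarrow> open_segment a b = open_segment c d"
  by (auto simp: doubleton_eq_iff open_segment_commute)

lemma midpoint_pt: "midpoint (pt t a b) (pt t c d) = pt t ((a + c)/2) ((b + d)/2)"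
  unfolding midpoint_def pt_def by (simp add: prod_eq_iff algebra_simps add_divide_distrib)

text \<open>If no side contained both ends, the midpoint would be an interior point of the
  tile.\<close>

lemma segment_in_side:
  assumes "nondeg s" "u \<noteq> v" "closed_segment u v \<subseteq> frontier (tile s)"
  obtains a b c d where "u = pt s a b" "v = pt s c d" "0 \<le> a" "0 \<le> b" "0 \<le> c" "0 \<le> d"
    "a + b \<le> 1" "c + d \<le> 1" "a = 0 \<and> c = 0 \<or> b = 0 \<and> d = 0 \<or> a + b = 1 \<and> c + d = 1"
proof -
  obtain a b where u: "u = pt s a b" using pt_surj[OF assms(1)] .
  obtain c d where v: "v = pt s c d" using pt_surj[OF assms(1)] .
  have f: "z \<in> tile s" "z \<notin> interior (tile s)" if "z \<in> closed_segment u v" for z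
    using assms(3) that unfolding frontier_tile by blast+
  have "u \<in> tile s" "v \<in> tile s" by (intro f; simp)+
  then have 1: "0 \<le> a" "0 \<le> b" "0 \<le> c" "0 \<le> d" "a + b \<le> 1" "c + d \<le> 1"
    unfolding u v pt_in_tile[OF assms(1)] by auto
  have "midpoint u v \<notin> interior (tile s)" by (intro f) simp
  then have "\<not> (0 < (a + c)/2 \<and> 0 < (b + d)/2 \<and> (a + c)/2 + (b + d)/2 < 1)"
    unfolding u v midpoint_pt pt_in_interior_tile[OF assms(1)] .
  then have "a = 0 \<and> c = 0 \<or> b = 0 \<and> d = 0 \<or> a + b = 1 \<and> c + d = 1"
    using 1 by (simp add: field_simps) linarith
  then show ?thesis using that u v 1 by blast
qed

context tiling_patch
begin

lemma edge_on_tile: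
  assumes "u \<in> tiling_vertices P" "v \<in> tiling_vertices P" "u \<noteq> v" "S \<in> P"
    "closed_segment u v \<subseteq> frontier S" "open_segment u v \<inter> tiling_vertices P = {}"
    "u \<in> ball 0 R" "v \<in> ball 0 R"
  obtains s where "s \<in> Y" "S = tile s" "wt \<Omega> (midpoint u v) > 4"
    "{u,v} = {vq s, vr s} \<or> {u,v} = {vp s, vq s} \<or>
     ({u,v} = {vp s, vm s} \<or> {u,v} = {vm s, vr s}) \<and> vm s \<in> tiling_vertices P \<or>
     {u,v} = {vp s, vr s} \<and> vm s \<notin> tiling_vertices P"
proof -
  have ball: "z \<in> ball 0 R" if "z \<in> closed_segment u v" for z
    using that assms(7,8) closed_segment_subset[OF _ _ convex_ball, of u 0 R v] by blast
  have "u \<in> frontier S" using assms(5) by (meson ends_in_segment(1) subsetD)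
  \<comment> \<open>Needed to pass from the frontier of \<open>S\<close> to \<open>S\<close> itself.
    Tiles shown by the patch are closed, and a set missing the open ball cannot have
    \<open>u\<close> in its closure.\<close>
  moreover have "closed S"
  proof -
    have "S \<in> tile ` level \<Omega> (Suc (Suc n)) \<or> S \<inter> ball 0 R = {}" using shown assms(4) by blast
    then show ?thesis
    proof
      assume "S \<inter> ball 0 R = {}"
      then have "closure S \<inter> ball 0 R = {}"
        using open_Int_closure_eq_empty[OF open_ball, of 0 R S] by blast
      then show ?thesis using \<open>u \<in> frontier S\<close> assms(7) unfolding frontier_def by blast
    qed (auto simp: closed_tile)
  qed
  ultimately have "u \<in> S" unfolding frontier_def by simp
  then obtain s where s: "s \<in> Y" "S = tile s" using shown[OF assms(4)] assms(7) unfolding Y_def by blast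
  have nd: "nondeg s" using nondeg_Y[OF s(1)] .
  obtain a b c d where uv: "u = pt s a b" "v = pt s c d" and pos: "0 \<le> a" "0 \<le> b" "0 \<le> c" "0 \<le> d"
    "a + b \<le> 1" "c + d \<le> 1" and side: "a = 0 \<and> c = 0 \<or> b = 0 \<and> d = 0 \<or> a + b = 1 \<and> c + d = 1"
    using segment_in_side[OF nd assms(3) assms(5)[unfolded s(2)]] .
  have abcd: "a \<noteq> c \<or> b \<noteq> d" using uv assms(3) by auto
  have "wt s (midpoint u v) = 4"
    unfolding uv midpoint_pt wt_pt[OF nd] using pos side abcd
    by (auto simp: corner_weight_def field_simps)
  then have big: "wt \<Omega> (midpoint u v) > 4"
    using wt_root_side[OF s(1)] ball[of "midpoint u v"] by simp
  have nv: "z \<notin> tiling_vertices P" if "{x,y} \<in> leg_pieces s \<union> hyp_piece s" "z \<in> open_segment x y" "z \<in> {u,v}" for x y z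
    using piece_no_vertex[OF s(1) that(1,2)] that(3) assms(7,8) by blast
  have seg: "pt s ((1-k)*x + k*x') ((1-k)*y + k*y') \<in> open_segment (pt s x y) (pt s x' y')"
    if "0 < k" "k < 1" "x \<noteq> x' \<or> y \<noteq> y'" for k x y x' y'
    using pt_in_open_segment[OF nd that(3,1,2)] by simp
  have hypc: "e = 0 \<or> e = 1" if "pt s (1 - e) e \<in> {u,v}" "0 \<le> e" "e \<le> 1" for e
  proof (rule ccontr)
    assume "\<not> (e = 0 \<or> e = 1)"
    then have "pt s (1 - e) e \<in> open_segment (vq s) (vr s)"
      using seg[of e 1 0 0 1] that by simp
    then show False using nv[of "vq s" "vr s" "pt s (1 - e) e"] that(1) assms(1,2)
      unfolding hyp_piece_def by blast
  qed
  have shortc: "e = 0 \<or> e = 1" if "pt s e 0 \<in> {u,v}" "0 \<le> e" "e \<le> 1" for e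
  proof (rule ccontr)
    assume "\<not> (e = 0 \<or> e = 1)"
    then have "pt s e 0 \<in> open_segment (vp s) (vq s)"
      using seg[of e 0 1 0 0] that by simp
    then show False using nv[of "vp s" "vq s" "pt s e 0"] that(1) assms(1,2)
      unfolding leg_pieces_def by blast
  qed
  have longc: "e = 0 \<or> e = 1/2 \<or> e = 1" if "pt s 0 e \<in> {u,v}" "0 \<le> e" "e \<le> 1" for e
  proof (rule ccontr)
    assume *: "\<not> (e = 0 \<or> e = 1/2 \<or> e = 1)"
    show False
    proof (cases "e < 1/2")
      case True
      then have "pt s 0 e \<in> open_segment (vp s) (vm s)"
        using seg[of "2*e" 0 0 0 "1/2"] that * by simp
      then show False using nv[of "vp s" "vm s" "pt s 0 e"] that(1) assms(1,2)
        unfolding leg_pieces_def by blast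
    next
      case False
      then have "pt s 0 ((1 - (2*e-1))*(1/2) + (2*e-1)) \<in> open_segment (vm s) (vr s)"
        using seg[of "2*e-1" 0 0 "1/2" 1] that * by simp
      then have "pt s 0 e \<in> open_segment (vm s) (vr s)" by (simp add: field_simps)
      then show False using nv[of "vm s" "vr s" "pt s 0 e"] that(1) assms(1,2)
        unfolding leg_pieces_def by blast
    qed
  qed
  have "{u,v} = {vq s, vr s} \<or> {u,v} = {vp s, vq s} \<or>
     ({u,v} = {vp s, vm s} \<or> {u,v} = {vm s, vr s}) \<and> vm s \<in> tiling_vertices P \<or>
     {u,v} = {vp s, vr s} \<and> vm s \<notin> tiling_vertices P"
    using side
  proof (elim disjE)
    assume "a = 0 \<and> c = 0"
    then have "b = 0 \<or> b = 1/2 \<or> b = 1" "d = 0 \<or> d = 1/2 \<or> d = 1" "b \<noteq> d"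
      using longc[of b] longc[of d] uv pos abcd by simp_all
    moreover have "u = pt s 0 b" "v = pt s 0 d" using uv \<open>a = 0 \<and> c = 0\<close> by simp_all
    ultimately have "{u,v} = {vp s, vm s} \<or> {u,v} = {vm s, vr s} \<or> {u,v} = {vp s, vr s}"
      by (elim disjE) (simp_all add: insert_commute)
    then show ?thesis
    proof (elim disjE)
      assume e: "{u,v} = {vp s, vm s}"
      then have "vm s \<in> {u,v}" by simp
      then have "vm s \<in> tiling_vertices P" using assms(1,2) by auto
      then show ?thesis using e by simp
    next
      assume e: "{u,v} = {vm s, vr s}"
      then have "vm s \<in> {u,v}" by simp
      then have "vm s \<in> tiling_vertices P" using assms(1,2) by auto
      then show ?thesis using e by simp
    next
      assume e: "{u,v} = {vp s, vr s}"
      have "vm s \<in> open_segment (vp s) (vr s)" using seg[of "1/2" 0 0 0 1] by simp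
      then have "vm s \<notin> tiling_vertices P" using open_segment_doubleton[OF e] assms(6) by blast
      then show ?thesis using e by simp
    qed
  next
    assume "b = 0 \<and> d = 0"
    then have "a = 0 \<or> a = 1" "c = 0 \<or> c = 1" "a \<noteq> c"
      using shortc[of a] shortc[of c] uv pos abcd by simp_all
    moreover have "u = pt s a 0" "v = pt s c 0" using uv \<open>b = 0 \<and> d = 0\<close> by simp_all
    ultimately have "{u,v} = {vp s, vq s}" by (elim disjE) (simp_all add: insert_commute)
    then show ?thesis by simp
  next
    assume "a + b = 1 \<and> c + d = 1"
    then have ac: "a = 1 - b" "c = 1 - d" by simp_all
    then have "b = 0 \<or> b = 1" "d = 0 \<or> d = 1" "b \<noteq> d"
      using hypc[of b] hypc[of d] uv pos abcd by simp_all
    moreover have "u = pt s (1 - b) b" "v = pt s (1 - d) d" using uv ac by simp_all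
    ultimately have "{u,v} = {vq s, vr s}" by (elim disjE) (simp_all add: insert_commute)
    then show ?thesis by simp
  qed
  then show ?thesis using that s big by blast
qed

lemma leg_edge_in_stage7:
  assumes "t \<in> X" "{u,v} \<in> leg_pieces t" "u \<noteq> v" "wt \<Omega> (midpoint u v) > 4"
  shows "{u,v} \<in> stage7 X"
proof -
  have "midpoint u v \<in> open_segment u v" using assms(3) by simp
  then obtain s where "s \<in> X" "s \<noteq> t" "{u,v} \<in> leg_pieces s"
    using matched_X(1) assms unfolding matched_def by blast
  moreover have "leg_pieces r = set (leg_list r)" for r unfolding leg_pieces_def leg_list_def by simp
  ultimately show ?thesis using assms(1,2) unfolding stage7_def patch_edges_def set_append by blast
qed

lemma full_edges_in_stage7:
  assumes "t \<in> X"
  shows "edge_a t \<in> stage7 X" "edge_b t \<in> stage7 X" "edge_c t \<in> stage7 X" "edge_h t \<in> stage7 X"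
    "edge_t t \<in> stage7 X"
  using assms unfolding stage7_def patch_edges_def by auto

lemma hyp_partner_cases:
  assumes "t \<in> X" "0 < k" "k < 5" "wt \<Omega> (hyp t k) > 4"
  obtains s where "s \<in> X" "s \<noteq> t" "mirrored X t" "\<And>k. hyp t k = hyp s k"
  | s where "s \<in> X" "s \<noteq> t" "rotated X t" "\<not> mirrored X t" "\<And>k. hyp t k = hyp s (5 - k)"
proof -
  obtain s where s: "s \<in> X" "s \<noteq> t" "{vq t, vr t} = {vq s, vr s}"
    using hyp_partner[OF assms] by blast
  from s(3) consider "vq t = vq s" "vr t = vr s" | "vq t = vr s" "vr t = vq s"
    by (auto simp: doubleton_eq_iff)
  then show ?thesis
  proof cases
    case 1
    then have "mirrored X t" unfolding mirrored_def using s by metis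
    then show ?thesis using that(1) s pt_affine_eq[OF 1] by blast
  next
    case 2
    then have "rotated X t" unfolding rotated_def using s by metis
    then show ?thesis using that(2) s pt_affine_eq_swap[OF 2] rotated_not_mirrored[OF assms(1)] by blast
  qed
qed

lemma corner_vertex:
  assumes "t \<in> X" "s \<in> children t" "z \<in> {vp s, vq s, vr s}" "z \<in> ball 0 R"
  shows "z \<in> tiling_vertices P"
  using vertex_iff[OF assms(4)] Y_iff assms by blast

lemma mid_mid_no_vertex:
  assumes "t \<in> X" "s \<in> children t" "t' \<in> X" "s' \<in> children t'" "s \<noteq> s'" "vm s = vm s'" "vm s \<in> ball 0 R"
  shows "vm s \<notin> tiling_vertices P"
proof -
  have Y: "s \<in> Y" "s' \<in> Y" using assms Y_iff by blast+
  have "wt r (vm r) = 4" if "r \<in> Y" for r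
    using wt_pt[OF nondeg_Y[OF that]] by (simp add: corner_weight_def)
  then have "wt s (vm s) = 4" "wt s' (vm s) = 4" using Y assms(6) by metis+
  then show ?thesis using two_sides_no_vertex[OF assms(7) Y assms(5)] by blast
qed

lemma children_of_distinct:
  assumes "t \<in> X" "t' \<in> X" "t \<noteq> t'" "s \<in> children t" "s' \<in> children t'"
  shows "s \<noteq> s'"
  using children_disjoint[OF nondeg_root, of t "Suc n" t' s] assms unfolding X_def by blast

text \<open>Treats \<open>fD\<close> and \<open>fE\<close> together, the two children whose long legs lie on the hypotenuse.\<close>

lemma long_leg_on_hyp:
  assumes t: "t \<in> X" "s \<in> children t" "vp s = hyp t 3" "vm s = hyp t k" "vr s = hyp t (2*k - 3)"
    and k: "k = 2 \<and> s = fD t \<or> k = 4 \<and> s = fE t"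
    and big: "wt \<Omega> z > 4" "z = hyp t j" "0 < j" "j < 5"
    and ball: "vm s \<in> ball 0 R"
    and e: "(e = {vp s, vm s} \<or> e = {vm s, vr s}) \<and> vm s \<in> tiling_vertices P \<or>
     e = {vp s, vr s} \<and> vm s \<notin> tiling_vertices P"
  shows "e \<in> stage7 X"
proof (rule hyp_edge_in_stage7[OF t(1)])
  have big': "wt \<Omega> (hyp t j) > 4" using big by simp
  show "e \<in> set (outer_list X t) \<union> set (inner_list X t)"
  proof (cases rule: hyp_partner_cases[OF t(1) big(3,4) big'])
    case (1 t')
    \<comment> \<open>Mirrored: the same child of \<open>t'\<close> has the same long leg, so centre
      faces centre and the leg is undivided.\<close>
    define s' where "s' = (if k = 2 then fD t' else fE t')"
    have s': "s' \<in> children t'" "vm s' = hyp t' k"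
      using k unfolding s'_def children_def by (auto simp: pt_child)
    have "s \<noteq> s'" by (rule children_of_distinct[OF t(1) 1(1) 1(2)[symmetric] t(2) s'(1)])
    moreover have "vm s = vm s'" unfolding t(4) s'(2) by (rule 1(4))
    ultimately have "vm s \<notin> tiling_vertices P"
      by (rule mid_mid_no_vertex[OF t(1,2) 1(1) s'(1) _ _ ball])
    then have "e = {vp s, vr s}" using e by simp
    then have "e = {hyp t 3, hyp t (2*k - 3)}" unfolding t(3,5) .
    then have "e = {hyp t 3, hyp t 1} \<or> e = {hyp t 3, hyp t 5}" using k by (elim disjE) simp_all
    then show ?thesis using 1(3) unfolding outer_list_def inner_list_def
      by (elim disjE) (simp_all add: insert_commute)
  next
    case (2 t')
    \<comment> \<open>Rotated: position 5 - \<open>k\<close> of \<open>t'\<close> is 3 or 1, the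
      right angle of \<open>fD t'\<close> or of \<open>fA t'\<close>, so the leg is halved.\<close>
    define s' where "s' = (if k = 2 then fD t' else fA t')"
    have s': "s' \<in> children t'" "vp s' = hyp t' (5 - k)"
      using k unfolding s'_def children_def by (auto simp: pt_child)
    have "vm s = vp s'" unfolding t(4) s'(2) by (rule 2(5))
    then have "vm s \<in> tiling_vertices P"
      by (intro corner_vertex[OF 2(1) s'(1) _ ball]) simp
    then have "e = {vp s, vm s} \<or> e = {vm s, vr s}" using e by simp
    then have "e = {hyp t 3, hyp t k} \<or> e = {hyp t k, hyp t (2*k - 3)}" unfolding t(3,4,5) .
    then have "e \<in> {{hyp t 3, hyp t 2}, {hyp t 2, hyp t 1}, {hyp t 3, hyp t 4}, {hyp t 4, hyp t 5}}"
      using k by (elim disjE) simp_all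
    then show ?thesis using 2(3,4) unfolding outer_list_def inner_list_def
      by (elim insertE emptyE) (simp_all add: insert_commute)
  qed
qed

lemma midpoint_doubleton: "{u,v} = {a,b} \<Longrightarrow> midpoint u v = midpoint a b"
  by (auto simp: doubleton_eq_iff midpoint_sym)

lemma midpoint_hyp: "midpoint (hyp t a) (hyp t b) = hyp t ((a + b)/2)"
  unfolding midpoint_pt by (rule arg_cong2[of _ _ _ _ "pt t"]) (simp_all add: field_simps)

text \<open>Whether a long leg is halved is settled inside the parent for \<open>fA\<close>, whose
  centre \<open>v0 t\<close> is a corner of \<open>fB t\<close>, and for \<open>fB\<close> and
  \<open>fC\<close>, whose centres coincide. For \<open>fD\<close> and \<open>fE\<close> it depends
  on the tile across the hypotenuse.\<close>

theorem edge_in_stage7: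
  assumes "u \<in> tiling_vertices P" "v \<in> tiling_vertices P" "u \<noteq> v" "S \<in> P"
    "closed_segment u v \<subseteq> frontier S" "open_segment u v \<inter> tiling_vertices P = {}"
    "u \<in> ball 0 R" "v \<in> ball 0 R"
  shows "{u,v} \<in> stage7 X"
proof -
  obtain s where s: "s \<in> Y" "S = tile s" and big: "wt \<Omega> (midpoint u v) > 4"
    and e: "{u,v} = {vq s, vr s} \<or> {u,v} = {vp s, vq s} \<or>
     ({u,v} = {vp s, vm s} \<or> {u,v} = {vm s, vr s}) \<and> vm s \<in> tiling_vertices P \<or>
     {u,v} = {vp s, vr s} \<and> vm s \<notin> tiling_vertices P"
    using edge_on_tile[OF assms] .
  obtain t where t: "t \<in> X" "s \<in> children t" using s(1) Y_iff by blast
  note full = full_edges_in_stage7[OF t(1)]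
  have leg: "{u,v} \<in> stage7 X" if "{u,v} \<in> leg_pieces t"
    using leg_edge_in_stage7[OF t(1) that assms(3) big] .
  have ball: "vm s \<in> ball 0 R" if "{u,v} = {vp s, vr s} \<or> {u,v} = {vp s, vm s} \<or> {u,v} = {vm s, vr s}"
  proof -
    have "vm s \<in> closed_segment u v"
    proof -
      have "vm s = midpoint (vp s) (vr s)" by (simp add: midpoint_pt)
      then show ?thesis using that
      proof (elim disjE)
        assume "{u,v} = {vp s, vr s}"
        then show ?thesis using \<open>vm s = midpoint (vp s) (vr s)\<close> midpoint_doubleton[of u v "vp s" "vr s"]
          midpoint_in_closed_segment[of u v] by simp
      next
        assume "{u,v} = {vp s, vm s}"
        then show ?thesis by (metis ends_in_segment doubleton_eq_iff)
      next
        assume "{u,v} = {vm s, vr s}"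
        then show ?thesis by (metis ends_in_segment doubleton_eq_iff)
      qed
    qed
    then show ?thesis
      using closed_segment_subset[OF assms(7,8) convex_ball] by blast
  qed
  have onhyp: "0 < (a+b)/2 \<and> (a+b)/2 < 5 \<and> midpoint u v = hyp t ((a+b)/2)"
    if "{u,v} = {hyp t a, hyp t b}" "0 \<le> a" "a \<le> 5" "0 \<le> b" "b \<le> 5" for a b
  proof -
    have "a \<noteq> b" using that(1) assms(3) by auto
    then show ?thesis using midpoint_doubleton[OF that(1)] that midpoint_hyp[of t a b] by auto
  qed
  have long: "{u,v} \<in> stage7 X" if k: "k = 2 \<and> s = fD t \<or> k = 4 \<and> s = fE t"
    and e': "({u,v} = {vp s, vm s} \<or> {u,v} = {vm s, vr s}) \<and> vm s \<in> tiling_vertices P \<or>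
     {u,v} = {vp s, vr s} \<and> vm s \<notin> tiling_vertices P" for k :: real
  proof -
    have c: "vp s = hyp t 3" "vm s = hyp t k" "vr s = hyp t (2*k - 3)"
      using k by (auto simp: pt_child)
    have k5: "0 \<le> k" "k \<le> 5" "0 \<le> 2*k - 3" "2*k-3 \<le> 5" using k by auto
    have "\<exists>j. midpoint u v = hyp t j \<and> 0 < j \<and> j < 5"
    proof -
      have "{u,v} = {hyp t 3, hyp t k} \<or> {u,v} = {hyp t k, hyp t (2*k-3)} \<or> {u,v} = {hyp t 3, hyp t (2*k-3)}"
        using e' unfolding c by argo
      then show ?thesis
      proof (elim disjE)
        assume "{u,v} = {hyp t 3, hyp t k}"
        then show ?thesis using onhyp[of 3 k] k5 by (intro exI[of _ "(3 + k)/2"]) simp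
      next
        assume "{u,v} = {hyp t k, hyp t (2*k-3)}"
        then show ?thesis using onhyp[of k "2*k-3"] k5 by (intro exI[of _ "(k + (2*k-3))/2"]) simp
      next
        assume "{u,v} = {hyp t 3, hyp t (2*k-3)}"
        then show ?thesis using onhyp[of 3 "2*k-3"] k5 by (intro exI[of _ "(3 + (2*k-3))/2"]) simp
      qed
    qed
    then obtain j where j: "midpoint u v = hyp t j" "0 < j" "j < 5" by blast
    have "vm s \<in> ball 0 R" by (rule ball) (use e' in argo)
    then show ?thesis using long_leg_on_hyp[OF t c k big j _ e'] by simp
  qed
  consider "s = fA t" | "s = fB t" | "s = fC t" | "s = fD t" | "s = fE t"
    using t(2) unfolding children_def by blast
  then show ?thesis
  proof cases
    case A: 1
    then have c: "vp s = hyp t 1" "vq s = hyp t 0" "vm s = v0 t" "vr s = vp t" by (simp_all add: pt_child)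
    have "v0 t \<in> tiling_vertices P" if "v0 t \<in> ball 0 R"
      by (rule corner_vertex[OF t(1), of "fB t"]) (use that in \<open>simp_all add: children_def pt_child\<close>)
    then have "vm s \<in> tiling_vertices P" if "{u,v} = {vp s, vr s}" using ball that unfolding c by simp
    then have "{u,v} = {vq s, vr s} \<or> {u,v} = {vp s, vq s} \<or> {u,v} = {vp s, vm s} \<or> {u,v} = {vm s, vr s}"
      using e by argo
    then have "{u,v} = {hyp t 0, vp t} \<or> {u,v} = {hyp t 1, hyp t 0} \<or> {u,v} = edge_b t \<or> {u,v} = {v0 t, vp t}"
      unfolding c .
    then show ?thesis
    proof (elim disjE)
      assume "{u,v} = {hyp t 0, vp t}"
      then show ?thesis by (intro leg) (simp add: leg_pieces_def insert_commute)
    next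
      assume h: "{u,v} = {hyp t 1, hyp t 0}"
      have "{u,v} \<in> set (outer_list X t)"
      proof -
        have z: "midpoint u v = hyp t ((1+0)/2)" using onhyp[OF h] by simp
        have big': "wt \<Omega> (hyp t ((1+0)/2)) > 4" using big unfolding z .
        have "mirrored X t \<or> rotated X t"
          by (rule hyp_partner_cases[OF t(1) _ _ big']) simp_all
        then show ?thesis unfolding h outer_list_def by (auto simp: insert_commute)
      qed
      then show ?thesis using hyp_edge_in_stage7[OF t(1)] by blast
    qed (use full in \<open>simp_all add: insert_commute\<close>)
  next
    case B: 2
    then have c: "vp s = v0 t" "vq s = vp t" "vr s = vm t" by (simp_all add: pt_child)
    have "vm s \<notin> tiling_vertices P" if "vm s \<in> ball 0 R"
      by (rule mid_mid_no_vertex[OF t t(1), of "fC t"])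
        (use that B children_distinct[OF nondeg_X[OF t(1)]] in \<open>simp_all add: children_def pt_child\<close>)
    then have "{u,v} = {vq s, vr s} \<or> {u,v} = {vp s, vq s} \<or> {u,v} = {vp s, vr s}" using e ball by argo
    then have "{u,v} = {vp t, vm t} \<or> {u,v} = {v0 t, vp t} \<or> {u,v} = {v0 t, vm t}" unfolding c .
    then show ?thesis
    proof (elim disjE)
      assume "{u,v} = {vp t, vm t}"
      then show ?thesis by (intro leg) (simp add: leg_pieces_def)
    qed (use full in \<open>simp_all add: insert_commute\<close>)
  next
    case C: 3
    then have c: "vp s = v0 t" "vq s = hyp t 1" "vr s = vm t" by (simp_all add: pt_child)
    have "vm s \<notin> tiling_vertices P" if "vm s \<in> ball 0 R"
      by (rule mid_mid_no_vertex[OF t t(1), of "fB t"])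
        (use that C children_distinct[OF nondeg_X[OF t(1)]] in \<open>simp_all add: children_def pt_child\<close>)
    then have "{u,v} = {vq s, vr s} \<or> {u,v} = {vp s, vq s} \<or> {u,v} = {vp s, vr s}" using e ball by argo
    then have "{u,v} = {hyp t 1, vm t} \<or> {u,v} = {v0 t, hyp t 1} \<or> {u,v} = {v0 t, vm t}" unfolding c .
    then show ?thesis using full by (elim disjE) (simp_all add: insert_commute)
  next
    case D: 4
    then have c: "vp s = hyp t 3" "vq s = vm t" "vr s = hyp t 1" by (simp_all add: pt_child)
    have "{u,v} = {vq s, vr s} \<or> {u,v} = {vp s, vq s} \<or> ?thesis"
      using e long[of 2] D by argo
    then have "{u,v} = {vm t, hyp t 1} \<or> {u,v} = {hyp t 3, vm t} \<or> ?thesis" unfolding c .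
    then show ?thesis using full by (elim disjE) (simp_all add: insert_commute)
  next
    case E: 5
    then have c: "vp s = hyp t 3" "vq s = vm t" "vr s = vr t" by (simp_all add: pt_child)
    have "{u,v} = {vq s, vr s} \<or> {u,v} = {vp s, vq s} \<or> ?thesis"
      using e long[of 4] E by argo
    then have "{u,v} = {vm t, vr t} \<or> {u,v} = {hyp t 3, vm t} \<or> ?thesis" unfolding c .
    then show ?thesis
    proof (elim disjE)
      assume "{u,v} = {vm t, vr t}"
      then show ?thesis by (intro leg) (simp add: leg_pieces_def)
    qed (use full in \<open>simp_all add: insert_commute\<close>)
  qed
qed

end

section \<open>Supertiles\<close>

definition map_frame :: "(point \<Rightarrow> point) \<Rightarrow> frame \<Rightarrow> frame" where
  "map_frame f t = (f (vp t), f (vq t), f (vr t))"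

text \<open>Affinity in terms of frames, the form that makes dissection commute with
  \<open>f\<close>.\<close>

definition affine_map :: "(point \<Rightarrow> point) \<Rightarrow> bool" where
  "affine_map f \<longleftrightarrow> (\<forall>t x y. f (pt t x y) = pt (map_frame f t) x y)"

lemma frame_eta: "(vp t, vq t, vr t) = t"
  by (simp add: pt_def)

lemma frame_eqI: "vp s = vp t \<Longrightarrow> vq s = vq t \<Longrightarrow> vr s = vr t \<Longrightarrow> s = t"
  by (metis frame_eta)

lemma map_frame_pt:
  "vp (map_frame f t) = f (vp t)" "vq (map_frame f t) = f (vq t)" "vr (map_frame f t) = f (vr t)"
  by (simp_all add: map_frame_def pt_def)

lemma map_frame_children:
  assumes "affine_map f"
  shows "children (map_frame f t) = map_frame f ` children t"
proof -
  have f: "f (pt t x y) = pt (map_frame f t) x y" for t x y using assms unfolding affine_map_def by blast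
  have "fA (map_frame f t) = map_frame f (fA t)" "fB (map_frame f t) = map_frame f (fB t)"
    "fC (map_frame f t) = map_frame f (fC t)" "fD (map_frame f t) = map_frame f (fD t)"
    "fE (map_frame f t) = map_frame f (fE t)"
    by (rule frame_eqI; simp only: map_frame_pt; simp add: pt_child f)+
  then show ?thesis unfolding children_def by simp
qed

lemma map_frame_level:
  assumes "affine_map f"
  shows "level (map_frame f \<Omega>) n = map_frame f ` level \<Omega> n"
  by (induction n) (simp_all add: map_frame_children[OF assms] image_UN)

lemma tile_eq: "tile t = {pt t x y | x y. 0 \<le> x \<and> 0 \<le> y \<and> x + y \<le> 1}"
proof (intro equalityI subsetI)
  fix z assume "z \<in> tile t"
  then obtain u v w where "0 \<le> u" "0 \<le> v" "0 \<le> w" "u + v + w = 1"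
    "z = u *\<^sub>R vp t + v *\<^sub>R vq t + w *\<^sub>R vr t"
    unfolding tile_def convex_hull_3 by blast
  then show "z \<in> {pt t x y | x y. 0 \<le> x \<and> 0 \<le> y \<and> x + y \<le> 1}"
    using pt_affine_comb[of u v w t] by (intro CollectI exI[of _ v] exI[of _ w]) simp
next
  fix z assume "z \<in> {pt t x y | x y. 0 \<le> x \<and> 0 \<le> y \<and> x + y \<le> 1}"
  then obtain x y where "z = pt t x y" "0 \<le> x" "0 \<le> y" "x + y \<le> 1" by blast
  then show "z \<in> tile t"
    unfolding tile_def convex_hull_3 using pt_affine_comb[of "1 - x - y" x y t]
    by (intro CollectI exI[of _ "1 - x - y"] exI[of _ x] exI[of _ y]) simp
qed

lemma map_frame_tile:
  assumes "affine_map f"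
  shows "tile (map_frame f t) = f ` tile t"
proof -
  have f: "f (pt t x y) = pt (map_frame f t) x y" for x y using assms unfolding affine_map_def by blast
  show ?thesis unfolding tile_eq f[symmetric] by blast
qed

lemma affine_map_scale: "affine_map (\<lambda>z. c *\<^sub>R z)"
  unfolding affine_map_def map_frame_def pt_def by (simp add: algebra_simps)

lemma isometry_linear_part:
  assumes "isometry f"
  shows "orthogonal_transformation (\<lambda>z. f z - f 0)"
  using assms unfolding orthogonal_transformation_isometry isometry_def by (simp add: dist_norm)

lemma affine_map_isometry:
  assumes "isometry f"
  shows "affine_map f"
  unfolding affine_map_def
proof (intro allI)
  fix t x y
  define L where "L z = f z - f 0" for z
  have lin: "linear L"
    using isometry_linear_part[OF assms] unfolding orthogonal_transformation_def L_def by blast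
  have f: "f z = f 0 + L z" for z unfolding L_def by simp
  have *: "f (a + x *\<^sub>R (b - a) + y *\<^sub>R (c - a)) = f a + x *\<^sub>R (f b - f a) + y *\<^sub>R (f c - f a)" for a b c
  proof -
    have "L (a + x *\<^sub>R (b - a) + y *\<^sub>R (c - a)) = L a + x *\<^sub>R (L b - L a) + y *\<^sub>R (L c - L a)"
      by (simp only: linear_add[OF lin] linear_scale[OF lin] linear_diff[OF lin])
    then show ?thesis
      unfolding f[of "a + x *\<^sub>R (b - a) + y *\<^sub>R (c - a)"] f[of a] f[of b] f[of c] by simp
  qed
  show "f (pt t x y) = pt (map_frame f t) x y"
    using *[of "vp t" "vq t" "vr t"] by (simp add: pt_def map_frame_def)
qed

section \<open>Frames of the right shape and isometries\<close>

definition leg_frame :: "real \<Rightarrow> frame \<Rightarrow> bool" where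
  "leg_frame c t \<longleftrightarrow> (vq t - vp t) \<bullet> (vq t - vp t) = c\<^sup>2 \<and> (vr t - vp t) \<bullet> (vr t - vp t) = 4 * c\<^sup>2
     \<and> (vq t - vp t) \<bullet> (vr t - vp t) = 0"

lemma inner_pt_diff:
  assumes "leg_frame c t"
  shows "(pt t a b - pt t a' b') \<bullet> (pt t d e - pt t d' e') = ((a - a') * (d - d') + 4 * (b - b') * (e - e')) * c\<^sup>2"
proof -
  define u v where "u = vq t - vp t" "v = vr t - vp t"
  note uv = this
  have i: "u \<bullet> u = c\<^sup>2" "v \<bullet> v = 4 * c\<^sup>2" "u \<bullet> v = 0" "v \<bullet> u = 0"
    using assms unfolding leg_frame_def uv by (auto simp: inner_commute)
  have *: "pt t a b - pt t a' b' = (a - a') *\<^sub>R u + (b - b') *\<^sub>R v" for a b a' b'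
    unfolding uv pt_def by (simp add: prod_eq_iff algebra_simps)
  show ?thesis unfolding * by (simp add: inner_add_left inner_add_right i) (simp add: algebra_simps)
qed

lemma leg_frame_child:
  assumes "leg_frame c t" "s \<in> children t"
  shows "leg_frame (c / sqrt 5) s"
  using assms(2) unfolding children_def leg_frame_def
  by (elim insertE emptyE; simp add: pt_child inner_pt_diff[OF assms(1)] power_divide field_simps)

lemma leg_frame_level:
  assumes "leg_frame c \<Omega>" "t \<in> level \<Omega> n"
  shows "leg_frame (c / sqrt 5 ^ n) t"
  using assms(2)
proof (induction n arbitrary: t)
  case (Suc n)
  then obtain t' where "t' \<in> level \<Omega> n" "t \<in> children t'" by auto
  then show ?case using leg_frame_child[OF Suc.IH] by (simp add: mult.commute)
qed (use assms in simp)

lemma leg_frame_scale: "leg_frame c t \<Longrightarrow> leg_frame (k * c) (map_frame (\<lambda>z. k *\<^sub>R z) t)"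
  unfolding leg_frame_def map_frame_pt
  by (simp add: power_mult_distrib power2_eq_square flip: scaleR_diff_right)

lemma isometry_inner:
  assumes "isometry f"
  shows "(f a - f b) \<bullet> (f d - f e) = (a - b) \<bullet> (d - e)"
proof -
  have o: "orthogonal_transformation (\<lambda>z. f z - f 0)" using isometry_linear_part[OF assms] .
  then have lin: "linear (\<lambda>z. f z - f 0)" unfolding orthogonal_transformation_def by blast
  have "f a - f b = f (a - b) - f 0" "f d - f e = f (d - e) - f 0"
    using linear_diff[OF lin, of a b] linear_diff[OF lin, of d e] by simp_all
  moreover have "(f v - f 0) \<bullet> (f w - f 0) = v \<bullet> w" for v w
    using o unfolding orthogonal_transformation_def by blast
  ultimately show ?thesis by metis
qed

lemma leg_frame_isometry: "isometry f \<Longrightarrow> leg_frame c t \<Longrightarrow> leg_frame c (map_frame f t)"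
  unfolding leg_frame_def map_frame_pt by (simp add: isometry_inner)

lemma nondeg_leg_frame:
  assumes "leg_frame c t" "c > 0"
  shows "nondeg t"
proof -
  define a b d e where "a = fst (vq t) - fst (vp t)" "b = snd (vq t) - snd (vp t)"
    "d = fst (vr t) - fst (vp t)" "e = snd (vr t) - snd (vp t)"
  note D = this
  have "a * a + b * b = c\<^sup>2" "d * d + e * e = 4 * c\<^sup>2" "a * d + b * e = 0"
    using assms(1) unfolding leg_frame_def D by (simp_all add: inner_prod_def)
  \<comment> \<open>Lagrange's identity: the squared determinant is the product of the squared legs,
    as their inner product vanishes.\<close>
  moreover have "(a * e - b * d)\<^sup>2 + (a * d + b * e)\<^sup>2 = (a * a + b * b) * (d * d + e * e)"
    by (simp add: power2_eq_square algebra_simps)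
  ultimately have "(a * e - b * d)\<^sup>2 = c\<^sup>2 * (4 * c\<^sup>2)" by simp
  then have "a * e - b * d \<noteq> 0" using assms(2) by auto
  then show ?thesis unfolding nondeg_def D .
qed

definition unit_frame :: frame where
  "unit_frame = ((0,0), (1 / sqrt 5) *\<^sub>R (2,-1), (1 / sqrt 5) *\<^sub>R (2,4))"

lemma leg_frame_unit: "leg_frame 1 unit_frame"
  unfolding leg_frame_def unit_frame_def by (simp add: pt_def field_simps)

lemma prototile_eq: "prototile = tile unit_frame"
  unfolding prototile_def tile_def unit_frame_def
  by (simp add: pt_def inverse_eq_divide zero_prod_def)

lemma leg_frame_obtain_isometry:
  assumes "leg_frame 1 t"
  obtains f where "isometry f" "map_frame f unit_frame = t"
proof -
  define u v where "u = vq t - vp t" "v = vr t - vp t"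
  note uv = this
  have i: "u \<bullet> u = 1" "v \<bullet> v = 4" "u \<bullet> v = 0" "v \<bullet> u = 0"
    using assms unfolding leg_frame_def uv by (auto simp: inner_commute)
  \<comment> \<open>The coefficients are the coordinates of \<open>z\<close> in
    \<open>unit_frame\<close>: its components along (2,-1) and (1,2), both normalised, the second
    halved because the long leg has length 2.\<close>
  define f where "f z = vp t + ((2 * fst z - snd z) / sqrt 5) *\<^sub>R u + ((fst z + 2 * snd z) / (2 * sqrt 5)) *\<^sub>R v" for z :: point
  have "(dist (f z) (f w))\<^sup>2 = (dist z w)\<^sup>2" for z w
  proof -
    define a b where "a = fst z - fst w" "b = snd z - snd w"
    note ab = this
    have "f z - f w = ((2 * a - b) / sqrt 5) *\<^sub>R u + ((a + 2 * b) / (2 * sqrt 5)) *\<^sub>R v"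
      unfolding f_def ab by (simp add: prod_eq_iff field_simps)
    then have "(f z - f w) \<bullet> (f z - f w) = ((2 * a - b) / sqrt 5)\<^sup>2 + 4 * ((a + 2 * b) / (2 * sqrt 5))\<^sup>2"
      by (simp add: inner_add_left inner_add_right i power2_eq_square)
    also have "\<dots> = ((2 * a - b)\<^sup>2 + (a + 2 * b)\<^sup>2) / 5" by (simp add: power_divide power_mult_distrib field_simps)
    also have "\<dots> = a * a + b * b" by (simp add: power2_eq_square algebra_simps)
    finally show ?thesis
      unfolding dist_norm power2_norm_eq_inner by (simp add: inner_prod_def ab)
  qed
  then have "isometry f" unfolding isometry_def by simp
  moreover have "map_frame f unit_frame = t"
  proof (rule frame_eqI)
    have v: "vp unit_frame = (0,0)" "vq unit_frame = (2 / sqrt 5, -1 / sqrt 5)" "vr unit_frame = (2 / sqrt 5, 4 / sqrt 5)"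
      by (simp_all add: unit_frame_def pt_def)
    have c: "(2 * (2 / sqrt 5) - -1 / sqrt 5) / sqrt 5 = 1" "(2 / sqrt 5 + 2 * (-1 / sqrt 5)) / (2 * sqrt 5) = 0"
      "(2 * (2 / sqrt 5) - 4 / sqrt 5) / sqrt 5 = 0" "(2 / sqrt 5 + 2 * (4 / sqrt 5)) / (2 * sqrt 5) = 1"
      by (simp_all add: field_simps)
    show "vp (map_frame f unit_frame) = vp t" unfolding map_frame_pt v f_def by simp
    show "vq (map_frame f unit_frame) = vq t" unfolding map_frame_pt v f_def fst_conv snd_conv c uv by simp
    show "vr (map_frame f unit_frame) = vr t" unfolding map_frame_pt v f_def fst_conv snd_conv c uv by simp
  qed
  ultimately show ?thesis using that by blast
qed

text \<open>The corners are the extreme points, and the squared distances 1, 4 and 5 tell them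
  apart.\<close>

lemma leg_frame_unique:
  assumes "leg_frame 1 s" "leg_frame 1 t" "tile s = tile t"
  shows "s = t"
proof -
  have nd: "nondeg s" "nondeg t"
    using nondeg_leg_frame[OF assms(1)] nondeg_leg_frame[OF assms(2)] by simp_all
  have set: "{vp s, vq s, vr s} = {vp t, vq t, vr t}"
    by (rule set_eqI, unfold extreme_point_of_tile[OF nd(1), symmetric] extreme_point_of_tile[OF nd(2), symmetric] assms(3), rule refl)
  define d where "d a b = (a - b) \<bullet> (a - b)" for a b :: point
  have ds: "d (vp r) (vq r) = 1" "d (vp r) (vr r) = 4" "d (vq r) (vr r) = 5"
    "d (vq r) (vp r) = 1" "d (vr r) (vp r) = 4" "d (vr r) (vq r) = 5" "d a a = 0" if "leg_frame 1 r" for r a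
    unfolding d_def inner_pt_diff[OF that] by simp_all
  note s = ds[OF assms(1)] and t = ds[OF assms(2)]
  have mem: "vp s \<in> {vp t, vq t, vr t}" "vq s \<in> {vp t, vq t, vr t}" "vr s \<in> {vp t, vq t, vr t}"
    unfolding set[symmetric] by simp_all
  have p: "vp s = vp t"
  proof (rule ccontr)
    assume "vp s \<noteq> vp t"
    then consider "vp s = vq t" | "vp s = vr t" using mem(1) by blast
    then show False
    proof cases
      case 1
      then have "d (vq t) (vr s) = 4" using s(2) by simp
      then show False using mem(3) t by (elim insertE emptyE) simp_all
    next
      case 2
      then have "d (vr t) (vq s) = 1" using s(1) by simp
      then show False using mem(2) t by (elim insertE emptyE) simp_all
    qed
  qed
  have "d (vp t) (vq s) = 1" "d (vp t) (vr s) = 4" using s(1,2) p by simp_all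
  then have "vq s = vq t" "vr s = vr t" using mem(2,3) t by (elim insertE emptyE; simp)+
  then show ?thesis using frame_eqI p by blast
qed

section \<open>The substitution expressed by frames\<close>

definition root_frame :: frame where
  "root_frame = ((0,0), (2,-1), (2,4))"

lemma root_frame_eq: "root_frame = map_frame (\<lambda>z. sqrt 5 *\<^sub>R z) unit_frame"
  by (rule frame_eqI; simp only: map_frame_pt) (simp_all add: root_frame_def unit_frame_def pt_def)

lemma dissection_eq: "dissection = tile ` children root_frame"
proof -
  have "tile (fA root_frame) = convex hull {(2,-1), (2,0), (0,0)}"
    "tile (fB root_frame) = convex hull {(0,0), (1,0), (1,2)}"
    "tile (fC root_frame) = convex hull {(1,0), (2,0), (1,2)}"
    "tile (fD root_frame) = convex hull {(2,0), (2,2), (1,2)}"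
    "tile (fE root_frame) = convex hull {(1,2), (2,2), (2,4)}"
    unfolding tile_def by (rule arg_cong[of _ _ "\<lambda>S. convex hull S"];
        simp add: pt_child; simp add: root_frame_def pt_def insert_commute)+
  then show ?thesis unfolding dissection_def children_def by simp
qed

lemma isometry_rescale:
  assumes "isometry f"
  shows "isometry (\<lambda>x. sqrt 5 *\<^sub>R f (x /\<^sub>R sqrt 5))"
  unfolding isometry_def
proof (intro allI)
  fix x y
  have scale: "dist (c *\<^sub>R a) (c *\<^sub>R b) = \<bar>c\<bar> * dist a b" for c :: real and a b :: point
    by (simp add: dist_norm flip: scaleR_diff_right)
  have "dist (sqrt 5 *\<^sub>R f (x /\<^sub>R sqrt 5)) (sqrt 5 *\<^sub>R f (y /\<^sub>R sqrt 5)) = sqrt 5 * dist (x /\<^sub>R sqrt 5) (y /\<^sub>R sqrt 5)"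
    using scale[of "sqrt 5" "f (x /\<^sub>R sqrt 5)" "f (y /\<^sub>R sqrt 5)"] assms
    unfolding isometry_def by (metis abs_of_nonneg real_sqrt_ge_zero zero_le_numeral)
  also have "\<dots> = dist x y" unfolding scale by simp
  finally show "dist (sqrt 5 *\<^sub>R f (x /\<^sub>R sqrt 5)) (sqrt 5 *\<^sub>R f (y /\<^sub>R sqrt 5)) = dist x y" .
qed

lemma subst_tile_frame:
  assumes "leg_frame 1 t"
  shows "subst_tile (tile t) = tile ` children (map_frame (\<lambda>z. sqrt 5 *\<^sub>R z) t)"
proof -
  have image: "(\<lambda>S. (\<lambda>x. sqrt 5 *\<^sub>R f (x /\<^sub>R sqrt 5)) ` S) ` dissection
      = tile ` children (map_frame (\<lambda>z. sqrt 5 *\<^sub>R z) t)"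
    if f: "isometry f" "map_frame f unit_frame = t" for f
  proof -
    define F where "F = (\<lambda>x. sqrt 5 *\<^sub>R f (x /\<^sub>R sqrt 5))"
    have aff: "affine_map F" unfolding F_def using affine_map_isometry[OF isometry_rescale[OF f(1)]] .
    have "map_frame F root_frame = map_frame (\<lambda>z. sqrt 5 *\<^sub>R z) t"
      unfolding root_frame_eq f(2)[symmetric] by (rule frame_eqI; simp only: map_frame_pt) (simp_all add: F_def)
    then have "children (map_frame (\<lambda>z. sqrt 5 *\<^sub>R z) t) = map_frame F ` children root_frame"
      using map_frame_children[OF aff, of root_frame] by simp
    then show ?thesis unfolding dissection_eq F_def[symmetric] by (simp add: image_image map_frame_tile[OF aff])
  qed
  have frame: "map_frame f unit_frame = t" if "isometry f" "f ` prototile = tile t" for f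
    using leg_frame_unique[OF leg_frame_isometry[OF that(1) leg_frame_unit] assms]
      map_frame_tile[OF affine_map_isometry[OF that(1)], of unit_frame] that(2) prototile_eq by simp
  obtain f where f: "isometry f" "map_frame f unit_frame = t" using leg_frame_obtain_isometry[OF assms] .
  have fp: "f ` prototile = tile t"
    using map_frame_tile[OF affine_map_isometry[OF f(1)], of unit_frame] f(2) prototile_eq by simp
  show ?thesis
  proof (intro equalityI subsetI)
    fix T assume "T \<in> subst_tile (tile t)"
    then obtain g S where g: "isometry g" "g ` prototile = tile t" "S \<in> dissection"
      "T = (\<lambda>x. sqrt 5 *\<^sub>R g (x /\<^sub>R sqrt 5)) ` S" unfolding subst_tile_def by blast
    then show "T \<in> tile ` children (map_frame (\<lambda>z. sqrt 5 *\<^sub>R z) t)"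
      using image[OF g(1) frame[OF g(1,2)]] by blast
  next
    fix T assume "T \<in> tile ` children (map_frame (\<lambda>z. sqrt 5 *\<^sub>R z) t)"
    then obtain S where "S \<in> dissection" "T = (\<lambda>x. sqrt 5 *\<^sub>R f (x /\<^sub>R sqrt 5)) ` S"
      using image[OF f] by blast
    then show "T \<in> subst_tile (tile t)" unfolding subst_tile_def using f(1) fp by blast
  qed
qed

definition big_frame :: "nat \<Rightarrow> frame" where
  "big_frame n = map_frame (\<lambda>z. sqrt 5 ^ n *\<^sub>R z) unit_frame"

lemma leg_frame_big: "leg_frame (sqrt 5 ^ n) (big_frame n)"
  unfolding big_frame_def using leg_frame_scale[OF leg_frame_unit] by simp

text \<open>Expansion commutes with dissection, so \<open>n\<close> substitutions amount to one
  expansion by \<open>sqrt 5 ^ n\<close> followed by \<open>n\<close> dissections.\<close>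

lemma supertile_eq: "supertile n = tile ` level (big_frame n) n"
proof (induction n)
  case 0
  have "big_frame 0 = unit_frame" unfolding big_frame_def by (rule frame_eqI; simp only: map_frame_pt; simp)
  then show ?case unfolding supertile_def by (simp add: prototile_eq)
next
  case (Suc n)
  let ?s = "\<lambda>z :: point. sqrt 5 *\<^sub>R z"
  have big: "big_frame (Suc n) = map_frame ?s (big_frame n)"
    unfolding big_frame_def by (rule frame_eqI; simp only: map_frame_pt; simp)
  have one: "leg_frame 1 t" if "t \<in> level (big_frame n) n" for t
    using leg_frame_level[OF leg_frame_big that] by simp
  have "supertile (Suc n) = subst (supertile n)" unfolding supertile_def by simp
  also have "\<dots> = (\<Union>t\<in>level (big_frame n) n. subst_tile (tile t))"
    unfolding Suc subst_def by simp
  also have "\<dots> = (\<Union>t\<in>level (big_frame n) n. tile ` children (map_frame ?s t))"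
    using subst_tile_frame[OF one] by simp
  also have "\<dots> = tile ` level (big_frame (Suc n)) (Suc n)"
    unfolding big by (simp add: map_frame_level[OF affine_map_scale] image_UN)
  finally show ?case .
qed

lemma isometry_supertile:
  assumes "isometry f"
  shows "(\<lambda>T. f ` T) ` supertile n = tile ` level (map_frame f (big_frame n)) n"
  unfolding supertile_eq map_frame_level[OF affine_map_isometry[OF assms]]
  by (simp add: image_image map_frame_tile[OF affine_map_isometry[OF assms]])

section \<open>The chromatic index\<close>

lemma dist_pt_squared:
  "leg_frame c t \<Longrightarrow> (dist (pt t a b) (pt t a' b'))\<^sup>2 = ((a - a')\<^sup>2 + 4 * (b - b')\<^sup>2) * c\<^sup>2"
  unfolding dist_norm power2_norm_eq_inner by (subst inner_pt_diff) (simp_all add: power2_eq_square algebra_simps)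

lemma tile_diameter:
  assumes "leg_frame c t" "0 < c" "z \<in> tile t" "w \<in> tile t"
  shows "dist z w \<le> 4 * c"
proof -
  obtain x y where z: "z = pt t x y" "0 \<le> x" "0 \<le> y" "x + y \<le> 1" using assms(3) unfolding tile_eq by blast
  obtain x' y' where w: "w = pt t x' y'" "0 \<le> x'" "0 \<le> y'" "x' + y' \<le> 1" using assms(4) unfolding tile_eq by blast
  have "\<bar>x - x'\<bar> \<le> 1" "\<bar>y - y'\<bar> \<le> 1" using z w by linarith+
  then have "(x - x')\<^sup>2 \<le> 1" "(y - y')\<^sup>2 \<le> 1" unfolding abs_square_le_1 .
  then have "(x - x')\<^sup>2 + 4 * (y - y')\<^sup>2 \<le> 16" by linarith
  then have "((x - x')\<^sup>2 + 4 * (y - y')\<^sup>2) * c\<^sup>2 \<le> 16 * c\<^sup>2" by (rule mult_right_mono) simp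
  then have "(dist z w)\<^sup>2 \<le> (4 * c)\<^sup>2"
    unfolding z(1) w(1) dist_pt_squared[OF assms(1)] by (simp add: power_mult_distrib)
  then show ?thesis by (rule power2_le_imp_le) (use assms(2) in simp)
qed

abbreviation centre :: "frame \<Rightarrow> point" where "centre t \<equiv> pt t (1/3) (1/3)"

lemma centre_ball:
  assumes "leg_frame 1 t"
  shows "ball (centre t) (1/10) \<subseteq> interior (tile t)"
proof
  have nd: "nondeg t" using nondeg_leg_frame[OF assms] by simp
  fix w assume w: "w \<in> ball (centre t) (1/10)"
  obtain x y where xy: "w = pt t x y" using pt_surj[OF nd] .
  have "(dist (centre t) w)\<^sup>2 < (1/10)\<^sup>2" using w by (intro power_strict_mono) auto
  then have *: "(1/3 - x)\<^sup>2 + 4 * (1/3 - y)\<^sup>2 < (1/10)\<^sup>2"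
    unfolding xy dist_pt_squared[OF assms] by simp
  have "(1/3 - x)\<^sup>2 < (1/10)\<^sup>2" "(1/3 - y)\<^sup>2 < (1/10)\<^sup>2"
    using * zero_le_power2[of "1/3 - x"] zero_le_power2[of "1/3 - y"] by linarith+
  then have "\<bar>1/3 - x\<bar> < 1/10" "\<bar>1/3 - y\<bar> < 1/10"
    using power2_less_imp_less[of "\<bar>1/3 - x\<bar>" "1/10"] power2_less_imp_less[of "\<bar>1/3 - y\<bar>" "1/10"] by simp_all
  then show "w \<in> interior (tile t)" unfolding xy pt_in_interior_tile[OF nd] by linarith
qed

lemma is_tile_frame:
  assumes "is_tile S"
  shows "\<exists>t. leg_frame 1 t \<and> S = tile t"
proof -
  obtain f where f: "isometry f" "S = f ` prototile" using assms unfolding is_tile_def by blast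
  have "S = tile (map_frame f unit_frame)"
    unfolding f(2) prototile_eq using map_frame_tile[OF affine_map_isometry[OF f(1)]] by simp
  then show ?thesis using leg_frame_isometry[OF f(1) leg_frame_unit] by blast
qed

text \<open>Balls of radius 1/10 about the centroids fit into the tiles, so the centroids are
  uniformly discrete; they also stay within distance \<open>R\<close> + 4 of the origin. Finiteness
  makes the defining property of pinwheel tilings applicable.\<close>

lemma finite_tiles_meeting_ball:
  assumes "tiling P"
  shows "finite {S \<in> P. S \<inter> ball 0 R \<noteq> {}}"
proof -
  let ?F = "{S \<in> P. S \<inter> ball 0 R \<noteq> {}}"
  define fr where "fr S = (SOME t. leg_frame 1 t \<and> S = tile t)" for S
  have fr: "leg_frame 1 (fr S)" "tile (fr S) = S" if "S \<in> P" for S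
    using someI_ex[OF is_tile_frame[of S]] assms that unfolding tiling_def fr_def by auto
  have far: "dist (centre (fr S)) (centre (fr T)) \<ge> 1/10" if "S \<in> P" "T \<in> P" "S \<noteq> T" for S T
  proof (rule ccontr)
    assume "\<not> ?thesis"
    then have "centre (fr T) \<in> interior (tile (fr S))" "centre (fr T) \<in> interior (tile (fr T))"
      using centre_ball[OF fr(1)[OF that(1)]] centre_ball[OF fr(1)[OF that(2)]] by auto
    then have "interior S \<inter> interior T \<noteq> {}" unfolding fr(2)[OF that(1)] fr(2)[OF that(2)] by blast
    then show False using assms that unfolding tiling_def by blast
  qed
  have inj: "inj_on (\<lambda>S. centre (fr S)) ?F"
  proof (rule inj_onI, rule ccontr)
    fix S T assume "S \<in> ?F" "T \<in> ?F" "centre (fr S) = centre (fr T)" "S \<noteq> T"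
    then show False using far[of S T] by simp
  qed
  have "bounded ((\<lambda>S. centre (fr S)) ` ?F)"
    unfolding bounded_def
  proof (intro exI ballI)
    fix z assume "z \<in> (\<lambda>S. centre (fr S)) ` ?F"
    then obtain S w where S: "S \<in> P" "w \<in> S" "w \<in> ball 0 R" "z = centre (fr S)" by blast
    have "z \<in> tile (fr S)" unfolding S(4) tile_eq
      by (intro CollectI exI[of _ "1/3"]) simp
    then have "dist w z \<le> 4" using tile_diameter[OF fr(1)[OF S(1)], of w z] S(2) fr(2)[OF S(1)] by simp
    then show "dist 0 z \<le> R + 4" using S(3) dist_triangle[of 0 z w] by simp
  qed
  moreover have "uniform_discrete ((\<lambda>S. centre (fr S)) ` ?F)"
  proof (rule uniformI2)
    fix x y assume "x \<in> (\<lambda>S. centre (fr S)) ` ?F" "y \<in> (\<lambda>S. centre (fr S)) ` ?F" "x \<noteq> y"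
    then show "dist x y \<ge> 1/10" using far by blast
  qed simp
  ultimately have "finite ((\<lambda>S. centre (fr S)) ` ?F)" using uniform_discrete_finite_iff by blast
  then show ?thesis using inj by (rule finite_imageD)
qed

lemma card_level_le: "card (level \<Omega> n) \<le> 5 ^ n"
proof (induction n)
  case (Suc n)
  have five: "card (children t) \<le> 5" for t
    unfolding children_def using card_length[of "[fA t, fB t, fC t, fD t, fE t]"] by simp
  have "card (level \<Omega> (Suc n)) \<le> (\<Sum>t\<in>level \<Omega> n. card (children t))"
    by (simp add: card_UN_le[OF finite_level])
  also have "\<dots> \<le> (\<Sum>t\<in>level \<Omega> n. 5)" using five by (intro sum_mono)
  also have "\<dots> = 5 * card (level \<Omega> n)" by simp
  finally show ?case using Suc by simp
qed simp

text \<open>Parents and grandparents of tiles are used throughout, so the patch needs at least two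
  levels; the lower bound on \<open>R\<close> guarantees this.\<close>

lemma pinwheel_patch:
  assumes "pinwheel_tiling P" "100 \<le> R"
  obtains \<Omega> n where "tiling_patch \<Omega> n P R" "leg_frame (sqrt 5 ^ Suc (Suc n)) \<Omega>"
proof -
  have tiling: "tiling P" using assms(1) unfolding pinwheel_tiling_def by blast
  then have cover: "\<Union>P = UNIV" unfolding tiling_def by blast
  define F where "F = {S \<in> P. S \<inter> ball 0 R \<noteq> {}}"
  have fin: "finite F" unfolding F_def using finite_tiles_meeting_ball[OF tiling] .
  moreover have "F \<subseteq> P" unfolding F_def by blast
  ultimately have "\<exists>N f. isometry f \<and> F \<subseteq> (\<lambda>T. f ` T) ` supertile N"
    using assms(1) unfolding pinwheel_tiling_def by blast
  then obtain N f where f: "isometry f" and sub: "F \<subseteq> (\<lambda>T. f ` T) ` supertile N"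
    by blast
  define \<Omega> where "\<Omega> = map_frame f (big_frame N)"
  have leg: "leg_frame (sqrt 5 ^ N) \<Omega>" unfolding \<Omega>_def using leg_frame_isometry[OF f leg_frame_big] .
  have shown: "F \<subseteq> tile ` level \<Omega> N" using sub unfolding isometry_supertile[OF f] \<Omega>_def .
  \<comment> \<open>Six points far apart exclude the two smallest patches.\<close>
  have "\<forall>k. \<exists>S\<in>P. (10 * real k, 0) \<in> S" using cover by blast
  then obtain S where S: "S k \<in> P" "(10 * real k, 0) \<in> S k" for k by metis
  have SF: "S k \<in> F" if "k < 6" for k
  proof -
    have "norm (10 * real k, 0 :: real) = 10 * real k" by (simp add: norm_Pair real_sqrt_mult)
    then have "(10 * real k, 0 :: real) \<in> ball 0 R" unfolding mem_ball_0 using that assms(2) by linarith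
    then have "S k \<inter> ball 0 R \<noteq> {}" using S(2)[of k] by (metis IntI empty_iff)
    then show ?thesis using S(1)[of k] unfolding F_def by simp
  qed
  have injS: "inj S"
  proof (rule injI)
    fix j k assume jk: "S j = S k"
    have "is_tile (S k)" using tiling S(1)[of k] unfolding tiling_def by simp
    then obtain t where t: "leg_frame 1 t" "S k = tile t" using is_tile_frame by blast
    have "dist (10 * real j, 0 :: real) (10 * real k, 0) \<le> 4"
      using tile_diameter[OF t(1), of "(10 * real j, 0)" "(10 * real k, 0)"] S(2)[of j] S(2)[of k] jk t(2) by simp
    then have "\<bar>10 * real j - 10 * real k\<bar> \<le> 4" by (simp add: dist_norm norm_Pair)
    then show "j = k" by linarith
  qed
  have "card (S ` {..<6}) \<le> card F" using SF fin by (intro card_mono) auto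
  moreover have "card (S ` {..<6}) = 6" using injS by (simp add: card_image inj_on_subset)
  moreover have "card F \<le> card (level \<Omega> N)" using shown finite_level[of \<Omega> N] by (meson surj_card_le)
  ultimately have six: "6 \<le> (5::nat) ^ N" using card_level_le[of \<Omega> N] by linarith
  have "N \<noteq> 0" "N \<noteq> 1" by (rule notI; use six in simp)+
  then obtain n where n: "N = Suc (Suc n)" by (metis One_nat_def not0_implies_Suc)
  have "nondeg \<Omega>" using nondeg_leg_frame[OF leg] by simp
  then have "tiling_patch \<Omega> n P R"
    by unfold_locales (use cover shown in \<open>auto simp: F_def n\<close>)
  then show ?thesis using that leg unfolding n by blast
qed

section \<open>A vertex of degree eight\<close>

context tiling_patch
begin

text \<open>The segment between two common corners is a whole side of both tiles. Its inner points
  therefore have weight 4 in each of them and cannot be vertices.\<close>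

lemma corners_edge:
  assumes s: "s \<in> Y" "s' \<in> Y" "s \<noteq> s'" "a \<noteq> b"
    "{a,b} \<subseteq> {vp s, vq s, vr s}" "{a,b} \<subseteq> {vp s', vq s', vr s'}" "a \<in> ball 0 R" "b \<in> ball 0 R"
  shows "{a,b} \<in> tiling_edges P"
proof -
  have wt: "wt u z = 4" if u: "u \<in> Y" "{a,b} \<subseteq> {vp u, vq u, vr u}" and z: "z \<in> open_segment a b" for u z
  proof -
    have nd: "nondeg u" using nondeg_Y[OF u(1)] .
    have "wt u z = 4" if seg: "z \<in> open_segment (pt u x y) (pt u x' y')"
      and xy: "(x,y,x',y') \<in> {(0,0,1,0), (0,0,0,1), (1,0,0,1)}" for x y x' y'
    proof -
      obtain k where k: "0 < k" "k < 1" "z = pt u ((1-k)*x + k*x') ((1-k)*y + k*y')"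
        using open_segment_pt[OF seg] .
      show ?thesis using xy unfolding k(3) wt_pt[OF nd]
        by (elim insertE emptyE Pair_inject; hypsubst)
          (use k(1,2) in \<open>simp_all add: corner_weight_def field_simps\<close>)
    qed
    then have *: "wt u z = 4" if "z \<in> open_segment (vp u) (vq u) \<or> z \<in> open_segment (vp u) (vr u)
        \<or> z \<in> open_segment (vq u) (vr u)" using that by blast
    have "a \<in> {vp u, vq u, vr u}" "b \<in> {vp u, vq u, vr u}" using u(2) by blast+
    then show ?thesis using z s(4)
      by (intro *) (elim insertE emptyE; simp add: open_segment_commute)
  qed
  have ball: "z \<in> ball 0 R" if "z \<in> closed_segment a b" for z
    using that closed_segment_subset[OF s(7,8) convex_ball] by blast
  have "a \<in> tiling_vertices P" "b \<in> tiling_vertices P"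
    using vertex_iff[OF s(7)] vertex_iff[OF s(8)] s(1,5) by blast+
  moreover have "open_segment a b \<inter> tiling_vertices P = {}"
  proof (intro equals0I)
    fix z assume z: "z \<in> open_segment a b \<inter> tiling_vertices P"
    then have "wt s z = 4" "wt s' z = 4" using wt s by blast+
    moreover have "z \<in> ball 0 R" using z ball by (simp add: open_segment_def)
    ultimately show False using two_sides_no_vertex[of z s s'] s z by blast
  qed
  moreover have "tile s \<in> P"
  proof (rule tile_in_P[OF s(1) _ s(7)])
    show "a \<in> tile s" using s(5) wt_corner[OF nondeg_Y[OF s(1)], of a] wt_pos_iff[OF nondeg_Y[OF s(1)], of a] by blast
  qed
  moreover have "closed_segment a b \<subseteq> frontier (tile s)"
  proof
    fix z assume z: "z \<in> closed_segment a b"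
    have "0 < wt s z \<and> wt s z < 8"
    proof (cases "z \<in> {a,b}")
      case True
      then have "z \<in> {vp s, vq s, vr s}" using s(5) by blast
      then show ?thesis using wt_corner[OF nondeg_Y[OF s(1)], of z] by linarith
    next
      case False
      then have "z \<in> open_segment a b" using z unfolding open_segment_def by blast
      then show ?thesis using wt[OF s(1,5)] by simp
    qed
    then show "z \<in> frontier (tile s)"
      unfolding frontier_tile using wt_pos_iff[OF nondeg_Y[OF s(1)], of z] wt_eq_8_iff[OF nondeg_Y[OF s(1)], of z] by auto
  qed
  ultimately show ?thesis unfolding tiling_edges_def using s(4) by blast
qed

text \<open>\<open>fB T\<close> and \<open>fC T\<close> mirror each other in their common long leg,
  whose centre is \<open>v\<close>. Two neighbours of \<open>v\<close> lie on this leg; three more,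
  the points \<open>v0\<close>, \<open>hyp\<close> 1 and \<open>hyp\<close> 3, come from each of the
  two tiles.\<close>

lemma eight_edges_at_mid:
  assumes T: "T \<in> level \<Omega> n" "tile T \<subseteq> ball 0 R"
  obtains v W where "card W = 8" "v \<notin> W" "\<And>w. w \<in> W \<Longrightarrow> {v,w} \<in> tiling_edges P"
proof -
  define t t' where "t = fB T" "t' = fC T"
  note tt' = this
  have nd: "nondeg T" using nondeg_level[OF nondeg_root T(1)] .
  have X: "t \<in> X" "t' \<in> X" unfolding X_def tt' using T(1) by (auto simp: children_def)
  have ne: "t \<noteq> t'" unfolding tt' using children_distinct(5)[OF nd] .
  have ball: "pt T x y \<in> ball 0 R" if "0 \<le> x" "0 \<le> y" "x + y \<le> 1" for x y
    using T(2) pt_in_tile[OF nd] that by blast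
  have Y: "s \<in> Y" if "s \<in> children t \<union> children t'" for s using that X Y_iff by blast
  have c: "fB u \<in> children u" "fC u \<in> children u" "fD u \<in> children u" "fE u \<in> children u" for u
    by (simp_all add: children_def)
  have sib: "fB u \<noteq> fC u" "fC u \<noteq> fD u" "fD u \<noteq> fE u" if "u \<in> X" for u
    using children_distinct[OF nondeg_X[OF that]] by blast+
  have cross: "r \<noteq> r'" if "r \<in> children t" "r' \<in> children t'" for r r'
    using children_of_distinct[OF X ne that] .
  define v where "v = pt T (1/5) (3/10)"
  define W where "W = {vp t, vr t, v0 t, hyp t 1, hyp t 3, v0 t', hyp t' 1, hyp t' 3}"
  have mid: "vm t = v" "vm t' = v" unfolding tt' v_def by (simp_all add: pt_child)
  have Wpt: "W = {pt T (2/5) (1/10), pt T (0) (1/2), pt T (1/5) (1/10), pt T (0) (1/10), pt T (0) (3/10), pt T (13/25) (9/50), pt T (16/25) (13/50), pt T (8/25) (19/50)}"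
    unfolding W_def tt' by (simp add: pt_child)
  have "card W = 8" unfolding Wpt by (simp add: pt_inj[OF nd])
  moreover have vW: "v \<notin> W" unfolding Wpt v_def by (simp add: pt_inj[OF nd])
  moreover have "{v,w} \<in> tiling_edges P" if "w \<in> W" for w
  proof -
    have "v \<in> ball 0 R" unfolding v_def by (rule ball) simp_all
    moreover have "w \<in> ball 0 R"
      using that unfolding Wpt by (elim insertE emptyE; hypsubst; intro ball; simp)
    ultimately have b: "v \<in> ball 0 R" "w \<in> ball 0 R" .
    have vw: "v \<noteq> w" using vW that by blast
    have edge: ?thesis if "r \<in> children t \<union> children t'" "r' \<in> children t \<union> children t'" "r \<noteq> r'"
      "{v,w} \<subseteq> {vp r, vq r, vr r}" "{v,w} \<subseteq> {vp r', vq r', vr r'}" for r r'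
      using corners_edge[OF Y[OF that(1)] Y[OF that(2)] that(3) vw that(4,5) b] .
    have shared: "vp t = vp t'" "vr t = vr t'" unfolding tt' by (simp_all add: pt_child)
    have "w = vp t \<or> w = vr t \<or> (\<exists>u\<in>{t,t'}. w = v0 u \<or> w = hyp u 1 \<or> w = hyp u 3)"
      using that unfolding W_def by blast
    then show ?thesis
    proof (elim disjE bexE)
      assume w: "w = vp t"
      show ?thesis using c[of t] c[of t'] cross w shared mid
        by (intro edge[of "fB t" "fB t'"]) (simp_all add: pt_child)
    next
      assume w: "w = vr t"
      show ?thesis using c[of t] c[of t'] cross w shared mid
        by (intro edge[of "fE t" "fE t'"]) (simp_all add: pt_child)
    next
      fix u assume u: "u \<in> {t,t'}" "w = v0 u"
      show ?thesis using c[of u] sib[of u] u X mid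
        by (intro edge[of "fB u" "fC u"]) (auto simp: pt_child)
    next
      fix u assume u: "u \<in> {t,t'}" "w = hyp u 1"
      show ?thesis using c[of u] sib[of u] u X mid
        by (intro edge[of "fC u" "fD u"]) (auto simp: pt_child)
    next
      fix u assume u: "u \<in> {t,t'}" "w = hyp u 3"
      show ?thesis using c[of u] sib[of u] u X mid
        by (intro edge[of "fD u" "fE u"]) (auto simp: pt_child)
    qed
  qed
  ultimately show ?thesis using that by blast
qed

end

section \<open>The two bounds on the chromatic index\<close>

lemma pinwheel_edge_colourable:
  assumes "pinwheel_tiling P"
  shows "edge_colourable (tiling_edges P) 8"
proof (rule edge_colourable_compactness)
  fix F assume F: "finite F" "F \<subseteq> tiling_edges P"
  have "finite e" if "e \<in> F" for e
  proof -
    have "e \<in> tiling_edges P" using that F(2) by (rule rev_subsetD)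
    then show ?thesis unfolding tiling_edges_def by auto
  qed
  then have "bounded (\<Union>F)" using F(1) by (intro finite_imp_bounded) auto
  then obtain B where B: "\<And>z. z \<in> \<Union>F \<Longrightarrow> norm z \<le> B" unfolding bounded_iff by blast
  define R where "R = max 100 (B + 1)"
  obtain \<Omega> n where "tiling_patch \<Omega> n P R"
    using pinwheel_patch[OF assms, of R] unfolding R_def by (metis max.cobounded1)
  then interpret tiling_patch \<Omega> n P R .
  have "F \<subseteq> stage7 X"
  proof
    fix e assume e: "e \<in> F"
    then have "e \<in> tiling_edges P" using F(2) by (rule rev_subsetD)
    then obtain u v S where uv: "e = {u,v}" "u \<in> tiling_vertices P" "v \<in> tiling_vertices P" "u \<noteq> v"
      "S \<in> P" "closed_segment u v \<subseteq> frontier S" "open_segment u v \<inter> tiling_vertices P = {}"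
      unfolding tiling_edges_def by auto
    have "z \<in> ball 0 R" if "z \<in> e" for z
    proof -
      have "norm z \<le> B" using that e by (intro B) blast
      then show ?thesis unfolding mem_ball_0 R_def by linarith
    qed
    then have "u \<in> ball 0 R" "v \<in> ball 0 R" using uv(1) by simp_all
    then show "e \<in> stage7 X" unfolding uv(1) using edge_in_stage7[OF uv(2-7)] by simp
  qed
  then show "edge_colourable F 8" using edge_colourable_subset[OF stage7_colourable] by simp
qed

lemma pinwheel_vertex_of_degree_8:
  assumes "pinwheel_tiling P"
  obtains v W where "card W = 8" "v \<notin> W" "\<And>w. w \<in> W \<Longrightarrow> {v,w} \<in> tiling_edges P"
proof -
  obtain \<Omega> n where "tiling_patch \<Omega> n P 100" and leg: "leg_frame (sqrt 5 ^ Suc (Suc n)) \<Omega>"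
    by (rule pinwheel_patch[OF assms order_refl])
  then interpret tiling_patch \<Omega> n P 100 by simp
  obtain s where s: "s \<in> Y" "0 \<in> tile s" by (rule ball_tile[of 0]) simp_all
  obtain t where t: "t \<in> X" "s \<in> children t" using s(1) Y_iff by blast
  obtain T where T: "T \<in> level \<Omega> n" "t \<in> children T" using t(1) unfolding X_def by auto
  have nd: "nondeg T" using nondeg_level[OF nondeg_root T(1)] .
  have "0 < wt s 0" using wt_pos_iff[OF nondeg_Y[OF s(1)]] s(2) by simp
  also have "\<dots> \<le> wt t 0" by (rule wt_child_le[OF nondeg_X[OF t(1)] t(2)])
  also have "\<dots> \<le> wt T 0" by (rule wt_child_le[OF nd T(2)])
  finally have 0: "0 \<in> tile T" using wt_pos_iff[OF nd] by simp
  \<comment> \<open>\<open>T\<close> is two levels above the tiles, hence of scale 5 and diameter at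
    most 20. It contains the origin, so it lies well inside the ball of radius 100.\<close>
  have "sqrt 5 ^ Suc (Suc n) / sqrt 5 ^ n = 5" by simp
  then have "leg_frame 5 T" using leg_frame_level[OF leg T(1)] by simp
  then have "dist 0 z \<le> 20" if "z \<in> tile T" for z using tile_diameter[of 5 T 0 z] 0 that by simp
  then have "tile T \<subseteq> ball 0 100" by fastforce
  then show ?thesis using eight_edges_at_mid[OF T(1)] that by blast
qed

theorem theorem6p7:
  fixes P :: "(real \<times> real) set set"
  assumes "pinwheel_tiling P"
  shows "chromatic_index (tiling_edges P) = 8"
proof -
  have lower: "8 \<le> k" if "edge_colourable (tiling_edges P) k" for k
  proof -
    obtain c :: "(real \<times> real) set \<Rightarrow> nat"
      where c: "c ` tiling_edges P \<subseteq> {..<k}" "proper_edge_colouring (tiling_edges P) c"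
      using \<open>edge_colourable (tiling_edges P) k\<close> unfolding edge_colourable_def by blast
    obtain v W where W: "card W = 8" "v \<notin> W" and edge: "\<And>w. w \<in> W \<Longrightarrow> {v,w} \<in> tiling_edges P"
      using pinwheel_vertex_of_degree_8[OF assms] by blast
    have "inj_on (\<lambda>w. c {v,w}) W"
    proof (rule inj_onI)
      fix x y assume xy: "x \<in> W" "y \<in> W" "c {v,x} = c {v,y}"
      have "{v,x} = {v,y}"
        by (rule proper_edge_colouring_unique[OF c(2) edge[OF xy(1)] edge[OF xy(2)] _ _ xy(3), of v]) simp_all
      then show "x = y" by (auto simp: doubleton_eq_iff)
    qed
    moreover have "(\<lambda>w. c {v,w}) ` W \<subseteq> {..<k}" using c(1) edge by blast
    ultimately show ?thesis using card_inj_on_le[of "\<lambda>w. c {v,w}" W "{..<k}"] W(1) by simp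
  qed
  have "chromatic_index (tiling_edges P) = Inf {enat k | k. edge_colourable (tiling_edges P) k}"
    unfolding chromatic_index_def edge_colourable_def ..
  also have "\<dots> = enat 8"
  proof (rule antisym)
    show "Inf {enat k | k. edge_colourable (tiling_edges P) k} \<le> enat 8"
      using pinwheel_edge_colourable[OF assms] by (intro Inf_lower) blast
    show "enat 8 \<le> Inf {enat k | k. edge_colourable (tiling_edges P) k}"
      by (rule Inf_greatest) (auto dest: lower)
  qed
  finally show ?thesis by (simp add: numeral_eq_enat)
qed

end
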